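(* Let $\mathfrak g=\bigoplus_{i\in\mathbb Z}\mathfrak g_i$ be a graded semisimple Lie algebra as in the context, such that $2H_0$ is 1-simple. Suppose that the prehomogeneous space $(\mathfrak g_0,\mathfrak g_1,H_0)$ is 1-irreducible (i.e. it admits a unique fundamental relative invariant) and that it admits a very special 1-simple element. Then $\mathfrak g_p=\{0\}$ for $|p|\ge3$.
   Context: $\mathbb F$ is a local field of characteristic $0$; $\mathfrak g=\bigoplus_{i\in\mathbb Z}\mathfrak g_i$ is a finite-dimensional semisimple $\mathbb Z$-graded Lie algebra over $\mathbb F$, with $H_0\in\mathfrak g_0$ such that $\mathfrak g_i=\{x:[H_0,x]=ix\}$. $G$ is the centralizer of $H_0$ in $\mathrm{Aut}_0(\mathfrak g)$, the group of automorphisms of $\mathfrak g$ which become elementary over an algebraic closure; it acts on $\mathfrak g_1$ (geometrically prehomogeneous action, denoted $(\mathfrak g_0,\mathfrak g_1,H_0)$). A relative invariant is a polynomial $F$ on $\mathfrak g_1$ with $F(gx)=\chi(g)F(x)$ for a character $\chi$ of $G$; "1-irreducible" means that, up to a scalar, there is exactly one fundamental (irreducible, non-constant) relative invariant, so that every relatively invariant polynomial is, up to a scalar, a power of it. An $sl_2$-triple is a nonzero triple $(x,h,y)$ with $[x,y]=-h$, $[h,x]=2x$, $[h,y]=-2y$; $h$ is 1-simple if it belongs to an $sl_2$-triple with $x\in\mathfrak g_1$, $y\in\mathfrak g_{-1}$. With $E_i(h)=\{x\in\mathfrak g:[h,x]=ix\}$, put $\mathfrak p(h)=\bigoplus_{i\ge0}E_i(h)$,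 $\mathfrak n(h)=\bigoplus_{i>0}E_i(h)$. A 1-simple $h$ is special if $\mathfrak n(2H_0)\subset\mathfrak p(h)$, and $h$ is very special if both $h$ and $2H_0-h$ are 1-simple and special. *)

theory Defs
  imports
    "HOL-Analysis.Abstract_Topological_Spaces"
    "HOL-Algebra.Algebraic_Closure_Type"
    "HOL-Algebra.Ring_Divisibility"
    "HOL-Algebra.Generated_Groups"
    "HOL-Algebra.Bij"
begin

section \<open>Local fields\<close>

text \<open>
  A local field is a non-discrete locally compact Hausdorff topological field.
  In characteristic 0 these are the fields of real and complex numbers and the finite
  extensions of the p-adic numbers.
\<close>

definition local_field :: "'k::field topology \<Rightarrow> bool" where
  "local_field T \<longleftrightarrow>
     topspace T = UNIV \<and> Hausdorff_space T \<and> locally_compact_space T \<and>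
     T \<noteq> discrete_topology UNIV \<and>
     continuous_map (prod_topology T T) T (\<lambda>(a, b). a + b) \<and>
     continuous_map T T uminus \<and>
     continuous_map (prod_topology T T) T (\<lambda>(a, b). a * b) \<and>
     continuous_map (subtopology T (- {0})) T inverse"


section \<open>Polynomials on a subspace of a finite-dimensional vector space\<close>

text \<open>
  Over an infinite field, polynomials on a finite-dimensional space \<open>W\<close> are the same as
  polynomial functions on \<open>W\<close>: the algebra of functions generated by the constants and the
  linear functionals. Every linear functional on the subspace \<open>W\<close> is the restriction of one
  on the ambient space. Functions are made extensional (\<open>undefined\<close> outside \<open>W\<close>), so
  that equality of polynomials is equality on \<open>W\<close>.
\<close>

inductive_set polynomial_functions ::
    "('k::field \<Rightarrow> 'v::ab_group_add \<Rightarrow> 'v) \<Rightarrow> 'v set \<Rightarrow> ('v \<Rightarrow> 'k) set"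
  for smul :: "'k \<Rightarrow> 'v \<Rightarrow> 'v" and W :: "'v set"
where
  const: "(\<lambda>x\<in>W. c) \<in> polynomial_functions smul W"
| functional: "Vector_Spaces.linear smul (*) f
    \<Longrightarrow> (\<lambda>x\<in>W. f x) \<in> polynomial_functions smul W"
| add: "\<lbrakk>p \<in> polynomial_functions smul W; q \<in> polynomial_functions smul W\<rbrakk>
    \<Longrightarrow> (\<lambda>x\<in>W. p x + q x) \<in> polynomial_functions smul W"
| mult: "\<lbrakk>p \<in> polynomial_functions smul W; q \<in> polynomial_functions smul W\<rbrakk>
    \<Longrightarrow> (\<lambda>x\<in>W. p x * q x) \<in> polynomial_functions smul W"

definition polynomial_ring ::
    "('k::field \<Rightarrow> 'v::ab_group_add \<Rightarrow> 'v) \<Rightarrow> 'v set \<Rightarrow> ('v \<Rightarrow> 'k) ring" where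
  "polynomial_ring smul W =
     \<lparr>carrier = polynomial_functions smul W,
      monoid.mult = (\<lambda>p q. \<lambda>x\<in>W. p x * q x),
      one = (\<lambda>x\<in>W. 1),
      ring.zero = (\<lambda>x\<in>W. 0),
      add = (\<lambda>p q. \<lambda>x\<in>W. p x + q x)\<rparr>"


section \<open>Lie algebras\<close>

text \<open>The basis is only used to write down the extension of scalars below.\<close>

locale lie_algebra = finite_dimensional_vector_space smul Basis
  for smul :: "'k::field_char_0 \<Rightarrow> 'v::ab_group_add \<Rightarrow> 'v"
    and Basis :: "'v set" +
  fixes bracket :: "'v \<Rightarrow> 'v \<Rightarrow> 'v"
  assumes bracket_linear_left: "Vector_Spaces.linear smul smul (\<lambda>x. bracket x y)"
    and bracket_linear_right: "Vector_Spaces.linear smul smul (\<lambda>y. bracket x y)"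
    and bracket_self: "bracket x x = 0"
    and jacobi: "bracket x (bracket y z) + bracket y (bracket z x) + bracket z (bracket x y) = 0"
begin

definition ideal :: "'v set \<Rightarrow> bool" where
  "ideal I \<longleftrightarrow> subspace I \<and> (\<forall>x. \<forall>y\<in>I. bracket x y \<in> I)"

definition derived :: "'v set \<Rightarrow> 'v set" where
  "derived I = span {bracket x y | x y. x \<in> I \<and> y \<in> I}"

definition solvable :: "'v set \<Rightarrow> bool" where
  "solvable I \<longleftrightarrow> (\<exists>n. (derived ^^ n) I = {0})"

definition semisimple :: bool where
  "semisimple \<longleftrightarrow> (\<forall>I. ideal I \<and> solvable I \<longrightarrow> I = {0})"

definition automorphisms :: "('v \<Rightarrow> 'v) set" where
  "automorphisms =
     {s. Vector_Spaces.linear smul smul s \<and> bij s \<and>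
         (\<forall>x y. s (bracket x y) = bracket (s x) (s y))}"

text \<open>
  Extension of scalars to the algebraic closure. An element of the extended algebra is its
  family of coordinates with respect to \<open>Basis\<close>, i.e. a function supported on \<open>Basis\<close>
  with values in the algebraic closure; the bracket is given by the same structure constants
  as over the base field.
\<close>

definition ext_space :: "('v \<Rightarrow> 'k alg_closure) set" where
  "ext_space = {u. \<forall>b. b \<notin> Basis \<longrightarrow> u b = 0}"

definition ext_bracket ::
    "('v \<Rightarrow> 'k alg_closure) \<Rightarrow> ('v \<Rightarrow> 'k alg_closure) \<Rightarrow> ('v \<Rightarrow> 'k alg_closure)" where
  "ext_bracket u w =
     (\<lambda>b. \<Sum>x\<in>Basis. \<Sum>y\<in>Basis. u x * w y * to_ac (representation Basis (bracket x y) b))"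

definition ext_map ::
    "('v \<Rightarrow> 'v) \<Rightarrow> ('v \<Rightarrow> 'k alg_closure) \<Rightarrow> ('v \<Rightarrow> 'k alg_closure)" where
  "ext_map s = (\<lambda>u\<in>ext_space. \<lambda>b. \<Sum>x\<in>Basis. u x * to_ac (representation Basis (s x) b))"

definition ext_nilpotent ::
    "(('v \<Rightarrow> 'k alg_closure) \<Rightarrow> ('v \<Rightarrow> 'k alg_closure)) \<Rightarrow> bool" where
  "ext_nilpotent N \<longleftrightarrow> (\<exists>m. \<forall>u\<in>ext_space. (N ^^ m) u = (\<lambda>b. 0))"

text \<open>
  Exponential of a nilpotent endomorphism. The terms of the exponential series at \<open>u\<close>
  vanish from some index on, and only the non-zero ones are summed.
\<close>

definition ext_exp ::
    "(('v \<Rightarrow> 'k alg_closure) \<Rightarrow> ('v \<Rightarrow> 'k alg_closure))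
      \<Rightarrow> ('v \<Rightarrow> 'k alg_closure) \<Rightarrow> ('v \<Rightarrow> 'k alg_closure)" where
  "ext_exp N =
     (\<lambda>u\<in>ext_space. \<lambda>b. \<Sum>n | (N ^^ n) u \<noteq> (\<lambda>b. 0). (N ^^ n) u b / fact n)"

text \<open>
  The elementary automorphisms form the group generated by the \<open>exp (ad x)\<close> with \<open>ad x\<close>
  nilpotent.
\<close>

definition ext_elementary_automorphisms ::
    "(('v \<Rightarrow> 'k alg_closure) \<Rightarrow> ('v \<Rightarrow> 'k alg_closure)) set" where
  "ext_elementary_automorphisms =
     generate (BijGroup ext_space)
       {ext_exp (ext_bracket x) | x. x \<in> ext_space \<and> ext_nilpotent (ext_bracket x)}"

text \<open>Automorphisms that become elementary over the algebraic closure.\<close>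

definition Aut0 :: "('v \<Rightarrow> 'v) set" where
  "Aut0 = {s \<in> automorphisms. ext_map s \<in> ext_elementary_automorphisms}"

definition eigenspace :: "'v \<Rightarrow> int \<Rightarrow> 'v set" where
  "eigenspace h i = {x. bracket h x = smul (of_int i) x}"

definition parabolic :: "'v \<Rightarrow> 'v set" where
  "parabolic h = span (\<Union>i\<in>{0..}. eigenspace h i)"

definition nilradical :: "'v \<Rightarrow> 'v set" where
  "nilradical h = span (\<Union>i\<in>{0<..}. eigenspace h i)"

text \<open>The sign in \<open>[x, y] = -h\<close> is Bourbaki's convention.\<close>

definition sl2_triple :: "'v \<Rightarrow> 'v \<Rightarrow> 'v \<Rightarrow> bool" where
  "sl2_triple x h y \<longleftrightarrow>
     (x, h, y) \<noteq> (0, 0, 0) \<and>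
     bracket x y = - h \<and> bracket h x = smul 2 x \<and> bracket h y = smul (- 2) y"

end


section \<open>Graded semisimple Lie algebras\<close>

locale graded_semisimple_lie_algebra = lie_algebra smul Basis bracket
  for smul :: "'k::field_char_0 \<Rightarrow> 'v::ab_group_add \<Rightarrow> 'v"
    and Basis :: "'v set"
    and bracket :: "'v \<Rightarrow> 'v \<Rightarrow> 'v" +
  fixes gr :: "int \<Rightarrow> 'v set" and H0 :: 'v
  assumes semisimple: "semisimple"
    and gr_subspace: "subspace (gr i)"
    and gr_span: "span (\<Union>i. gr i) = UNIV"
    and gr_direct: "\<lbrakk>finite I; \<And>i. i \<in> I \<Longrightarrow> x i \<in> gr i; (\<Sum>i\<in>I. x i) = 0; i \<in> I\<rbrakk>
                    \<Longrightarrow> x i = 0"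
    and gr_bracket: "\<lbrakk>x' \<in> gr i; y' \<in> gr j\<rbrakk> \<Longrightarrow> bracket x' y' \<in> gr (i + j)"
    and H0_in_gr0: "H0 \<in> gr 0"
    and gr_eigenspace: "gr i = {z. bracket H0 z = smul (of_int i) z}"
begin

definition G :: "('v \<Rightarrow> 'v) set" where
  "G = {s \<in> Aut0. s H0 = H0}"

definition character :: "(('v \<Rightarrow> 'v) \<Rightarrow> 'k) \<Rightarrow> bool" where
  "character \<xi> \<longleftrightarrow>
     (\<forall>s\<in>G. \<xi> s \<noteq> 0) \<and> (\<forall>s\<in>G. \<forall>t\<in>G. \<xi> (s \<circ> t) = \<xi> s * \<xi> t)"

definition relative_invariant :: "('v \<Rightarrow> 'k) \<Rightarrow> bool" where
  "relative_invariant F \<longleftrightarrow>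
     F \<in> polynomial_functions smul (gr 1) \<and>
     (\<exists>\<xi>. character \<xi> \<and> (\<forall>s\<in>G. \<forall>x\<in>gr 1. F (s x) = \<xi> s * F x))"

text \<open>
  The units of the polynomial ring are the non-zero constants, so an irreducible element
  is automatically non-constant.
\<close>

definition fundamental_relative_invariant :: "('v \<Rightarrow> 'k) \<Rightarrow> bool" where
  "fundamental_relative_invariant F \<longleftrightarrow>
     relative_invariant F \<and> ring_irreducible\<^bsub>polynomial_ring smul (gr 1)\<^esub> F"

definition one_irreducible :: bool where
  "one_irreducible \<longleftrightarrow>
     (\<exists>F. fundamental_relative_invariant F \<and>
          (\<forall>F'. fundamental_relative_invariant F' \<longrightarrow>
                (\<exists>c. c \<noteq> 0 \<and> F' = (\<lambda>x\<in>gr 1. c * F x))))"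

definition one_simple :: "'v \<Rightarrow> bool" where
  "one_simple h \<longleftrightarrow> (\<exists>x\<in>gr 1. \<exists>y\<in>gr (- 1). sl2_triple x h y)"

definition special :: "'v \<Rightarrow> bool" where
  "special h \<longleftrightarrow> one_simple h \<and> nilradical (smul 2 H0) \<subseteq> parabolic h"

definition very_special :: "'v \<Rightarrow> bool" where
  "very_special h \<longleftrightarrow> special h \<and> special (smul 2 H0 - h)"

end

end

(*
  Let h be very special, h' = 2H_0 - h, and let D(i,j) be the joint eigenspaces of ad h and ad h'.
  The sl2-triples of h and h' make the set of weights (i,j) symmetric under both sign changes, and
  specialness forbids i + j > 0 with i < 0 or j < 0; hence |i| <= 2 whenever j is non-zero. So a
  non-zero g_p with p >= 3 contains a non-zero D(2p,0) or D(0,2p), say the former, and it lies in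
  the ideal C of elements that commute with h' and with all ad h'-eigenvectors of non-zero weight.

  For a graded ideal I put P_I(x) = det((ad x)^2 : I_{-1} -> I_1), x in g_1. If x belongs to an
  sl2-triple of h, then P_C(x) is non-zero because h acts on C as 2H_0, while P_g(x) = 0 because
  (ad x)^2 kills D(0,-2). A divisor of P_g of minimal degree among those vanishing at x is
  irreducible, and so is a non-constant divisor of P_C of minimal degree. They are not proportional,
  so it remains to see that every divisor of P_I is relatively invariant.

  Over the algebraic closure, an element s of G is the end point of a polynomial path of
  automorphisms exp(t ad x_1) ... exp(t ad x_k). Its block diagonal factor l(t) with respect to the
  grading is a graded automorphism, rational in t, with l(0) = 1 and l(1) = s. If p divides P_I, the
  zeros of p(l(t) .) on a fixed line are zeros of P_I, so p(l(t) z) / p(l(t) x_0) takes finitely many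
  values, and, being rational in t, it is constant. Comparing t = 0 and t = 1 gives
  p(s z) / p(s x_0) = p(z) / p(x_0).
*)
theory Submission
  imports Defs "Jordan_Normal_Form.Determinant" "HOL-Library.Function_Algebras"
begin


text \<open>The usual route to relative invariance of divisors is connectedness of the centralizer
  of \<open>H0\<close>. Here \<open>G\<close> is only known through elementary automorphisms over
  the closure, and a path of those from 1 to s leaves \<open>G\<close>, since the factors exp(t ad
  x_i) need not respect the grading. A block LU decomposition along the path repairs this. The Levi
  factor exists off the zeros of a few block minors, polynomials in t that are non-zero at t = 0 and
  t = 1 because the path is graded there. Polynomials are functions without a degree, and no
  factorization theory is invoked: the degree of a divisor is read off on the line through 0 and a
  point x_0 with P_I(x_0) non-zero, and homogeneity of P_I makes a divisor of degree 0 on this line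
  constant. An sl2-triple of 2H_0 supplies x_0 for all ideals at once and gives dim I_1 = dim
  I_{-1}, so that P_I is the determinant of a square matrix. The base field need not be
  algebraically closed, so diagonalizability of ad h and ad h' with integer eigenvalues is derived
  from the sl2 relations by operator identities.\<close>

section \<open>Finite-dimensional representations of sl2\<close>

context vector_space
begin

text \<open>Finiteness is asked of the span only: besides weight spaces, the lemma is applied to
  graded pieces of the scalar extension, which sit in the function type
  \<open>'v \<Rightarrow> 'k alg_closure\<close>.\<close>

lemma linear_inj_on_finite_span_surj:
  assumes lin: "Vector_Spaces.linear scale scale f"
    and fin: "finite B" and stable: "f ` span B \<subseteq> span B" and inj: "inj_on f (span B)"
  shows "f ` span B = span B"
proof (rule ccontr)
  interpret f: Vector_Spaces.linear scale scale f by fact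
  assume "f ` span B \<noteq> span B"
  with stable obtain b where b: "b \<in> span B" "b \<notin> f ` span B" by auto
  obtain B' where B': "B' \<subseteq> B" "independent B'" "B \<subseteq> span B'"
    using maximal_independent_subset by blast
  have spB: "span B' = span B"
    using B' by (metis span_mono span_span subset_antisym)
  have finB': "finite B'" using B' fin finite_subset by blast
  have injB': "inj_on f B'" using inj spB span_superset by (metis inj_on_subset)
  have ind: "independent (f ` B')"
    using f.independent_inj_on_image[OF B'(2)] inj spB by simp
  have "span (f ` B') = f ` span B'" by (simp add: f.span_image)
  hence nb: "b \<notin> span (f ` B')" using b spB by simp
  have ind2: "independent (insert b (f ` B'))" using ind nb by (simp add: independent_insert)
  have "f ` B' \<subseteq> span B'"
    using image_mono[OF span_superset[of B'], of f] stable unfolding spB by (rule subset_trans)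
  hence "insert b (f ` B') \<subseteq> span B'" using b(1) spB by simp
  from independent_span_bound[OF finB' ind2 this]
  have "card (insert b (f ` B')) \<le> card B'" by blast
  moreover have "b \<notin> f ` B'" using nb span_base[of b "f ` B'"] by metis
  ultimately show False using finB' injB' by (simp add: card_image)
qed

lemma span_Union_subspaces:
  assumes sub: "\<And>i. i \<in> I \<Longrightarrow> subspace (W i)" and v: "v \<in> span (\<Union>i\<in>I. W i)"
  obtains S a where "finite S" "S \<subseteq> I" "\<And>i. i \<in> S \<Longrightarrow> a i \<in> W i" "v = (\<Sum>i\<in>S. a i)"
proof -
  have "\<exists>S a. finite S \<and> S \<subseteq> I \<and> (\<forall>i\<in>S. a i \<in> W i) \<and> v = (\<Sum>i\<in>S. a i)"
    using v
  proof (induction rule: span_induct_alt)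
    case base
    show ?case by (rule exI[of _ "{}"]) simp
  next
    case (step c x y)
    then obtain S a k where S: "finite S" "S \<subseteq> I" "\<forall>i\<in>S. a i \<in> W i" "y = (\<Sum>i\<in>S. a i)"
      and k: "k \<in> I" "x \<in> W k" by blast
    show ?case
    proof (intro exI conjI)
      let ?b = "\<lambda>i. if i = k then scale c x + (if k \<in> S then a k else 0) else a i"
      show "finite (insert k S)" "insert k S \<subseteq> I" using S k by auto
      show "\<forall>i\<in>insert k S. ?b i \<in> W i"
        using S k sub by (auto intro!: subspace_add subspace_scale)
      show "scale c x + y = (\<Sum>i\<in>insert k S. ?b i)"
      proof -
        have "(\<Sum>i\<in>insert k S. ?b i) = ?b k + (\<Sum>i\<in>S - {k}. ?b i)"
          using S(1) by (simp add: sum.insert_remove)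
        also have "(\<Sum>i\<in>S - {k}. ?b i) = (\<Sum>i\<in>S - {k}. a i)" by (rule sum.cong) auto
        also have "?b k + \<dots> = scale c x + (\<Sum>i\<in>S. a i)"
          using S(1) by (cases "k \<in> S") (auto simp: sum.remove[of S k] add.assoc)
        finally show ?thesis using S by simp
      qed
    qed
  qed
  with that show thesis by blast
qed

definition weight_space :: "('b \<Rightarrow> 'b) \<Rightarrow> int \<Rightarrow> 'b set" where
  "weight_space H i = {v. H v = scale (of_int i) v}"

end

locale weighted_space = vector_space smul
  for smul :: "'k::field_char_0 \<Rightarrow> 'v::ab_group_add \<Rightarrow> 'v" +
  fixes H :: "'v \<Rightarrow> 'v"
  assumes linear_H: "Vector_Spaces.linear smul smul H"
begin

abbreviation wt :: "int \<Rightarrow> 'v set" where "wt \<equiv> weight_space H"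

lemma H_add: "H (u + v) = H u + H v"
  and H_scale: "H (smul c v) = smul c (H v)"
  and H_0 [simp]: "H 0 = 0"
  and H_diff: "H (u - v) = H u - H v"
  and H_sum: "H (sum g S) = (\<Sum>i\<in>S. H (g i))"
proof -
  interpret Vector_Spaces.linear smul smul H by (rule linear_H)
  show "H (u + v) = H u + H v" "H (smul c v) = smul c (H v)" "H 0 = 0" "H (u - v) = H u - H v"
    "H (sum g S) = (\<Sum>i\<in>S. H (g i))"
    by (simp_all add: add scale diff sum)
qed

lemma subspace_wt: "subspace (wt i)"
  by (auto simp: subspace_def weight_space_def H_add H_scale scale_right_distrib
      scale_left_commute)

lemma wt_sum_eq_0:
  assumes "finite S" "\<And>i. i \<in> S \<Longrightarrow> a i \<in> wt i" "(\<Sum>i\<in>S. a i) = 0" "i \<in> S"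
  shows "a i = 0"
  using assms
proof (induction S arbitrary: a i rule: finite_induct)
  case (insert k S)
  \<comment> \<open>Applying \<open>H - k\<close> to the vanishing sum removes the term
    \<open>k\<close> and rescales the others by non-zero factors.\<close>
  have "(\<Sum>i\<in>S. smul (of_int (i - k)) (a i)) = 0"
  proof -
    have "H (\<Sum>i\<in>insert k S. a i) - smul (of_int k) (\<Sum>i\<in>insert k S. a i) = 0"
      by (simp only: insert.prems) simp
    moreover have "H (\<Sum>i\<in>insert k S. a i) = (\<Sum>i\<in>insert k S. smul (of_int i) (a i))"
      using insert.prems(1) by (auto simp: H_sum weight_space_def intro!: sum.cong)
    moreover have "(\<Sum>i\<in>insert k S. smul (of_int i) (a i)) - smul (of_int k) (\<Sum>i\<in>insert k S. a i)
        = (\<Sum>i\<in>insert k S. smul (of_int (i - k)) (a i))"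
      by (simp only: scale_sum_right sum_subtractf[symmetric] of_int_diff scale_left_diff_distrib)
    ultimately show ?thesis using insert.hyps by simp
  qed
  from insert.IH[OF _ this] insert.prems(1) have 0: "a i = 0" if "i \<in> S" for i
    using that insert.hyps subspace_wt by (fastforce intro: subspace_scale)
  with insert.prems(2) insert.hyps have "a k = 0" by simp
  with 0 insert.prems(3) show ?case by blast
qed simp

lemma wt_in_span_other:
  assumes v: "v \<in> wt j" and sp: "v \<in> span (\<Union>i\<in>I. wt i)" and j: "j \<notin> I"
  shows "v = 0"
proof -
  obtain S a where S: "finite S" "S \<subseteq> I" "\<And>i. i \<in> S \<Longrightarrow> a i \<in> wt i" "v = (\<Sum>i\<in>S. a i)"
    using span_Union_subspaces[OF subspace_wt sp] by metis
  let ?b = "\<lambda>i. if i = j then - v else a i"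
  have jS: "j \<notin> S" using S(2) j by blast
  have "(\<Sum>i\<in>insert j S. ?b i) = - v + (\<Sum>i\<in>S. ?b i)" using S(1) jS by simp
  also have "(\<Sum>i\<in>S. ?b i) = (\<Sum>i\<in>S. a i)" using jS by (intro sum.cong) auto
  finally have "(\<Sum>i\<in>insert j S. ?b i) = 0" using S(4) by simp
  moreover have "?b i \<in> wt i" if "i \<in> insert j S" for i
    using that v S(3) by (auto intro: subspace_neg subspace_wt)
  ultimately have "?b j = 0" using wt_sum_eq_0[of "insert j S" ?b j] S(1) by blast
  thus ?thesis by simp
qed

text \<open>\<open>H - j\<close> is invertible on the sum of the \<open>wt i\<close> with
  \<open>i \<in> I\<close>. Subtracting from \<open>v\<close> the preimage \<open>?u\<close> of
  \<open>(H - j) v\<close> leaves a vector of weight \<open>j\<close>. Diagonalizability of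
  \<open>H\<close> is built up in this way, one weight at a time.\<close>

lemma span_wt_step:
  assumes "H v - smul (of_int j) v \<in> span (\<Union>i\<in>I. wt i)" and j: "j \<notin> I"
  shows "v \<in> span (\<Union>i\<in>insert j I. wt i)"
proof -
  obtain S a where S: "finite S" "S \<subseteq> I" "\<And>i. i \<in> S \<Longrightarrow> a i \<in> wt i"
      "H v - smul (of_int j) v = (\<Sum>i\<in>S. a i)"
    using span_Union_subspaces[OF subspace_wt assms(1)] by metis
  let ?u = "\<Sum>i\<in>S. smul (inverse (of_int (i - j))) (a i)"
  have "H ?u - smul (of_int j) ?u = (\<Sum>i\<in>S. smul (of_int (i - j)) (smul (inverse (of_int (i - j))) (a i)))"
    unfolding H_sum scale_sum_right sum_subtractf[symmetric]
  proof (rule sum.cong[OF refl])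
    fix i assume "i \<in> S"
    hence "H (a i) = smul (of_int i) (a i)" using S(3) by (simp add: weight_space_def)
    thus "H (smul (inverse (of_int (i - j))) (a i)) - smul (of_int j) (smul (inverse (of_int (i - j))) (a i))
        = smul (of_int (i - j)) (smul (inverse (of_int (i - j))) (a i))"
      by (simp only: H_scale scale_scale of_int_diff scale_left_diff_distrib[symmetric])
        (simp add: ring_distribs mult.commute)
  qed
  also have "\<dots> = (\<Sum>i\<in>S. a i)"
  proof (rule sum.cong)
    fix i assume "i \<in> S"
    hence "i \<noteq> j" using S(2) j by blast
    hence "(of_int (i - j) :: 'k) \<noteq> 0" by simp
    thus "smul (of_int (i - j)) (smul (inverse (of_int (i - j))) (a i)) = a i"
      by (simp del: of_int_diff)
  qed simp
  finally have "v - ?u \<in> wt j" using S(4)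
    by (simp add: weight_space_def H_diff algebra_simps)
  moreover have "?u \<in> span (\<Union>i\<in>I. wt i)"
    using S(2,3) by (intro span_sum span_scale span_base) auto
  ultimately have "(v - ?u) + ?u \<in> span (\<Union>i\<in>insert j I. wt i)"
    by (intro span_add) (auto intro: span_base subsetD[OF span_mono, rotated])
  thus ?thesis by simp
qed

end

text \<open>Nilpotence of both operators is an axiom because in the application it is immediate from
  the grading; that \<open>H\<close> is diagonalizable with integer eigenvalues is then a
  consequence, \<open>span_wt_UNIV\<close>.\<close>

locale sl2_module = weighted_space smul H + finite_dimensional_vector_space smul Basis
  for smul :: "'k::field_char_0 \<Rightarrow> 'v::ab_group_add \<Rightarrow> 'v"
    and Basis :: "'v set" and H :: "'v \<Rightarrow> 'v" +
  fixes up dn :: "'v \<Rightarrow> 'v"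
  assumes linear_up: "Vector_Spaces.linear smul smul up"
    and linear_dn: "Vector_Spaces.linear smul smul dn"
    and up_dn: "up (dn v) = dn (up v) + H v"
    and H_up: "H (up v) = up (H v) + smul 2 (up v)"
    and H_dn: "H (dn v) = dn (H v) - smul 2 (dn v)"
    and nilpotent_up: "\<exists>n. \<forall>v. (up ^^ n) v = 0"
    and nilpotent_dn: "\<exists>n. \<forall>v. (dn ^^ n) v = 0"
begin

lemma up_add: "up (u + v) = up u + up v" and up_scale: "up (smul c v) = smul c (up v)"
  and up_diff: "up (u - v) = up u - up v" and up_0 [simp]: "up 0 = 0"
  and up_sum: "up (sum g S) = (\<Sum>i\<in>S. up (g i))"
proof -
  interpret Vector_Spaces.linear smul smul up by (rule linear_up)
  show "up (u + v) = up u + up v" "up (smul c v) = smul c (up v)" "up (u - v) = up u - up v" "up 0 = 0"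
    "up (sum g S) = (\<Sum>i\<in>S. up (g i))"
    by (simp_all add: add scale diff sum)
qed

lemma dn_add: "dn (u + v) = dn u + dn v" and dn_scale: "dn (smul c v) = smul c (dn v)"
  and dn_diff: "dn (u - v) = dn u - dn v" and dn_0 [simp]: "dn 0 = 0"
proof -
  interpret Vector_Spaces.linear smul smul dn by (rule linear_dn)
  show "dn (u + v) = dn u + dn v" "dn (smul c v) = smul c (dn v)" "dn (u - v) = dn u - dn v" "dn 0 = 0"
    by (simp_all add: add scale diff)
qed

lemma up_neg: "up (- v) = - up v" and dn_neg: "dn (- v) = - dn v"
  using up_diff[of 0 v] dn_diff[of 0 v] by simp_all

lemma dn_pow_0 [simp]: "(dn ^^ n) 0 = 0" by (induction n) auto
lemma dn_pow_scale: "(dn ^^ n) (smul c v) = smul c ((dn ^^ n) v)"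
  by (induction n) (auto simp: dn_scale)
lemma dn_pow_diff: "(dn ^^ n) (u - v) = (dn ^^ n) u - (dn ^^ n) v"
  by (induction n) (auto simp: dn_diff)

lemma up_wt: "v \<in> wt i \<Longrightarrow> up v \<in> wt (i + 2)"
  by (simp add: weight_space_def H_up up_scale scale_left_distrib)

lemma dn_wt: "v \<in> wt i \<Longrightarrow> dn v \<in> wt (i - 2)"
  by (simp add: weight_space_def H_dn dn_scale scale_left_diff_distrib)

lemma dn_pow_wt: "v \<in> wt i \<Longrightarrow> (dn ^^ n) v \<in> wt (i - 2 * int n)"
proof (induction n)
  case (Suc n)
  from dn_wt[OF Suc.IH[OF Suc.prems]] show ?case by (simp add: algebra_simps)
qed simp

lemma H_dn_pow: "H ((dn ^^ k) v) = (dn ^^ k) (H v) - smul (2 * of_nat k) ((dn ^^ k) v)"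
proof (induction k)
  case (Suc k)
  show ?case by (simp add: H_dn Suc dn_diff dn_scale scale_left_distrib algebra_simps)
qed simp

text \<open>This is e f^(k+1) = f^(k+1) e + (k+1) f^k (h - k) in the enveloping algebra.
  \<open>H v\<close> stays unevaluated because the identity is also applied to vectors not yet known
  to be sums of weight vectors.\<close>

lemma up_dn_pow:
  "up ((dn ^^ Suc k) v) = (dn ^^ Suc k) (up v) + smul (of_nat (Suc k)) ((dn ^^ k) (H v - smul (of_nat k) v))"
proof (induction k)
  case 0
  show ?case by (simp add: up_dn)
next
  case (Suc k)
  have "up ((dn ^^ Suc (Suc k)) v) = dn (up ((dn ^^ Suc k) v)) + H ((dn ^^ Suc k) v)"
    by (simp add: up_dn)
  also have "\<dots> = (dn ^^ Suc (Suc k)) (up v)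
      + smul (of_nat (Suc k)) ((dn ^^ Suc k) (H v - smul (of_nat k) v)) + H ((dn ^^ Suc k) v)"
    unfolding Suc by (simp add: dn_add dn_scale)
  also have "\<dots> = (dn ^^ Suc (Suc k)) (up v)
      + smul (of_nat (Suc (Suc k))) ((dn ^^ Suc k) (H v - smul (of_nat (Suc k)) v))"
    unfolding H_dn_pow dn_pow_diff dn_pow_scale
    by (simp add: scale_left_distrib scale_right_diff_distrib scale_right_distrib
        algebra_simps mult_2 del: funpow.simps) (simp add: scale_left_distrib[of 1 1, simplified])
  finally show ?case .
qed

text \<open>Induction on the power of \<open>up\<close> that kills \<open>v\<close>. At weight
  \<open>i\<close> the correction term of \<open>up_dn_pow\<close> vanishes for
  \<open>k = i\<close>, so the hypothesis passes to \<open>up v\<close>, two weights higher, and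
  \<open>up v = 0\<close> follows. Then \<open>v\<close> is a highest weight vector, and the factors
  \<open>(k + 1) * (i - k)\<close>, non-zero for \<open>k < i\<close>, allow the powers of
  \<open>dn\<close> to be stripped off one by one.\<close>

lemma dn_pow_inj:
  assumes "v \<in> wt (int i)" "(dn ^^ i) v = 0"
  shows "v = 0"
proof -
  have "v = 0" if "(up ^^ m) v = 0" "v \<in> wt (int i)" "(dn ^^ i) v = 0" for m
    using that
  proof (induction m arbitrary: i v)
    case (Suc m)
    have wtv: "H v = smul (of_nat i) v" using Suc.prems(2) by (simp add: weight_space_def)
    have "up ((dn ^^ Suc i) v) = (dn ^^ Suc i) (up v)"
      unfolding up_dn_pow by (simp add: wtv del: funpow.simps)
    hence "(dn ^^ Suc i) (up v) = 0" using Suc.prems(3) by simp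
    hence "(dn ^^ (i + 2)) (up v) = 0" by simp
    moreover have "up v \<in> wt (int (i + 2))" using up_wt[OF Suc.prems(2)] by (simp add: add.commute)
    moreover have "(up ^^ m) (up v) = 0" using Suc.prems(1) by (simp add: funpow_swap1)
    ultimately have Xv: "up v = 0" using Suc.IH by blast
    have "(dn ^^ k) v = 0 \<Longrightarrow> k \<le> i \<Longrightarrow> v = 0" for k
    proof (induction k)
      case (Suc k)
      have "0 = up ((dn ^^ Suc k) v)" using Suc.prems by simp
      also have "\<dots> = smul (of_nat (Suc k) * (of_nat i - of_nat k)) ((dn ^^ k) v)"
        unfolding up_dn_pow
        by (simp add: Xv wtv dn_pow_scale scale_left_diff_distrib[symmetric] dn_pow_diff[symmetric]
            del: funpow.simps of_nat_Suc)
      finally have "smul (of_nat (Suc k) * (of_nat i - of_nat k)) ((dn ^^ k) v) = 0" by simp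
      moreover have "(of_nat i - of_nat k :: 'k) \<noteq> 0" using Suc.prems(2) by simp
      ultimately have "(dn ^^ k) v = 0" by (simp del: of_nat_Suc)
      with Suc show ?case by simp
    qed simp
    with Suc.prems(3) show ?case by blast
  qed simp
  moreover obtain m where "(up ^^ m) v = 0" using nilpotent_up by blast
  ultimately show ?thesis using assms by blast
qed

text \<open>Through this symmetry every statement about lowering yields one about raising.\<close>

lemma swap: "sl2_module smul Basis (\<lambda>v. - H v) dn up"
proof -
  have "Vector_Spaces.linear smul smul (\<lambda>v. - H v)"
    by unfold_locales (auto simp: H_add H_scale)
  hence "weighted_space smul (\<lambda>v. - H v)"
    by (intro weighted_space.intro weighted_space_axioms.intro vector_space_axioms)
  thus ?thesis
    by (rule sl2_module.intro[OF _ finite_dimensional_vector_space_axioms sl2_module_axioms.intro])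
      (simp_all add: linear_up linear_dn up_dn H_up H_dn nilpotent_up nilpotent_dn up_neg dn_neg)
qed

lemma wt_swap: "weight_space (\<lambda>v. - H v) i = wt (- i)"
  by (auto simp: weight_space_def) (metis add.inverse_inverse)+

lemma up_pow_inj:
  assumes "v \<in> wt (- int i)" "(up ^^ i) v = 0"
  shows "v = 0"
  using sl2_module.dn_pow_inj[OF swap, of v i] assms by (simp add: wt_swap)

lemma dn_inj: "v \<in> wt i \<Longrightarrow> i > 0 \<Longrightarrow> dn v = 0 \<Longrightarrow> v = 0"
proof -
  assume a: "v \<in> wt i" "i > 0" "dn v = 0"
  then obtain n where n: "i = int (Suc n)" by (metis gr0_conv_Suc pos_int_cases)
  have "(dn ^^ Suc n) v = 0" using a(3) by (simp only: funpow_Suc_right) simp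
  with a(1) n show ?thesis using dn_pow_inj by blast
qed

lemma up_inj: "v \<in> wt i \<Longrightarrow> i < 0 \<Longrightarrow> up v = 0 \<Longrightarrow> v = 0"
  using sl2_module.dn_inj[OF swap, of v "- i"] by (simp add: wt_swap)

text \<open>The vector has weight \<open>- m - 2\<close>, and \<open>up_dn_pow\<close> at
  \<open>k = m\<close> shows that \<open>up\<close> kills it; but \<open>up\<close> is injective on
  negative weights.\<close>

lemma highest_weight_dn_pow:
  assumes "up w = 0" "w \<in> wt (int m)"
  shows "(dn ^^ Suc m) w = 0"
proof (rule up_inj)
  show "(dn ^^ Suc m) w \<in> wt (int m - 2 * int (Suc m))" by (rule dn_pow_wt) fact
  show "up ((dn ^^ Suc m) w) = 0"
    unfolding up_dn_pow using assms by (simp add: weight_space_def del: funpow.simps)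
qed simp

text \<open>If the power \<open>k + 1\<close> of \<open>dn\<close> kills a \<open>v\<close> with
  \<open>up v = 0\<close>, then by \<open>up_dn_pow\<close> the power \<open>k\<close> kills
  \<open>(H - k) v\<close>, which is again in the kernel of \<open>up\<close>. So a product of
  distinct factors \<open>H - k\<close> annihilates \<open>v\<close>, and all its weights are
  natural numbers.\<close>

lemma ker_up_subset_span_wt:
  assumes "up v = 0"
  shows "\<exists>n. v \<in> span (\<Union>i\<in>{0..<int n}. wt i)"
proof -
  have "v \<in> span (\<Union>i\<in>{0..<int k}. wt i)" if "(dn ^^ k) v = 0" "up v = 0" for k
    using that
  proof (induction k arbitrary: v)
    case 0
    thus ?case by (simp add: span_zero)
  next
    case (Suc k)
    let ?u = "H v - smul (of_nat k) v"
    have "smul (of_nat (Suc k)) ((dn ^^ k) ?u) = 0"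
      using up_dn_pow[of k v] Suc.prems by (simp del: funpow.simps of_nat_Suc)
    hence "(dn ^^ k) ?u = 0" by (simp del: of_nat_Suc)
    moreover have "up ?u = 0"
      using H_up[of v] Suc.prems(2) by (simp add: up_diff up_scale)
    ultimately have "?u \<in> span (\<Union>i\<in>{0..<int k}. wt i)" by (rule Suc.IH)
    hence "v \<in> span (\<Union>i\<in>insert (int k) {0..<int k}. wt i)"
      by (intro span_wt_step) auto
    moreover have "insert (int k) {0..<int k} = {0..<int (Suc k)}" by auto
    ultimately show ?case by simp
  qed
  with nilpotent_dn assms show ?thesis by blast
qed

text \<open>The map \<open>up\<close> after \<open>dn\<close> is an injective endomorphism of the
  finite-dimensional space \<open>wt i\<close>, hence onto. For injectivity: if
  \<open>up (dn w) = 0\<close>, then \<open>dn w\<close> is a highest weight vector of weight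
  \<open>i - 2 \<ge> 0\<close>, so the power \<open>i\<close> of \<open>dn\<close> kills
  \<open>w\<close>, against \<open>dn_pow_inj\<close>.\<close>

lemma up_surj_wt:
  assumes a: "a \<in> wt i" and i: "i \<ge> 2"
  shows "\<exists>c \<in> wt (i - 2). up c = a"
proof -
  obtain B where B: "B \<subseteq> wt i" "independent B" "wt i \<subseteq> span B"
    using maximal_independent_subset by blast
  have fB: "finite B" using B(2) finiteI_independent by blast
  have sB: "span B = wt i"
    using B by (metis subset_antisym span_minimal subspace_wt)
  have lin: "Vector_Spaces.linear smul smul (\<lambda>v. up (dn v))"
    by unfold_locales (auto simp: up_add dn_add up_scale dn_scale)
  have "inj_on (\<lambda>v. up (dn v)) (wt i)"
  proof (rule inj_onI)
    fix u v assume uv: "u \<in> wt i" "v \<in> wt i" "up (dn u) = up (dn v)"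
    obtain n where n: "i = int (n + 2)" using i by (metis add.commute zle_iff_zadd of_nat_add of_nat_numeral)
    let ?w = "u - v"
    have w: "?w \<in> wt i" using uv by (simp add: subspace_diff subspace_wt)
    have "up (dn ?w) = 0" using uv by (simp add: up_diff dn_diff)
    moreover have "dn ?w \<in> wt (int n)" using dn_wt[OF w] n by simp
    ultimately have "(dn ^^ Suc n) (dn ?w) = 0" by (rule highest_weight_dn_pow)
    hence "(dn ^^ (n + 2)) ?w = 0" by (simp add: funpow_swap1)
    with w n have "?w = 0" using dn_pow_inj by blast
    thus "u = v" by simp
  qed
  moreover have "(\<lambda>v. up (dn v)) ` wt i \<subseteq> wt i"
    using up_wt dn_wt by fastforce
  ultimately have "(\<lambda>v. up (dn v)) ` wt i = wt i"
    using linear_inj_on_finite_span_surj[OF lin fB] sB by simp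
  with a have "a \<in> (\<lambda>v. up (dn v)) ` wt i" by simp
  then obtain c where "c \<in> wt i" "up (dn c) = a" by blast
  with dn_wt show ?thesis by blast
qed

text \<open>The weights \<open>i - 2\<close> with \<open>i \<le> 1\<close> are negative, hence distinct from the weights of highest
  weight vectors; this is why \<open>H\<close> has no Jordan blocks here.\<close>

lemma up_low_span_wt:
  assumes "finite S" "S \<subseteq> {..1}" "up v \<in> span (\<Union>i\<in>S. wt i)"
  shows "\<exists>n. v \<in> span (\<Union>i\<in>(\<lambda>i. i - 2) ` S \<union> {0..<int n}. wt i)"
  using assms
proof (induction S arbitrary: v rule: finite_induct)
  case empty
  thus ?case using ker_up_subset_span_wt by simp
next
  case (insert j S)
  let ?u = "H v - smul (of_int (j - 2)) v"
  have "up ?u \<in> span (\<Union>i\<in>S. wt i)"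
  proof -
    have eq: "up ?u = H (up v) - smul (of_int j) (up v)"
      using H_up[of v] by (simp add: up_diff up_add up_scale algebra_simps scale_left_diff_distrib)
    obtain T a where T: "finite T" "T \<subseteq> insert j S" "\<And>i. i \<in> T \<Longrightarrow> a i \<in> wt i" "up v = (\<Sum>i\<in>T. a i)"
      using span_Union_subspaces[OF subspace_wt insert.prems(2)] by metis
    have "up ?u = (\<Sum>i\<in>T. smul (of_int (i - j)) (a i))"
      unfolding eq T(4) H_sum scale_sum_right sum_subtractf[symmetric]
      using T(3) by (intro sum.cong) (auto simp: weight_space_def scale_left_diff_distrib)
    moreover have "smul (of_int (i - j)) (a i) \<in> span (\<Union>i\<in>S. wt i)" if "i \<in> T" for i
    proof (cases "i = j")
      case False
      with that T show ?thesis by (intro span_scale span_base) blast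
    qed (simp add: span_zero)
    ultimately show ?thesis by (simp add: span_sum)
  qed
  then obtain n where n: "?u \<in> span (\<Union>i\<in>(\<lambda>i. i - 2) ` S \<union> {0..<int n}. wt i)"
    using insert by blast
  have "j - 2 \<notin> (\<lambda>i. i - 2) ` S \<union> {0..<int n}" using insert by auto
  from span_wt_step[OF n this] show ?case by (auto simp: image_Un)
qed

text \<open>By induction on the power of \<open>up\<close> that kills \<open>v\<close>, the vector
  \<open>up v\<close> is already a sum of weight vectors. Its components of weight at least 2 lift
  through \<open>up\<close> to weight vectors; once these lifts are subtracted, only weights at most
  1 remain, the case of \<open>up_low_span_wt\<close>.\<close>

theorem span_wt_UNIV: "span (\<Union>i. wt i) = UNIV"
proof -
  have step: "v \<in> span (\<Union>i. wt i)" if upv: "up v \<in> span (\<Union>i. wt i)" for v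
  proof -
    obtain S a where S: "finite S" "\<And>i. i \<in> S \<Longrightarrow> a i \<in> wt i" "up v = (\<Sum>i\<in>S. a i)"
      using span_Union_subspaces[OF subspace_wt upv] by metis
    have "\<forall>i\<in>S. \<exists>c. i \<ge> 2 \<longrightarrow> c \<in> wt (i - 2) \<and> up c = a i"
      using up_surj_wt S(2) by blast
    then obtain c where c: "\<And>i. i \<in> S \<Longrightarrow> i \<ge> 2 \<Longrightarrow> c i \<in> wt (i - 2) \<and> up (c i) = a i"
      by metis
    let ?u = "\<Sum>i\<in>{i\<in>S. i \<ge> 2}. c i"
    have "S = {i\<in>S. i \<le> 1} \<union> {i\<in>S. i \<ge> 2}" by auto
    hence "up v = (\<Sum>i\<in>{i\<in>S. i \<le> 1} \<union> {i\<in>S. i \<ge> 2}. a i)" using S(3) by simp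
    also have "\<dots> = (\<Sum>i\<in>{i\<in>S. i \<le> 1}. a i) + (\<Sum>i\<in>{i\<in>S. i \<ge> 2}. a i)"
      using S(1) by (intro sum.union_disjoint) auto
    also have "(\<Sum>i\<in>{i\<in>S. i \<ge> 2}. a i) = up ?u" using c by (simp add: up_sum)
    finally have "up (v - ?u) = (\<Sum>i\<in>{i\<in>S. i \<le> 1}. a i)" by (simp add: up_diff)
    also have "\<dots> \<in> span (\<Union>i\<in>{i\<in>S. i \<le> 1}. wt i)"
      using S(2) by (intro span_sum span_base) blast
    finally obtain n where "v - ?u \<in> span (\<Union>i\<in>(\<lambda>i. i - 2) ` {i\<in>S. i \<le> 1} \<union> {0..<int n}. wt i)"
      using up_low_span_wt S(1) by (metis (no_types, lifting) finite_subset mem_Collect_eq subsetI atMost_iff)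
    hence "v - ?u \<in> span (\<Union>i. wt i)" by (rule subsetD[OF span_mono, rotated]) auto
    moreover have "?u \<in> span (\<Union>i. wt i)" using c by (intro span_sum span_base) auto
    ultimately have "(v - ?u) + ?u \<in> span (\<Union>i. wt i)" by (rule span_add)
    thus ?thesis by simp
  qed
  have "v \<in> span (\<Union>i. wt i)" if "(up ^^ m) v = 0" for m v
    using that
  proof (induction m arbitrary: v)
    case (Suc m)
    hence "(up ^^ m) (up v) = 0" by (simp add: funpow_swap1)
    with Suc.IH step show ?case by blast
  qed (simp add: span_zero)
  with nilpotent_up show ?thesis by blast
qed

end


context weighted_space
begin

text \<open>\<open>A\<close> preserves each weight space of \<open>H\<close>, so the eigenvalue
  equation of \<open>v\<close> can be compared weight by weight.\<close>

lemma commuting_eigenvector_decomposition: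
  assumes full: "span (\<Union>i. wt i) = UNIV"
    and A: "Vector_Spaces.linear smul smul A" and comm: "\<And>v. A (H v) = H (A v)"
    and v: "A v = smul c v"
  obtains S a where "finite S" "\<And>i. i \<in> S \<Longrightarrow> a i \<in> wt i" "\<And>i. i \<in> S \<Longrightarrow> A (a i) = smul c (a i)"
    "v = (\<Sum>i\<in>S. a i)"
proof -
  interpret A: Vector_Spaces.linear smul smul A by fact
  have "v \<in> span (\<Union>i. wt i)" by (simp add: full)
  then obtain S a where S: "finite S" "\<And>i. i \<in> S \<Longrightarrow> a i \<in> wt i" "v = (\<Sum>i\<in>S. a i)"
    by (rule span_Union_subspaces[OF subspace_wt]) blast
  have "(\<Sum>i\<in>S. A (a i) - smul c (a i)) = 0"
    using v by (simp add: S(3) A.sum sum_subtractf scale_sum_right)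
  moreover have "A (a i) - smul c (a i) \<in> wt i" if "i \<in> S" for i
  proof -
    have "H (A (a i)) = A (smul (of_int i) (a i))"
      using S(2)[OF that] by (simp add: weight_space_def comm[symmetric])
    hence "A (a i) \<in> wt i" by (simp add: weight_space_def A.scale)
    thus ?thesis using S(2)[OF that] by (intro subspace_diff subspace_scale subspace_wt)
  qed
  ultimately have "A (a i) - smul c (a i) = 0" if "i \<in> S" for i
    using wt_sum_eq_0[OF S(1), of "\<lambda>i. A (a i) - smul c (a i)"] that by blast
  hence "A (a i) = smul c (a i)" if "i \<in> S" for i using that by simp
  from that[OF S(1,2) this S(3)] show thesis by simp
qed

end

section \<open>Weights of a very special element\<close>

context lie_algebra
begin

lemma bracket_add_left: "bracket (x + y) z = bracket x z + bracket y z"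
  and bracket_scale_left: "bracket (smul c x) z = smul c (bracket x z)"
  and bracket_neg_left: "bracket (- x) z = - bracket x z"
  and bracket_0_left [simp]: "bracket 0 z = 0"
  and bracket_sum_left: "bracket (sum f A) z = (\<Sum>a\<in>A. bracket (f a) z)"
proof -
  interpret Vector_Spaces.linear smul smul "\<lambda>x. bracket x z" by (rule bracket_linear_left)
  show "bracket (x + y) z = bracket x z + bracket y z"
    "bracket (smul c x) z = smul c (bracket x z)"
    "bracket (- x) z = - bracket x z" "bracket 0 z = 0"
    "bracket (sum f A) z = (\<Sum>a\<in>A. bracket (f a) z)"
    by (rule add scale neg zero sum)+
qed

lemma bracket_add_right: "bracket z (x + y) = bracket z x + bracket z y"
  and bracket_scale_right: "bracket z (smul c x) = smul c (bracket z x)"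
  and bracket_diff_right: "bracket z (x - y) = bracket z x - bracket z y"
  and bracket_neg_right: "bracket z (- x) = - bracket z x"
  and bracket_0_right [simp]: "bracket z 0 = 0"
  and bracket_sum_right: "bracket z (sum f A) = (\<Sum>a\<in>A. bracket z (f a))"
proof -
  interpret Vector_Spaces.linear smul smul "bracket z" by (rule bracket_linear_right)
  show "bracket z (x + y) = bracket z x + bracket z y"
    "bracket z (smul c x) = smul c (bracket z x)"
    "bracket z (x - y) = bracket z x - bracket z y"
    "bracket z (- x) = - bracket z x" "bracket z 0 = 0"
    "bracket z (sum f A) = (\<Sum>a\<in>A. bracket z (f a))"
    by (rule add scale diff neg zero sum)+
qed

lemma bracket_antisym: "bracket x y = - bracket y x"
proof -
  have "bracket (x + y) (x + y) = 0" by (rule bracket_self)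
  hence "bracket x y + bracket y x = 0"
    by (simp add: bracket_add_left bracket_add_right bracket_self[of x] bracket_self[of y] add.commute)
  thus ?thesis by (simp add: eq_neg_iff_add_eq_0)
qed

lemma bracket_derivation: "bracket x (bracket y z) = bracket (bracket x y) z + bracket y (bracket x z)"
proof -
  have "bracket y (bracket z x) = - bracket y (bracket x z)"
    using bracket_antisym[of z x] by (simp add: bracket_neg_right)
  moreover have "bracket z (bracket x y) = - bracket (bracket x y) z" by (rule bracket_antisym)
  ultimately show ?thesis using jacobi[of x y z] by (simp add: algebra_simps)
qed

lemma weighted_space_ad: "weighted_space smul (bracket h)"
  by (intro weighted_space.intro weighted_space_axioms.intro vector_space_axioms bracket_linear_right)

lemma eigenspace_eq_weight_space: "eigenspace h i = weight_space (bracket h) i"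
  by (simp add: eigenspace_def weight_space_def)

lemma subspace_eigenspace: "subspace (eigenspace h i)"
  unfolding eigenspace_eq_weight_space by (rule weighted_space.subspace_wt[OF weighted_space_ad])

lemma eigenspace_bracket:
  assumes "u \<in> eigenspace h i" "v \<in> eigenspace h j"
  shows "bracket u v \<in> eigenspace h (i + j)"
  using assms unfolding eigenspace_def
  by (simp add: bracket_derivation[of h u v] bracket_scale_left bracket_scale_right scale_left_distrib)

lemma ideal_UNIV: "ideal UNIV"
  by (simp add: ideal_def)

lemma ideal_bracket_right: "ideal I \<Longrightarrow> y \<in> I \<Longrightarrow> bracket x y \<in> I"
  by (auto simp: ideal_def)

lemma ideal_subspace: "ideal I \<Longrightarrow> subspace I"
  by (auto simp: ideal_def)

end

section \<open>Boundedness of the grading and sl2-triples in degrees 1 and -1\<close>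

context graded_semisimple_lie_algebra
begin

text \<open>The finitely many basis vectors have finitely many homogeneous components, whose degrees
  already span everything; a vector of any other degree is zero by independence of the eigenspaces
  of \<open>bracket H0\<close>.\<close>

lemma gr_bounded: "\<exists>N. \<forall>i. \<bar>i\<bar> > N \<longrightarrow> gr i = {0}"
proof -
  interpret w: weighted_space smul "bracket H0" by (rule weighted_space_ad)
  have wt: "w.wt = gr" by (rule ext) (simp add: weight_space_def gr_eigenspace)
  have "\<exists>S. finite S \<and> b \<in> span (\<Union>i\<in>S. gr i)" for b
  proof -
    have "b \<in> span (\<Union>i. gr i)" by (simp add: gr_span)
    then obtain S a where S: "finite S" "\<And>i. i \<in> S \<Longrightarrow> a i \<in> gr i" "b = (\<Sum>i\<in>S. a i)"
      by (rule span_Union_subspaces[OF gr_subspace]) blast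
    have "b \<in> span (\<Union>i\<in>S. gr i)" unfolding S(3) using S(2) by (intro span_sum span_base) blast
    with S(1) show ?thesis by blast
  qed
  then obtain S where S: "\<And>b. finite (S b)" "\<And>b. b \<in> span (\<Union>i\<in>S b. gr i)" by metis
  let ?I = "\<Union>b\<in>Basis. S b"
  have fin: "finite ?I" using S(1) finite_Basis by blast
  have "b \<in> span (\<Union>i\<in>?I. gr i)" if "b \<in> Basis" for b
  proof -
    have "(\<Union>i\<in>S b. gr i) \<subseteq> (\<Union>i\<in>?I. gr i)" using that by blast
    from subsetD[OF span_mono[OF this] S(2)] show ?thesis .
  qed
  hence "span Basis \<subseteq> span (\<Union>i\<in>?I. gr i)" by (intro span_minimal subsetI) auto
  hence full: "v \<in> span (\<Union>i\<in>?I. gr i)" for v using span_Basis by blast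
  have zero: "gr i = {0}" if "i \<notin> ?I" for i
  proof -
    have "v = 0" if "v \<in> gr i" for v
      using w.wt_in_span_other[of v i ?I] that \<open>i \<notin> ?I\<close> full wt by metis
    thus ?thesis using subspace_0[OF gr_subspace[of i]] by blast
  qed
  have "\<bar>i\<bar> \<le> Max (abs ` ?I)" if "i \<in> ?I" for i
    using fin that by (intro Max_ge finite_imageI imageI)
  with zero show ?thesis by (meson linorder_not_less)
qed

lemma ad_pow_gr: "x \<in> gr k \<Longrightarrow> v \<in> gr i \<Longrightarrow> (bracket x ^^ n) v \<in> gr (i + int n * k)"
proof (induction n)
  case (Suc n)
  from gr_bracket[OF Suc.prems(1) Suc.IH[OF Suc.prems]] show ?case by (simp add: algebra_simps)
qed simp

lemma ad_nilpotent:
  assumes x: "x \<in> gr k" and k: "k \<noteq> 0"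
  shows "\<exists>n. \<forall>v. (bracket x ^^ n) v = 0"
proof -
  obtain N where N: "\<And>i. \<bar>i\<bar> > N \<Longrightarrow> gr i = {0}" using gr_bounded by blast
  \<comment> \<open>Each step moves the degree by at least 1 in a fixed direction, so this many
    steps lead out of the interval from \<open>- N\<close> to \<open>N\<close>.\<close>
  let ?n = "nat (2 * \<bar>N\<bar> + 1)"
  have lin: "(bracket x ^^ n) (smul c u + w) = smul c ((bracket x ^^ n) u) + (bracket x ^^ n) w" for n c u w
    by (induction n) (auto simp: bracket_add_right bracket_scale_right)
  have 0: "(bracket x ^^ n) 0 = 0" for n by (induction n) auto
  have gr: "(bracket x ^^ ?n) v = 0" if "v \<in> gr i" for v i
  proof (cases "\<bar>i\<bar> > N")
    case True
    with N that have "v = 0" by blast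
    thus ?thesis by (simp add: 0)
  next
    case False
    have "\<bar>int ?n * k\<bar> \<ge> 2 * \<bar>N\<bar> + 1"
      using k mult_left_mono[of 1 "\<bar>k\<bar>" "2 * \<bar>N\<bar> + 1"] by (simp add: abs_mult)
    hence "\<bar>i + int ?n * k\<bar> > N" using False by linarith
    with ad_pow_gr[OF x that] N show ?thesis by blast
  qed
  have "(bracket x ^^ ?n) v = 0" for v
  proof -
    have "v \<in> span (\<Union>i. gr i)" by (simp add: gr_span)
    thus ?thesis by (induction rule: span_induct_alt) (auto simp: lin 0 gr)
  qed
  thus ?thesis by blast
qed

text \<open>The sign of the lowering operator turns \<open>bracket x y = - h\<close> into the usual
  relation [up, dn] = H.\<close>

lemma sl2_triple_module:
  assumes t: "sl2_triple x h y" and x: "x \<in> gr 1" and y: "y \<in> gr (- 1)"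
  shows "sl2_module smul Basis (bracket h) (bracket x) (\<lambda>v. - bracket y v)"
proof (rule sl2_module.intro[OF weighted_space_ad finite_dimensional_vector_space_axioms sl2_module_axioms.intro])
  have xy: "bracket x y = - h" and hx: "bracket h x = smul 2 x" and hy: "bracket h y = smul (- 2) y"
    using t by (auto simp: sl2_triple_def)
  show "Vector_Spaces.linear smul smul (\<lambda>v. - bracket y v)"
    by unfold_locales (simp_all add: bracket_add_right bracket_scale_right)
  show "bracket x (- bracket y v) = - bracket y (bracket x v) + bracket h v" for v
    unfolding bracket_neg_right bracket_derivation[of x y v] xy by (simp add: bracket_neg_left)
  show "bracket h (bracket x v) = bracket x (bracket h v) + smul 2 (bracket x v)" for v
    unfolding bracket_derivation[of h x v] hx by (simp add: bracket_scale_left)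
  show "bracket h (- bracket y v) = - bracket y (bracket h v) - smul 2 (- bracket y v)" for v
    unfolding bracket_neg_right bracket_derivation[of h y v] hy
    by (simp add: bracket_scale_left bracket_neg_left)
  show "\<exists>n. \<forall>v. (bracket x ^^ n) v = 0" using ad_nilpotent[OF x] by simp
  obtain n where n: "\<And>v. (bracket y ^^ n) v = 0" using ad_nilpotent[OF y] by auto
  have "((\<lambda>v. - bracket y v) ^^ k) v = (bracket y ^^ k) v \<or> ((\<lambda>v. - bracket y v) ^^ k) v = - (bracket y ^^ k) v"
    for k v by (induction k) (auto simp: bracket_neg_right)
  with n show "\<exists>n. \<forall>v. ((\<lambda>v. - bracket y v) ^^ n) v = 0" by (metis neg_equal_0_iff_equal)
qed (rule bracket_linear_right)

lemma sl2_triple_nonzero: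
  assumes "sl2_triple x h y"
  shows "x \<noteq> 0" "y \<noteq> 0"
proof -
  have xy: "bracket x y = - h" and hx: "bracket h x = smul 2 x" and hy: "bracket h y = smul (- 2) y"
    and nz: "(x, h, y) \<noteq> (0, 0, 0)"
    using assms by (auto simp: sl2_triple_def)
  have "h = 0 \<Longrightarrow> x = 0 \<and> y = 0" using hx hy by simp
  with xy nz show "x \<noteq> 0" "y \<noteq> 0" by auto
qed

end

section \<open>Joint eigenspaces of \<open>h1\<close> and \<open>h2\<close>, where
  \<open>h1 + h2 = 2 H0\<close>\<close>

locale very_special_decomposition = graded_semisimple_lie_algebra +
  fixes x0 y0 x1 h1 y1 x2 h2 y2
  assumes h1_h2: "h1 + h2 = smul 2 H0"
    and x0: "x0 \<in> gr 1" and y0: "y0 \<in> gr (- 1)" and triple0: "sl2_triple x0 (smul 2 H0) y0"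
    and x1: "x1 \<in> gr 1" and y1: "y1 \<in> gr (- 1)" and triple1: "sl2_triple x1 h1 y1"
    and x2: "x2 \<in> gr 1" and y2: "y2 \<in> gr (- 1)" and triple2: "sl2_triple x2 h2 y2"
    and special1: "nilradical (smul 2 H0) \<subseteq> parabolic h1"
    and special2: "nilradical (smul 2 H0) \<subseteq> parabolic h2"
begin

text \<open>The roles of \<open>h1\<close> and \<open>h2\<close> are symmetric; statements about the
  second index are obtained from the first through this lemma and \<open>D_swapped\<close>.\<close>

lemma swapped:
  "very_special_decomposition smul Basis bracket gr H0 x0 y0 x2 h2 y2 x1 h1 y1"
  by (intro very_special_decomposition.intro very_special_decomposition_axioms.intro
      graded_semisimple_lie_algebra_axioms x0 y0 triple0 x1 y1 triple1 x2 y2 triple2 special1 special2)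
    (metis h1_h2 add.commute)

sublocale sl0: sl2_module smul Basis "bracket (smul 2 H0)" "bracket x0" "\<lambda>v. - bracket y0 v"
  by (rule sl2_triple_module[OF triple0 x0 y0])

sublocale sl1: sl2_module smul Basis "bracket h1" "bracket x1" "\<lambda>v. - bracket y1 v"
  by (rule sl2_triple_module[OF triple1 x1 y1])

sublocale sl2: sl2_module smul Basis "bracket h2" "bracket x2" "\<lambda>v. - bracket y2 v"
  by (rule sl2_triple_module[OF triple2 x2 y2])

lemma bracket_h1_h2: "bracket h1 v + bracket h2 v = smul 2 (bracket H0 v)"
  by (simp add: bracket_add_left[symmetric] h1_h2 bracket_scale_left)

definition D :: "int \<Rightarrow> int \<Rightarrow> 'b set" where
  "D i j = eigenspace h1 i \<inter> eigenspace h2 j"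

lemma D_bracket: "u \<in> D i j \<Longrightarrow> v \<in> D k l \<Longrightarrow> bracket u v \<in> D (i + k) (j + l)"
  by (auto simp: D_def intro: eigenspace_bracket)

lemma D_neg: "u \<in> D i j \<Longrightarrow> - u \<in> D i j"
  by (auto simp: D_def intro: subspace_neg subspace_eigenspace)

lemma gr_eigenspace_2H0: "v \<in> gr p \<longleftrightarrow> v \<in> eigenspace (smul 2 H0) (2 * p)"
  by (auto simp: gr_eigenspace eigenspace_def bracket_scale_left simp flip: scale_scale)

lemma D_eqI: "v \<in> gr p \<Longrightarrow> v \<in> eigenspace h1 i \<Longrightarrow> v \<in> D i (2 * p - i)"
  using bracket_h1_h2[of v]
  by (simp add: D_def gr_eigenspace eigenspace_def scale_left_diff_distrib algebra_simps)

lemma h1_gr: "h1 \<in> gr 0"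
  using subspace_neg[OF gr_subspace gr_bracket[OF x1 y1]] triple1 by (simp add: sl2_triple_def)

text \<open>Degree 1 means total weight 2, all of which is taken by \<open>h1\<close>. Hence
  \<open>bracket x1\<close> and \<open>bracket y1\<close> move the first index only.\<close>

lemma x1_D: "x1 \<in> D 2 0" and y1_D: "y1 \<in> D (-2) 0"
proof -
  have "x1 \<in> eigenspace h1 2" "y1 \<in> eigenspace h1 (- 2)"
    using triple1 by (auto simp: sl2_triple_def eigenspace_def)
  from D_eqI[OF x1 this(1)] D_eqI[OF y1 this(2)] show "x1 \<in> D 2 0" "y1 \<in> D (-2) 0" by simp_all
qed

lemma D_swapped: "very_special_decomposition.D smul bracket h2 h1 j i = D i j"
  by (auto simp: very_special_decomposition.D_def[OF swapped] D_def)

lemma y2_D: "y2 \<in> D 0 (- 2)"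
  using very_special_decomposition.y1_D[OF swapped] by (simp add: D_swapped)

text \<open>The \<open>n\<close>-th power of the lowering or raising operator of the first triple
  carries weight \<open>n\<close> to \<open>- n\<close>, or back, injectively, and leaves
  \<open>j\<close> alone by \<open>x1_D\<close> and \<open>y1_D\<close>.\<close>

lemma D_nontrivial_reflect1:
  assumes v: "v \<in> D i j" "v \<noteq> 0"
  shows "\<exists>w. w \<in> D (- i) j \<and> w \<noteq> 0"
proof (cases "i \<ge> 0")
  case True
  then obtain n where n: "i = int n" using zero_le_imp_eq_int by blast
  have "((\<lambda>v. - bracket y1 v) ^^ k) v \<in> D (i - 2 * int k) j" for k
  proof (induction k)
    case (Suc k)
    from D_neg[OF D_bracket[OF y1_D Suc]] show ?case by (simp add: algebra_simps)
  qed (simp add: v)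
  from this[of n] have "((\<lambda>v. - bracket y1 v) ^^ n) v \<in> D (- i) j" using n by simp
  moreover have "((\<lambda>v. - bracket y1 v) ^^ n) v \<noteq> 0"
    using sl1.dn_pow_inj[of v n] v n by (auto simp: D_def eigenspace_eq_weight_space)
  ultimately show ?thesis by blast
next
  case False
  then obtain n where n: "i = - int n" by (metis int_cases2 of_nat_0_le_iff)
  have "(bracket x1 ^^ k) v \<in> D (i + 2 * int k) j" for k
  proof (induction k)
    case (Suc k)
    from D_bracket[OF x1_D Suc] show ?case by (simp add: algebra_simps)
  qed (simp add: v)
  from this[of n] have "(bracket x1 ^^ n) v \<in> D (- i) j" using n by simp
  moreover have "(bracket x1 ^^ n) v \<noteq> 0"
    using sl1.up_pow_inj[of v n] v n by (auto simp: D_def eigenspace_eq_weight_space)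
  ultimately show ?thesis by blast
qed

lemma D_nontrivial_reflect2:
  assumes "v \<in> D i j" "v \<noteq> 0"
  shows "\<exists>w. w \<in> D i (- j) \<and> w \<noteq> 0"
  using very_special_decomposition.D_nontrivial_reflect1[OF swapped, of v j i] assms
  by (simp add: D_swapped)

text \<open>\<open>i + j\<close> is the eigenvalue of \<open>2 H0\<close>, so \<open>v\<close> lies
  in its nilradical; \<open>special1\<close> puts \<open>v\<close> into the sum of the non-negative
  weight spaces of \<open>h1\<close>.\<close>

lemma D_nonneg1:
  assumes v: "v \<in> D i j" "v \<noteq> 0" and ij: "i + j > 0"
  shows "i \<ge> 0"
proof (rule ccontr)
  assume i: "\<not> i \<ge> 0"
  have "bracket (smul 2 H0) v = smul (of_int (i + j)) v"
    using bracket_h1_h2[of v] v(1)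
    by (simp add: D_def eigenspace_def bracket_scale_left scale_left_distrib)
  hence "v \<in> eigenspace (smul 2 H0) (i + j)" by (simp add: eigenspace_def)
  hence "v \<in> nilradical (smul 2 H0)" unfolding nilradical_def using ij by (intro span_base) auto
  with special1 have "v \<in> span (\<Union>i\<in>{0..}. sl1.wt i)"
    unfolding parabolic_def eigenspace_eq_weight_space by blast
  with sl1.wt_in_span_other[of v i "{0..}"] v i show False
    by (simp add: D_def eigenspace_eq_weight_space)
qed

lemma D_nonneg2:
  assumes "v \<in> D i j" "v \<noteq> 0" "i + j > 0"
  shows "j \<ge> 0"
  using very_special_decomposition.D_nonneg1[OF swapped, of v j i] assms
  by (simp add: D_swapped add.commute)

text \<open>If both indices are non-zero, the reflections make
  \<open>D \<bar>i\<bar> (- \<bar>j\<bar>)\<close> and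
  \<open>D (- \<bar>i\<bar>) \<bar>j\<bar>\<close> non-trivial, and \<open>D_nonneg1\<close>,
  \<open>D_nonneg2\<close> leave only \<open>\<bar>i\<bar> = \<bar>j\<bar>\<close>. If moreover
  \<open>\<bar>i\<bar> > 2\<close>, then \<open>x1\<close> moves a vector of first weight
  \<open>- \<bar>i\<bar>\<close> injectively to the still non-zero weight
  \<open>2 - \<bar>i\<bar>\<close> with the same \<open>j\<close>, which breaks this
  equality.\<close>

lemma D_nontrivial_bound:
  assumes v: "v \<in> D i j" "v \<noteq> 0" and j: "j \<noteq> 0"
  shows "\<bar>i\<bar> \<le> 2"
proof -
  have refl: "\<exists>w. w \<in> D a b \<and> w \<noteq> 0" if w: "w \<in> D i j" "w \<noteq> 0" and ab: "\<bar>a\<bar> = \<bar>i\<bar>" "\<bar>b\<bar> = \<bar>j\<bar>" for a b i j w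
  proof -
    obtain w' where "w' \<in> D a j" "w' \<noteq> 0"
      using D_nontrivial_reflect1[OF w] w ab by (cases "a = i") (auto simp: abs_eq_iff)
    then show ?thesis
      using D_nontrivial_reflect2[of w' a j] ab by (cases "b = j") (auto simp: abs_eq_iff)
  qed
  have diag: "\<bar>i\<bar> = \<bar>j\<bar>" if w: "w \<in> D i j" "w \<noteq> 0" and ij: "i \<noteq> 0" "j \<noteq> 0" for i j w
  proof -
    obtain u where u: "u \<in> D \<bar>i\<bar> (- \<bar>j\<bar>)" "u \<noteq> 0" using refl[OF w, of "\<bar>i\<bar>" "- \<bar>j\<bar>"] by auto
    obtain u' where u': "u' \<in> D (- \<bar>i\<bar>) \<bar>j\<bar>" "u' \<noteq> 0" using refl[OF w, of "- \<bar>i\<bar>" "\<bar>j\<bar>"] by auto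
    have "\<not> \<bar>i\<bar> > \<bar>j\<bar>" using D_nonneg2[OF u] ij by auto
    moreover have "\<not> \<bar>j\<bar> > \<bar>i\<bar>" using D_nonneg1[OF u'] ij by auto
    ultimately show ?thesis by simp
  qed
  show ?thesis
  proof (rule ccontr)
    assume i: "\<not> \<bar>i\<bar> \<le> 2"
    obtain u where u: "u \<in> D (- \<bar>i\<bar>) j" "u \<noteq> 0" using refl[OF v, of "- \<bar>i\<bar>" j] by auto
    have neg: "- \<bar>i\<bar> < 0" using i by simp
    have "bracket x1 u \<in> D (2 - \<bar>i\<bar>) j" using D_bracket[OF x1_D u(1)] by simp
    moreover have "bracket x1 u \<noteq> 0"
      using sl1.up_inj[of u "- \<bar>i\<bar>", OF _ neg] u by (auto simp: D_def eigenspace_eq_weight_space)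
    ultimately have "\<bar>2 - \<bar>i\<bar>\<bar> = \<bar>j\<bar>" using diag i j by force
    moreover have "\<bar>i\<bar> = \<bar>j\<bar>" using diag[OF v] i j by force
    ultimately show False using i by arith
  qed
qed

lemma gr_nontrivial_D:
  assumes p: "gr p \<noteq> {0}" "p \<ge> 3"
  shows "(\<exists>v. v \<in> D (2 * p) 0 \<and> v \<noteq> 0) \<or> (\<exists>v. v \<in> D 0 (2 * p) \<and> v \<noteq> 0)"
proof -
  obtain v where v: "v \<in> gr p" "v \<noteq> 0" using p(1) subspace_0[OF gr_subspace] by blast
  have comm: "bracket H0 (bracket h1 w) = bracket h1 (bracket H0 w)" for w
    using h1_gr bracket_derivation[of H0 h1 w] by (simp add: gr_eigenspace)
  have Hv: "bracket H0 v = smul (of_int p) v" using v(1) by (simp add: gr_eigenspace)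
  obtain S a where S: "finite S" "\<And>i. i \<in> S \<Longrightarrow> a i \<in> sl1.wt i"
      "\<And>i. i \<in> S \<Longrightarrow> bracket H0 (a i) = smul (of_int p) (a i)" "v = (\<Sum>i\<in>S. a i)"
    by (rule sl1.commuting_eigenvector_decomposition[OF sl1.span_wt_UNIV bracket_linear_right comm Hv]) blast
  obtain i where i: "i \<in> S" "a i \<noteq> 0" using S(4) v(2) by (metis sum.neutral)
  have "a i \<in> gr p" "a i \<in> eigenspace h1 i"
    using S(2,3)[OF i(1)] by (auto simp: gr_eigenspace eigenspace_eq_weight_space)
  from D_eqI[OF this] have ai: "a i \<in> D i (2 * p - i)" .
  \<comment> \<open>Two non-zero indices would each be at most 2 in absolute value, while their sum
    is \<open>2 * p \<ge> 6\<close>.\<close>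
  have "i = 0 \<or> 2 * p - i = 0"
  proof (rule ccontr)
    assume "\<not> (i = 0 \<or> 2 * p - i = 0)"
    hence "\<bar>i\<bar> \<le> 2" "\<bar>2 * p - i\<bar> \<le> 2"
      using D_nontrivial_bound[OF ai i(2)] ai i(2)
        very_special_decomposition.D_nontrivial_bound[OF swapped, of "a i" "2 * p - i" i]
      by (auto simp: D_swapped)
    with p(2) show False by linarith
  qed
  thus ?thesis using ai i(2) by fastforce
qed

text \<open>This is the centralizer of the ideal generated by the \<open>h2\<close>-weight vectors
  of non-zero weight, written without generating that ideal.\<close>

definition trivial_ideal :: "'b set" where
  "trivial_ideal = {u. bracket h2 u = 0 \<and> (\<forall>l v. l \<noteq> 0 \<longrightarrow> v \<in> eigenspace h2 l \<longrightarrow> bracket u v = 0)}"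

text \<open>It suffices to bracket with \<open>h2\<close>-weight vectors, since these span. One of
  non-zero weight commutes with \<open>u\<close>; one of weight 0 preserves every weight space of
  \<open>h2\<close>, and the Jacobi identity does the rest.\<close>

lemma ideal_trivial_ideal: "ideal trivial_ideal"
proof -
  have "bracket w u \<in> trivial_ideal" if u: "u \<in> trivial_ideal" for w u
  proof -
    have weight: "bracket w u \<in> trivial_ideal" if "w \<in> eigenspace h2 i" for w i
    proof (cases "i = 0")
      case False
      with u that have "bracket u w = 0" by (auto simp: trivial_ideal_def)
      hence "bracket w u = 0" using bracket_antisym[of w u] by simp
      with that show ?thesis by (simp add: trivial_ideal_def)
    next
      case True
      hence w: "bracket h2 w = 0" using that by (simp add: eigenspace_def)
      have "bracket h2 (bracket w u) = 0"
        using bracket_derivation[of h2 w u] w u by (simp add: trivial_ideal_def)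
      moreover have "bracket (bracket w u) m = 0" if m: "l \<noteq> 0" "m \<in> eigenspace h2 l" for l m
      proof -
        have "bracket w m \<in> eigenspace h2 l" using eigenspace_bracket[of w h2 0 m l] w m
          by (simp add: eigenspace_def)
        hence "bracket u (bracket w m) = 0" "bracket u m = 0"
          using u m by (auto simp: trivial_ideal_def)
        with bracket_derivation[of w u m] show ?thesis by simp
      qed
      ultimately show ?thesis by (auto simp: trivial_ideal_def)
    qed
    have "w \<in> span (\<Union>i. sl2.wt i)" by (simp add: sl2.span_wt_UNIV)
    thus ?thesis
    proof (induction rule: span_induct_alt)
      case base
      show ?case by (simp add: trivial_ideal_def)
    next
      case (step c x y)
      with weight show ?case
        by (auto simp: trivial_ideal_def bracket_add_left bracket_add_right bracket_scale_left
            bracket_scale_right eigenspace_eq_weight_space)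
    qed
  qed
  moreover have "subspace trivial_ideal"
    by (auto simp: subspace_def trivial_ideal_def bracket_add_left bracket_add_right
        bracket_scale_left bracket_scale_right)
  ultimately show ?thesis by (auto simp: ideal_def)
qed

text \<open>For \<open>a i\<close> in \<open>D i l\<close> with \<open>l \<noteq> 0\<close> the
  bracket lies in \<open>D (2 * p + i) l\<close>. Were it non-zero,
  \<open>D_nontrivial_bound\<close> would apply to both vectors, and \<open>i\<close> and
  \<open>2 * p + i\<close> cannot both be at most 2 in absolute value when
  \<open>p \<ge> 3\<close>.\<close>

lemma D_subset_trivial_ideal:
  assumes p: "p \<ge> 3" and u: "u \<in> D (2 * p) 0"
  shows "u \<in> trivial_ideal"
proof -
  have "bracket u m = 0" if l: "l \<noteq> 0" and m: "m \<in> eigenspace h2 l" for l m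
  proof -
    have comm: "bracket h2 (bracket h1 w) = bracket h1 (bracket h2 w)" for w
    proof -
      have "bracket h1 h2 = bracket h1 (smul 2 H0)"
        using bracket_self[of h1] by (simp add: h1_h2[symmetric] bracket_add_right)
      also have "\<dots> = - smul 2 (bracket H0 h1)"
        using bracket_antisym[of h1 H0] by (simp add: bracket_scale_right)
      also have "bracket H0 h1 = 0"
        using h1_gr by (simp add: gr_eigenspace)
      finally have "bracket h1 h2 = 0" by simp
      thus ?thesis using bracket_derivation[of h1 h2 w] by simp
    qed
    have "bracket h2 m = smul (of_int l) m" using m by (simp add: eigenspace_def)
    then obtain S a where S: "\<And>i. i \<in> S \<Longrightarrow> a i \<in> sl1.wt i"
        "\<And>i. i \<in> S \<Longrightarrow> bracket h2 (a i) = smul (of_int l) (a i)" "m = (\<Sum>i\<in>S. a i)"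
      by (rule sl1.commuting_eigenvector_decomposition[OF sl1.span_wt_UNIV bracket_linear_right comm]) blast
    have "bracket u (a i) = 0" if i: "i \<in> S" for i
    proof (rule ccontr)
      assume nz: "bracket u (a i) \<noteq> 0"
      have ai: "a i \<in> D i l" using S(1,2)[OF i]
        by (simp add: D_def eigenspace_eq_weight_space weight_space_def)
      have "a i \<noteq> 0" using nz by auto
      with D_nontrivial_bound[OF ai] l have "\<bar>i\<bar> \<le> 2" by blast
      moreover have "bracket u (a i) \<in> D (2 * p + i) l" using D_bracket[OF u ai] by simp
      with D_nontrivial_bound nz l have "\<bar>2 * p + i\<bar> \<le> 2" by blast
      ultimately show False using p by linarith
    qed
    thus ?thesis by (simp add: S(3) bracket_sum_right)
  qed
  with u show ?thesis by (auto simp: trivial_ideal_def D_def eigenspace_def)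
qed

text \<open>\<open>bracket y0\<close> lowers the degree by one, preserves \<open>I\<close>, and is
  injective on positive weights of \<open>2 H0\<close>.\<close>

lemma ideal_gr_nontrivial_descend:
  assumes "ideal I" "v \<in> I" "v \<in> gr (int (Suc n))" "v \<noteq> 0"
  shows "\<exists>w. w \<in> I \<and> w \<in> gr 1 \<and> w \<noteq> 0"
  using assms(2-4)
proof (induction n arbitrary: v)
  case 0
  thus ?case by auto
next
  case (Suc n)
  have "bracket y0 v \<in> gr (int (Suc n))" using gr_bracket[OF y0 Suc.prems(2)] by simp
  moreover have "bracket y0 v \<noteq> 0"
    using sl0.dn_inj[of v "2 * int (Suc (Suc n))"] Suc.prems
    by (auto simp: gr_eigenspace_2H0 eigenspace_eq_weight_space)
  ultimately show ?case using Suc ideal_bracket_right[OF assms(1)] by blast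
qed

lemma ad_square_inj_x0:
  assumes "d \<in> gr (- 1)" "bracket x0 (bracket x0 d) = 0"
  shows "d = 0"
  using sl0.up_pow_inj[of d 2] assms
  by (simp add: gr_eigenspace_2H0 eigenspace_eq_weight_space numeral_2_eq_2)

lemma ad_square_inj_y0:
  assumes "c \<in> gr 1" "bracket y0 (bracket y0 c) = 0"
  shows "c = 0"
  using sl0.dn_pow_inj[of c 2] assms
  by (simp add: gr_eigenspace_2H0 eigenspace_eq_weight_space numeral_2_eq_2 bracket_neg_right)

lemma ad_square_inj_x1:
  assumes "d \<in> trivial_ideal" "d \<in> gr (- 1)" "bracket x1 (bracket x1 d) = 0"
  shows "d = 0"
proof -
  have "bracket h1 d = - smul 2 d"
    using assms(1,2) bracket_h1_h2[of d] by (simp add: trivial_ideal_def gr_eigenspace)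
  hence "d \<in> sl1.wt (- int 2)" by (simp add: weight_space_def)
  with sl1.up_pow_inj[of d 2] assms(3) show ?thesis by (simp add: numeral_2_eq_2)
qed

text \<open>The vector lies in \<open>D 4 (- 2)\<close>: total weight 2 is positive while the second
  weight is negative, which specialness excludes.\<close>

lemma ad_square_y2: "bracket x1 (bracket x1 y2) = 0"
proof (rule ccontr)
  assume nz: "\<not> ?thesis"
  have "bracket x1 (bracket x1 y2) \<in> D (2 + (2 + 0)) (0 + (0 + - 2))"
    by (intro D_bracket x1_D y2_D)
  from D_nonneg2[OF this nz] show False by simp
qed

text \<open>The squares of \<open>bracket x0\<close> and \<open>bracket y0\<close> inject the two
  pieces into each other, inside \<open>I\<close>. This makes the matrix of the square of
  \<open>bracket x\<close> between them square for every \<open>x\<close> in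
  \<open>gr 1\<close>.\<close>

lemma gr_dim_ideal:
  assumes I: "ideal I"
  shows "dim (I \<inter> gr 1) = dim (I \<inter> gr (- 1))"
proof (rule antisym)
  interpret pair: finite_dimensional_vector_space_pair_1 smul Basis smul ..
  have le: "dim (I \<inter> gr i) \<le> dim (I \<inter> gr j)"
    if inj: "\<And>d. d \<in> gr i \<Longrightarrow> bracket x (bracket x d) = 0 \<Longrightarrow> d = 0"
      and x: "x \<in> gr k" and k: "j = k + (k + i)" for x i j k
  proof -
    have lin: "Vector_Spaces.linear smul smul (\<lambda>d. bracket x (bracket x d))"
      by unfold_locales (simp_all add: bracket_add_right bracket_scale_right)
    have sub: "subspace (I \<inter> gr i)" by (intro subspace_inter ideal_subspace I gr_subspace)
    have "inj_on (\<lambda>d. bracket x (bracket x d)) (I \<inter> gr i)"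
    proof (rule inj_onI)
      fix a b assume ab: "a \<in> I \<inter> gr i" "b \<in> I \<inter> gr i"
        "bracket x (bracket x a) = bracket x (bracket x b)"
      have "a - b \<in> gr i" using ab by (auto intro: subspace_diff gr_subspace)
      with inj[of "a - b"] ab(3) show "a = b" by (simp add: bracket_diff_right)
    qed
    hence "dim ((\<lambda>d. bracket x (bracket x d)) ` (I \<inter> gr i)) = dim (I \<inter> gr i)"
      using sub lin by (intro pair.dim_image_eq) (auto simp: span_eq_iff[THEN iffD2])
    moreover have "(\<lambda>d. bracket x (bracket x d)) ` (I \<inter> gr i) \<subseteq> I \<inter> gr j"
    proof (intro subsetI, elim imageE, intro IntI)
      fix u d assume d: "d \<in> I \<inter> gr i" "u = bracket x (bracket x d)"
      show "u \<in> I" unfolding d(2) using d(1) I by (intro ideal_bracket_right) auto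
      show "u \<in> gr j" unfolding d(2) k using d(1) x by (intro gr_bracket) auto
    qed
    ultimately show ?thesis by (metis dim_subset)
  qed
  show "dim (I \<inter> gr (- 1)) \<le> dim (I \<inter> gr 1)"
    by (rule le[OF ad_square_inj_x0 x0]) auto
  show "dim (I \<inter> gr 1) \<le> dim (I \<inter> gr (- 1))"
    by (rule le[OF ad_square_inj_y0 y0]) auto
qed

lemma gr_negative_nontrivial:
  assumes "gr p \<noteq> {0}" "p < 0"
  shows "gr (- p) \<noteq> {0}"
proof -
  obtain v where v: "v \<in> gr p" "v \<noteq> 0" using assms subspace_0[OF gr_subspace] by blast
  obtain n where n: "p = - int n" using assms(2) by (metis int_cases2 not_less of_nat_0_le_iff)
  have "(bracket x0 ^^ (2 * n)) v \<noteq> 0"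
    using sl0.up_pow_inj[of v "2 * n"] v n
    by (auto simp: gr_eigenspace_2H0 eigenspace_eq_weight_space)
  moreover have "(bracket x0 ^^ (2 * n)) v \<in> gr (p + int (2 * n) * 1)"
    by (rule ad_pow_gr[OF x0 v(1)])
  ultimately show ?thesis using n by auto
qed

end


section \<open>Determinants of function matrices\<close>

definition detf :: "nat \<Rightarrow> (nat \<Rightarrow> nat \<Rightarrow> 'a::comm_ring_1) \<Rightarrow> 'a" where
  "detf n M = det (mat n n (\<lambda>(i, j). M i j))"

lemma detf_leibniz:
  "detf n M = (\<Sum>p | p permutes {0..<n}. signof p * (\<Prod>i = 0..<n. M i (p i)))"
proof -
  have "(\<Prod>i = 0..<n. mat n n (\<lambda>(i, j). M i j) $$ (i, p i)) = (\<Prod>i = 0..<n. M i (p i))"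
    if "p permutes {0..<n}" for p
    using that by (intro prod.cong) (auto simp: permutes_in_image dest: permutes_in_image[of p _ _])
  thus ?thesis unfolding detf_def by (subst det_def'[of _ n]) (auto intro!: sum.cong)
qed

text \<open>Only closure properties of \<open>Q\<close> are assumed because two notions of
  polynomial function are substituted for it: the restricted functions of
  \<open>polynomial_functions\<close> and the total ones of \<open>coord_polys\<close>.\<close>

lemma detf_closed:
  assumes const: "\<And>c. Q (\<lambda>x. c)"
    and add: "\<And>f g. Q f \<Longrightarrow> Q g \<Longrightarrow> Q (\<lambda>x. f x + g x)"
    and mult: "\<And>f g. Q f \<Longrightarrow> Q g \<Longrightarrow> Q (\<lambda>x. f x * g x)"
    and M: "\<And>i j. i < n \<Longrightarrow> j < n \<Longrightarrow> Q (\<lambda>x. M x i j)"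
  shows "Q (\<lambda>x. detf n (M x))"
proof -
  have sum: "Q (\<lambda>x. \<Sum>p\<in>A. f p x)" if "\<And>p. p \<in> A \<Longrightarrow> Q (f p)" for A :: "(nat \<Rightarrow> nat) set" and f
    using that by (induction A rule: infinite_finite_induct) (auto intro: const add)
  have prod: "Q (\<lambda>x. \<Prod>i\<in>A. f i x)" if "\<And>i. i \<in> A \<Longrightarrow> Q (f i)" for A :: "nat set" and f
    using that by (induction A rule: infinite_finite_induct) (auto intro: const mult)
  show ?thesis
    unfolding detf_leibniz
    by (rule sum, rule mult, rule const, rule prod, rule M)
      (auto simp: permutes_in_image dest: permutes_in_image)
qed

lemma (in comm_ring_hom) hom_detf: "hom (detf n M) = detf n (\<lambda>i j. hom (M i j))"
  unfolding detf_def hom_det[symmetric] by (rule arg_cong[of _ _ det]) auto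

lemma comm_ring_hom_to_ac: "comm_ring_hom to_ac"
  by unfold_locales auto

lemma detf_eq_0_iff:
  fixes M :: "nat \<Rightarrow> nat \<Rightarrow> 'a::field"
  shows "detf n M = 0 \<longleftrightarrow> (\<exists>a. (\<exists>j<n. a j \<noteq> 0) \<and> (\<forall>i<n. (\<Sum>j<n. M i j * a j) = 0))"
proof -
  let ?A = "mat n n (\<lambda>(i, j). M i j)"
  have A: "?A \<in> carrier_mat n n" by simp
  have mv: "(?A *\<^sub>v v) $ i = (\<Sum>j<n. M i j * v $ j)" if "v \<in> carrier_vec n" "i < n" for v i
    using that by (auto simp: scalar_prod_def atLeast0LessThan intro!: sum.cong)
  have "detf n M = 0 \<longleftrightarrow> (\<exists>v. v \<in> carrier_vec n \<and> v \<noteq> 0\<^sub>v n \<and> ?A *\<^sub>v v = 0\<^sub>v n)"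
    unfolding detf_def by (rule det_0_iff_vec_prod_zero_field[OF A])
  also have "\<dots> \<longleftrightarrow> (\<exists>a. (\<exists>j<n. a j \<noteq> 0) \<and> (\<forall>i<n. (\<Sum>j<n. M i j * a j) = 0))"
  proof
    assume "\<exists>v. v \<in> carrier_vec n \<and> v \<noteq> 0\<^sub>v n \<and> ?A *\<^sub>v v = 0\<^sub>v n"
    then obtain v where v: "v \<in> carrier_vec n" "v \<noteq> 0\<^sub>v n" "?A *\<^sub>v v = 0\<^sub>v n" by blast
    have "\<exists>j<n. v $ j \<noteq> 0"
    proof (rule ccontr)
      assume "\<not> ?thesis"
      hence "v = 0\<^sub>v n" using v(1) by (intro eq_vecI) auto
      with v(2) show False ..
    qed
    moreover have "(\<Sum>j<n. M i j * v $ j) = 0" if "i < n" for i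
      using mv[OF v(1) that] v(3) that by simp
    ultimately show "\<exists>a. (\<exists>j<n. a j \<noteq> 0) \<and> (\<forall>i<n. (\<Sum>j<n. M i j * a j) = 0)"
      by (intro exI[of _ "\<lambda>j. v $ j"]) auto
  next
    assume "\<exists>a. (\<exists>j<n. a j \<noteq> 0) \<and> (\<forall>i<n. (\<Sum>j<n. M i j * a j) = 0)"
    then obtain a j where a: "j < n" "a j \<noteq> 0" "\<And>i. i < n \<Longrightarrow> (\<Sum>j<n. M i j * a j) = 0" by blast
    let ?v = "vec n a"
    have v: "?v \<in> carrier_vec n" by simp
    have "?v \<noteq> 0\<^sub>v n"
    proof
      assume "?v = 0\<^sub>v n"
      hence "?v $ j = 0\<^sub>v n $ j" by simp
      with a(1,2) show False by simp
    qed
    moreover have "?A *\<^sub>v ?v = 0\<^sub>v n"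
    proof (rule eq_vecI)
      fix i assume "i < dim_vec (0\<^sub>v n :: 'a vec)"
      hence i: "i < n" by simp
      have "(?A *\<^sub>v ?v) $ i = (\<Sum>j<n. M i j * ?v $ j)" by (rule mv[OF v i])
      also have "\<dots> = (\<Sum>j<n. M i j * a j)" by (rule sum.cong) auto
      finally show "(?A *\<^sub>v ?v) $ i = 0\<^sub>v n $ i" using a(3)[OF i] i by simp
    qed simp
    ultimately show "\<exists>v. v \<in> carrier_vec n \<and> v \<noteq> 0\<^sub>v n \<and> ?A *\<^sub>v v = 0\<^sub>v n" using v by blast
  qed
  finally show ?thesis .
qed

lemma detf_scale: "detf n (\<lambda>i j. c * M i j) = c ^ n * detf n M"
  unfolding detf_leibniz sum_distrib_left
  by (rule sum.cong) (simp_all add: prod.distrib algebra_simps)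

text \<open>Stated over a commutative ring: the entries will be polynomials in the path
  parameter.\<close>

lemma detf_adjugate:
  "\<exists>A. \<forall>i<n. \<forall>k<n. (\<Sum>j<n. M i j * A j k) = (if i = k then detf n M else 0)"
proof -
  let ?M = "mat n n (\<lambda>(i, j). M i j)"
  have M: "?M \<in> carrier_mat n n" by simp
  note adj = adj_mat[OF M]
  have "(\<Sum>j<n. M i j * adj_mat ?M $$ (j, k)) = (if i = k then detf n M else 0)" if ik: "i < n" "k < n" for i k
  proof -
    have "(\<Sum>j<n. M i j * adj_mat ?M $$ (j, k)) = (?M * adj_mat ?M) $$ (i, k)"
      using ik adj(1) by (auto simp: scalar_prod_def atLeast0LessThan intro!: sum.cong)
    also have "\<dots> = (if i = k then detf n M else 0)"
      unfolding adj(2) using ik by (simp add: detf_def)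
    finally show ?thesis .
  qed
  thus ?thesis by (intro exI[of _ "\<lambda>j k. adj_mat ?M $$ (j, k)"]) blast
qed

text \<open>\<open>c\<close> and \<open>d\<close> are independent families, not bases of the ambient
  space, so that \<open>f\<close> can be viewed as a map between two different graded
  pieces.\<close>

lemma (in vector_space) detf_eq_0_iff_kernel:
  assumes f: "Vector_Spaces.linear scale scale f"
    and fd: "\<And>j. j < n \<Longrightarrow> f (d j) = (\<Sum>i<n. scale (M i j) (c i))"
    and ind_c: "\<And>a. (\<Sum>i<n. scale (a i) (c i)) = 0 \<Longrightarrow> \<forall>i<n. a i = 0"
    and ind_d: "\<And>a. (\<Sum>i<n. scale (a i) (d i)) = 0 \<Longrightarrow> \<forall>i<n. a i = 0"
  shows "detf n M = 0 \<longleftrightarrow> (\<exists>v \<in> span (d ` {..<n}). v \<noteq> 0 \<and> f v = 0)"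
proof -
  interpret f: Vector_Spaces.linear scale scale f by fact
  have fsum: "f (\<Sum>j<n. scale (a j) (d j)) = (\<Sum>i<n. scale (\<Sum>j<n. M i j * a j) (c i))" for a
  proof -
    have "f (\<Sum>j<n. scale (a j) (d j)) = (\<Sum>j<n. \<Sum>i<n. scale (a j * M i j) (c i))"
      by (simp add: f.sum f.scale fd scale_sum_right)
    also have "\<dots> = (\<Sum>i<n. \<Sum>j<n. scale (a j * M i j) (c i))" by (rule sum.swap)
    finally show ?thesis by (simp add: scale_sum_left mult.commute)
  qed
  show ?thesis
  proof
    assume "detf n M = 0"
    then obtain a j where a: "j < n" "a j \<noteq> 0" "\<forall>i<n. (\<Sum>j<n. M i j * a j) = 0"
      unfolding detf_eq_0_iff by blast
    let ?v = "\<Sum>j<n. scale (a j) (d j)"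
    have "f ?v = 0" unfolding fsum using a(3) by simp
    moreover have "?v \<noteq> 0" using ind_d[of a] a(1,2) by blast
    moreover have "?v \<in> span (d ` {..<n})" by (intro span_sum span_scale span_base) auto
    ultimately show "\<exists>v \<in> span (d ` {..<n}). v \<noteq> 0 \<and> f v = 0" by blast
  next
    assume "\<exists>v \<in> span (d ` {..<n}). v \<noteq> 0 \<and> f v = 0"
    then obtain v where v: "v \<in> span (d ` {..<n})" "v \<noteq> 0" "f v = 0" by blast
    have "\<exists>a. v = (\<Sum>j<n. scale (a j) (d j))"
      using v(1)
    proof (induction rule: span_induct_alt)
      case base
      show ?case by (rule exI[of _ "\<lambda>_. 0"]) simp
    next
      case (step r x y)
      then obtain a k where a: "y = (\<Sum>j<n. scale (a j) (d j))" "x = d k" "k < n" by auto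
      have "scale r x + y = (\<Sum>j<n. scale (a j + (if j = k then r else 0)) (d j))"
        using a by (simp add: scale_left_distrib sum.distrib if_distrib[of "\<lambda>r. scale r _"] sum.delta
            cong: if_cong)
      thus ?case by (rule exI[of _ "\<lambda>j. a j + (if j = k then r else 0)"])
    qed
    then obtain a where a: "v = (\<Sum>j<n. scale (a j) (d j))" by blast
    have "\<exists>j<n. a j \<noteq> 0" using v(2) unfolding a by (metis (no_types, lifting) lessThan_iff scale_zero_left sum.neutral)
    moreover have "\<forall>i<n. (\<Sum>j<n. M i j * a j) = 0"
      using ind_c[of "\<lambda>i. \<Sum>j<n. M i j * a j"] v(3) unfolding a fsum by blast
    ultimately show "detf n M = 0" unfolding detf_eq_0_iff by blast
  qed
qed

section \<open>Irreducible divisors of homogeneous polynomials\<close>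

locale polynomial_space = vector_space smul
  for smul :: "'k::field_char_0 \<Rightarrow> 'v::ab_group_add \<Rightarrow> 'v" +
  fixes W :: "'v set"
  assumes subspace_W: "subspace W"
begin

abbreviation PF :: "('v \<Rightarrow> 'k) set" where "PF \<equiv> polynomial_functions smul W"

text \<open>Restriction to lines is the only source of degrees and of zero counting for polynomial
  functions.\<close>

lemma PF_line:
  assumes "p \<in> PF" "a \<in> W" "b \<in> W"
  shows "\<exists>q. \<forall>s. p (a + smul s b) = poly q s"
  using assms
proof (induction rule: polynomial_functions.induct)
  case (const c)
  thus ?case using subspace_W
    by (intro exI[of _ "[:c:]"]) (auto simp: subspace_def)
next
  case (functional f)
  interpret f: Vector_Spaces.linear smul "(*)" f by fact
  show ?case using functional subspace_W
    by (intro exI[of _ "[:f a, f b:]"]) (auto simp: subspace_def f.add f.scale)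
next
  case (add p q)
  then obtain p' q' where "\<forall>s. p (a + smul s b) = poly p' s" "\<forall>s. q (a + smul s b) = poly q' s" by blast
  thus ?case using add subspace_W
    by (intro exI[of _ "p' + q'"]) (auto simp: subspace_def)
next
  case (mult p q)
  then obtain p' q' where "\<forall>s. p (a + smul s b) = poly p' s" "\<forall>s. q (a + smul s b) = poly q' s" by blast
  thus ?case using mult subspace_W
    by (intro exI[of _ "p' * q'"]) (auto simp: subspace_def)
qed

lemma PF_extensional: "p \<in> PF \<Longrightarrow> x \<notin> W \<Longrightarrow> p x = undefined"
  by (induction rule: polynomial_functions.induct) auto

lemma PF_eqI:
  assumes "p \<in> PF" "q \<in> PF" "\<And>x. x \<in> W \<Longrightarrow> p x = q x"
  shows "p = q"
proof
  show "p x = q x" for x 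
    using assms(3) PF_extensional[OF assms(1)] PF_extensional[OF assms(2)] by (cases "x \<in> W") simp_all
qed

text \<open>The hypothesis on \<open>l\<close> gives \<open>p 0 = p x0 \<noteq> 0\<close>. On the
  line through 0 and a point \<open>x\<close> with \<open>P x \<noteq> 0\<close>, the product of the
  restrictions of \<open>p\<close> and \<open>q\<close> is the monomial \<open>P x * s ^ N\<close>;
  a factor that does not vanish at 0 must be constant. The remaining points follow by density along
  lines through \<open>x0\<close>.\<close>

lemma homogeneous_divisor_constant:
  assumes p: "p \<in> PF" and q: "q \<in> PF" and pq: "\<And>x. x \<in> W \<Longrightarrow> p x * q x = P x"
    and hom: "\<And>s x. x \<in> W \<Longrightarrow> P (smul s x) = s ^ N * P x"
    and x0: "x0 \<in> W" "P x0 \<noteq> 0" and l: "\<And>s. p (smul s x0) = poly l s" and deg: "degree l = 0"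
    and x: "x \<in> W"
  shows "p x = p x0"
proof -
  have W: "smul s x \<in> W" if "x \<in> W" for s x
    using that subspace_W by (simp add: subspace_def)
  have W0: "0 \<in> W" using subspace_W by (simp add: subspace_def)
  obtain c where c: "l = [:c:]" using deg degree_eq_zeroE by blast
  have px0: "p x0 = c" using l[of 1] c by simp
  have p0: "p 0 = c" using l[of 0] c by simp
  have c0: "c \<noteq> 0" using pq[OF x0(1)] x0(2) px0 by auto
  have generic: "p x = c" if x: "x \<in> W" "P x \<noteq> 0" for x
  proof -
    obtain a where a: "\<And>s. p (smul s x) = poly a s" using PF_line[OF p W0 x(1)] by auto
    obtain b where b: "\<And>s. q (smul s x) = poly b s" using PF_line[OF q W0 x(1)] by auto
    have "poly (a * b) s = poly (monom (P x) N) s" for s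
      using pq[OF W[OF x(1)], of s] hom[OF x(1), of s] by (simp add: a b poly_monom)
    hence ab: "a * b = monom (P x) N" using poly_eq_poly_eq_iff by blast
    have nz: "monom (P x) N \<noteq> 0" using x(2) by simp
    have a0: "poly a 0 \<noteq> 0" using a[of 0] p0 c0 by simp
    have b_nz: "b \<noteq> 0" and a_nz: "a \<noteq> 0" using ab nz by auto
    \<comment> \<open>All \<open>N\<close> zeros of \<open>a * b\<close> at 0 belong to
      \<open>b\<close>, which exhausts the degree and leaves none for \<open>a\<close>.\<close>
    have "order 0 (monom (P x) N) = N"
      using x(2) order_power_n_n[of 0 N] order_smult[of "P x" 0 "monom 1 N"]
      by (simp add: smult_monom monom_altdef)
    hence "N = order 0 a + order 0 b" using order_mult[of a b 0] ab nz by simp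
    also have "order 0 a = 0" using a0 by (rule order_0I)
    finally have "N \<le> degree b" using order_degree[OF b_nz] by simp
    moreover have "degree a + degree b = N"
      using degree_mult_eq[OF a_nz b_nz] ab x(2) by (simp add: degree_monom_eq)
    ultimately have "degree a = 0" by simp
    then obtain d where "a = [:d:]" using degree_eq_zeroE by blast
    with a[of 0] a[of 1] p0 show ?thesis by simp
  qed
  have dir: "x - x0 \<in> W" using x x0(1) subspace_W by (simp add: subspace_diff)
  have lin: "x0 + smul s (x - x0) \<in> W" for s using dir x0(1) W subspace_W by (simp add: subspace_add)
  obtain a where a: "\<And>s. p (x0 + smul s (x - x0)) = poly a s" using PF_line[OF p x0(1) dir] by blast
  obtain b where b: "\<And>s. q (x0 + smul s (x - x0)) = poly b s" using PF_line[OF q x0(1) dir] by blast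
  \<comment> \<open>Either \<open>P\<close> vanishes at the point of the line, or
    \<open>generic\<close> applies to it; since \<open>a * b\<close> is not the zero polynomial,
    \<open>a\<close> is constant.\<close>
  have "poly ((a - [:c:]) * (a * b)) s = 0" for s
  proof (cases "poly (a * b) s = 0")
    case False
    hence "P (x0 + smul s (x - x0)) \<noteq> 0" using pq[OF lin, of s] unfolding a b poly_mult by simp
    with generic[OF lin] show ?thesis by (simp add: a)
  qed simp
  hence "(a - [:c:]) * (a * b) = 0" using poly_all_0_iff_0 by blast
  moreover have "poly (a * b) 0 \<noteq> 0" using pq[OF x0(1)] x0(2) a[of 0] b[of 0] by simp
  ultimately have "a = [:c:]" by auto
  with a[of 1] px0 show ?thesis by simp
qed

text \<open>Degrees are taken on the line through 0 and \<open>x0\<close>, where no divisor of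
  \<open>P\<close> vanishes identically, so they are additive. Let \<open>p\<close> have least
  degree among the divisors vanishing at \<open>z\<close>. In a factorization of \<open>p\<close>
  one factor vanishes at \<open>z\<close> and has full degree; the other has degree 0 and is
  constant by \<open>homogeneous_divisor_constant\<close>.\<close>

lemma exists_irreducible_divisor:
  assumes P: "P \<in> PF" and hom: "\<And>s x. x \<in> W \<Longrightarrow> P (smul s x) = s ^ N * P x"
    and x0: "x0 \<in> W" "P x0 \<noteq> 0" and z: "z \<in> W" "P z = 0"
  obtains p q where "p \<in> PF" "q \<in> PF" "ring_irreducible\<^bsub>polynomial_ring smul W\<^esub> p" "p z = 0"
    "\<And>x. x \<in> W \<Longrightarrow> p x * q x = P x"
proof -
  let ?R = "polynomial_ring smul W"
  have W0: "0 \<in> W" using subspace_W by (simp add: subspace_def)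
  have "\<forall>p\<in>PF. \<exists>l. \<forall>s. p (smul s x0) = poly l s" using PF_line[OF _ W0 x0(1)] by simp
  then obtain l where l: "\<And>p s. p \<in> PF \<Longrightarrow> p (smul s x0) = poly (l p) s" by metis
  define Dv where "Dv p \<longleftrightarrow> p \<in> PF \<and> p z = 0 \<and> (\<exists>q\<in>PF. \<forall>x\<in>W. p x * q x = P x)" for p
  have "Dv P" unfolding Dv_def using P z
    by (auto intro!: bexI[of _ "\<lambda>x\<in>W. 1"] polynomial_functions.const)
  then obtain p where p: "Dv p" and min: "\<And>p'. Dv p' \<Longrightarrow> degree (l p) \<le> degree (l p')"
    using ex_has_least_nat[of Dv P "\<lambda>p. degree (l p)"] by blast
  obtain q where pPF: "p \<in> PF" and pz: "p z = 0" and q: "q \<in> PF" "\<And>x. x \<in> W \<Longrightarrow> p x * q x = P x"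
    using p unfolding Dv_def by blast
  have px0: "p x0 \<noteq> 0" using q(2)[OF x0(1)] x0(2) by auto
  have carrier: "carrier ?R = PF" by (simp add: polynomial_ring_def)
  have mult: "(f \<otimes>\<^bsub>?R\<^esub> g) x = f x * g x" if "x \<in> W" for f g x
    using that by (simp add: polynomial_ring_def)
  have mult_closed: "f \<otimes>\<^bsub>?R\<^esub> g \<in> PF" if "f \<in> PF" "g \<in> PF" for f g
    using that by (simp add: polynomial_ring_def polynomial_functions.mult)
  have one: "\<one>\<^bsub>?R\<^esub> = (\<lambda>x\<in>W. 1)" by (simp add: polynomial_ring_def)
  have onePF: "\<one>\<^bsub>?R\<^esub> \<in> PF" by (simp add: one polynomial_functions.const)
  have "p \<notin> Units ?R"
  proof
    assume "p \<in> Units ?R"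
    then obtain u where u: "p \<otimes>\<^bsub>?R\<^esub> u = \<one>\<^bsub>?R\<^esub>" by (auto simp: Units_def)
    have "(p \<otimes>\<^bsub>?R\<^esub> u) z = (1 :: 'k)" unfolding u using z by (simp add: one)
    with mult[OF z(1), of p u] pz show False by simp
  qed
  moreover have "b \<in> Units ?R" if b: "b \<in> PF" and pf: "properfactor ?R b p" for b
  proof -
    obtain c where c: "c \<in> PF" "p = b \<otimes>\<^bsub>?R\<^esub> c" and ndiv: "\<not> p divides\<^bsub>?R\<^esub> b"
      using pf by (auto simp: properfactor_def factor_def carrier)
    have bc: "b x * c x = p x" if "x \<in> W" for x using c(2) mult[OF that] by simp
    have b_div: "b x * (c \<otimes>\<^bsub>?R\<^esub> q) x = P x" and c_div: "c x * (b \<otimes>\<^bsub>?R\<^esub> q) x = P x"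
      if "x \<in> W" for x using q(2)[OF that] bc[OF that] by (simp_all add: mult[OF that] mult.left_commute mult.assoc[symmetric])
    have "poly (l b * l c) s = poly (l p) s" for s
      using bc[of "smul s x0"] x0(1) subspace_W l[OF b] l[OF c(1)] l[OF pPF] by (simp add: subspace_def)
    hence lp: "l b * l c = l p" using poly_eq_poly_eq_iff by blast
    have "poly (l p) 1 \<noteq> 0" using l[OF pPF, of 1] px0 by simp
    hence "l p \<noteq> 0" by auto
    with lp have deg: "degree (l p) = degree (l b) + degree (l c)"
      by (metis degree_mult_eq mult_zero_left mult_zero_right)
    have inv: "\<exists>g\<in>PF. \<forall>x\<in>W. f x * g x = 1"
      if f: "f \<in> PF" "degree (l f) = 0" and g: "g \<in> PF" "\<And>x. x \<in> W \<Longrightarrow> f x * g x = P x" for f g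
    proof -
      have "f x = f x0" if "x \<in> W" for x
        by (rule homogeneous_divisor_constant[OF f(1) g hom x0 l[OF f(1)] f(2) that])
      moreover have "f x0 \<noteq> 0" using g(2)[OF x0(1)] x0(2) by auto
      ultimately show ?thesis
        by (intro bexI[of _ "\<lambda>x\<in>W. inverse (f x0)"] polynomial_functions.const) simp
    qed
    \<comment> \<open>If \<open>c\<close> carries the zero, then \<open>b\<close> is a unit; if
      \<open>b\<close> does, then \<open>c\<close> is a unit and \<open>p\<close> divides
      \<open>b\<close>, contrary to \<open>properfactor\<close>.\<close>
    have "b z * c z = 0" using bc[OF z(1)] pz by simp
    hence "c z = 0 \<or> b z = 0" by auto
    thus ?thesis
    proof
      assume "c z = 0"
      hence "Dv c" unfolding Dv_def using c(1) c_div mult_closed[OF b q(1)] by blast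
      from min[OF this] deg have "degree (l b) = 0" by simp
      then obtain g where g: "g \<in> PF" "\<And>x. x \<in> W \<Longrightarrow> b x * g x = 1"
        using inv[OF b _ mult_closed[OF c(1) q(1)] b_div] by blast
      have "b \<otimes>\<^bsub>?R\<^esub> g = \<one>\<^bsub>?R\<^esub>" "g \<otimes>\<^bsub>?R\<^esub> b = \<one>\<^bsub>?R\<^esub>"
        using mult_closed b g mult onePF by (auto intro!: PF_eqI simp: one mult.commute)
      thus ?thesis using b g(1) by (auto simp: Units_def carrier)
    next
      assume "b z = 0"
      hence "Dv b" unfolding Dv_def using b b_div mult_closed[OF c(1) q(1)] by blast
      from min[OF this] deg have "degree (l c) = 0" by simp
      then obtain g where g: "g \<in> PF" "\<And>x. x \<in> W \<Longrightarrow> c x * g x = 1"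
        using inv[OF c(1) _ mult_closed[OF b q(1)] c_div] by blast
      have "b = p \<otimes>\<^bsub>?R\<^esub> g"
      proof (rule PF_eqI[OF b mult_closed[OF pPF g(1)]])
        fix x assume x: "x \<in> W"
        have "p x * g x = b x * (c x * g x)" using bc[OF x] by (simp add: mult.assoc)
        thus "b x = (p \<otimes>\<^bsub>?R\<^esub> g) x" using g(2)[OF x] mult[OF x] by simp
      qed
      with g(1) ndiv show ?thesis by (auto simp: factor_def carrier)
    qed
  qed
  moreover have "p \<noteq> \<zero>\<^bsub>?R\<^esub>"
  proof
    assume "p = \<zero>\<^bsub>?R\<^esub>"
    hence "p x0 = 0" using x0 by (simp add: polynomial_ring_def)
    with px0 show False ..
  qed
  ultimately have "ring_irreducible\<^bsub>?R\<^esub> p"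
    by (auto simp: ring_irreducible_def Divisibility.irreducible_def carrier)
  from that[OF pPF q(1) this pz q(2)] show thesis .
qed

end


section \<open>Extension of scalars to the algebraic closure\<close>

definition fscale :: "'a::field \<Rightarrow> ('b \<Rightarrow> 'a) \<Rightarrow> 'b \<Rightarrow> 'a" where
  "fscale c u = (\<lambda>b. c * u b)"

interpretation fs: vector_space fscale
  by unfold_locales (auto simp: fscale_def algebra_simps fun_eq_iff)

lemma fscale_apply: "fscale c u b = c * u b"
  by (simp add: fscale_def)

declare plus_fun_apply [simp del] zero_fun_apply [simp del]
lemmas fun_apply = fscale_apply plus_fun_apply zero_fun_apply minus_apply

lemma sum_fun_apply: "(\<Sum>a\<in>A. f a) x = (\<Sum>a\<in>A. f a x)"
  by (induction A rule: infinite_finite_induct) (auto simp: fun_apply)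

text \<open>The counterpart of \<open>polynomial_functions\<close> over the algebraic closure,
  generated by the coordinates. These functions are total, not restricted to a subspace.\<close>

inductive_set coord_polys :: "(('v \<Rightarrow> 'a::field) \<Rightarrow> 'a) set" where
  const: "(\<lambda>u. c) \<in> coord_polys"
| coord: "(\<lambda>u. u b) \<in> coord_polys"
| add: "p \<in> coord_polys \<Longrightarrow> q \<in> coord_polys \<Longrightarrow> (\<lambda>u. p u + q u) \<in> coord_polys"
| mult: "p \<in> coord_polys \<Longrightarrow> q \<in> coord_polys \<Longrightarrow> (\<lambda>u. p u * q u) \<in> coord_polys"

lemma coord_polys_sum:
  "(\<And>a. a \<in> A \<Longrightarrow> f a \<in> coord_polys) \<Longrightarrow> (\<lambda>u. \<Sum>a\<in>A. f a u) \<in> coord_polys"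
  by (induction A rule: infinite_finite_induct) (auto intro: coord_polys.intros)

text \<open>The degree bound \<open>M\<close> is uniform over all lines. The argument with finitely
  many values needs this, because there the line moves with the path parameter.\<close>

lemma coord_polys_line:
  fixes p :: "('v \<Rightarrow> 'a::field) \<Rightarrow> 'a"
  assumes "p \<in> coord_polys"
  shows "\<exists>M. \<forall>a b. \<exists>q. degree q \<le> M \<and> (\<forall>s. p (a + fscale s b) = poly q s)"
  using assms
proof induction
  case (const c)
  show ?case by (intro exI[of _ 0] allI exI[of _ "[:c:]"]) simp
next
  case (coord b)
  have "\<exists>q. degree q \<le> 1 \<and> (\<forall>s. (a + fscale s d) b = poly q s)" for a d :: "'v \<Rightarrow> 'a"
    by (rule exI[of _ "[:a b, d b:]"]) (auto simp: fun_apply)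
  thus ?case by blast
next
  case (add p q)
  then obtain M N where M: "\<And>a b. \<exists>r. degree r \<le> M \<and> (\<forall>s. p (a + fscale s b) = poly r s)"
    and N: "\<And>a b. \<exists>r. degree r \<le> N \<and> (\<forall>s. q (a + fscale s b) = poly r s)" by blast
  show ?case
  proof (intro exI[of _ "max M N"] allI)
    fix a b
    obtain r r' where "degree r \<le> M" "\<And>s. p (a + fscale s b) = poly r s"
      "degree r' \<le> N" "\<And>s. q (a + fscale s b) = poly r' s" using M N by meson
    thus "\<exists>r. degree r \<le> max M N \<and> (\<forall>s. p (a + fscale s b) + q (a + fscale s b) = poly r s)"
      by (intro exI[of _ "r + r'"]) (auto intro!: degree_add_le)
  qed
next
  case (mult p q)
  then obtain M N where M: "\<And>a b. \<exists>r. degree r \<le> M \<and> (\<forall>s. p (a + fscale s b) = poly r s)"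
    and N: "\<And>a b. \<exists>r. degree r \<le> N \<and> (\<forall>s. q (a + fscale s b) = poly r s)" by blast
  show ?case
  proof (intro exI[of _ "M + N"] allI)
    fix a b
    obtain r r' where "degree r \<le> M" "\<And>s. p (a + fscale s b) = poly r s"
      "degree r' \<le> N" "\<And>s. q (a + fscale s b) = poly r' s" using M N by meson
    thus "\<exists>r. degree r \<le> M + N \<and> (\<forall>s. p (a + fscale s b) * q (a + fscale s b) = poly r s)"
      using degree_mult_le[of r r'] by (intro exI[of _ "r * r'"]) auto
  qed
qed

context lie_algebra
begin

definition to_ext :: "'v \<Rightarrow> 'v \<Rightarrow> 'k alg_closure" where
  "to_ext v = (\<lambda>b. to_ac (representation Basis v b))"

definition fext :: "('v \<Rightarrow> 'k) \<Rightarrow> ('v \<Rightarrow> 'k alg_closure) \<Rightarrow> 'k alg_closure" where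
  "fext f u = (\<Sum>x\<in>Basis. u x * to_ac (f x))"

text \<open>The formula of \<open>ext_map\<close> without the restriction to
  \<open>ext_space\<close>, so that the map is linear on the whole function type.\<close>

definition mext :: "('v \<Rightarrow> 'v) \<Rightarrow> ('v \<Rightarrow> 'k alg_closure) \<Rightarrow> 'v \<Rightarrow> 'k alg_closure" where
  "mext s u = (\<lambda>b. fext (\<lambda>x. representation Basis (s x) b) u)"

lemma linear_coordinate: "Vector_Spaces.linear smul (*) (\<lambda>v. representation Basis v b)"
  by (rule linear_representation[OF independent_Basis span_Basis])

lemma basis_expansion: "(\<Sum>b\<in>Basis. smul (representation Basis v b) b) = v"
  by (rule sum_representation_eq[OF independent_Basis _ finite_Basis]) (auto simp: span_Basis)

lemma to_ext_add: "to_ext (u + v) = to_ext u + to_ext v"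
  and to_ext_scale: "to_ext (smul c v) = fscale (to_ac c) (to_ext v)"
  and to_ext_0 [simp]: "to_ext 0 = 0"
  and to_ext_sum: "to_ext (sum g A) = (\<Sum>a\<in>A. to_ext (g a))"
proof -
  have lin: "representation Basis (u + v) b = representation Basis u b + representation Basis v b"
    "representation Basis (smul c v) b = c * representation Basis v b"
    "representation Basis 0 b = 0"
    "representation Basis (sum g A) b = (\<Sum>a\<in>A. representation Basis (g a) b)" for b
  proof -
    interpret Vector_Spaces.linear smul "(*)" "\<lambda>v. representation Basis v b" by (rule linear_coordinate)
    show "representation Basis (u + v) b = representation Basis u b + representation Basis v b"
      "representation Basis (smul c v) b = c * representation Basis v b"
      "representation Basis 0 b = 0"
        "representation Basis (sum g A) b = (\<Sum>a\<in>A. representation Basis (g a) b)"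
      by (rule add scale zero sum)+
  qed
  show "to_ext (u + v) = to_ext u + to_ext v"
    "to_ext (smul c v) = fscale (to_ac c) (to_ext v)" "to_ext 0 = 0"
    "to_ext (sum g A) = (\<Sum>a\<in>A. to_ext (g a))"
    by (auto simp: to_ext_def lin to_ac_sum sum_fun_apply fun_eq_iff fun_apply)
qed

lemma to_ext_basis: "b \<in> Basis \<Longrightarrow> to_ext b = (\<lambda>x. if x = b then 1 else 0)"
  using representation_basis[OF independent_Basis] by (auto simp: to_ext_def fun_eq_iff)

lemma to_ext_in_ext_space: "to_ext v \<in> ext_space"
  using representation_ne_zero[of Basis v] by (auto simp: ext_space_def to_ext_def)

lemma ext_space_expansion:
  assumes "u \<in> ext_space"
  shows "u = (\<Sum>b\<in>Basis. fscale (u b) (to_ext b))"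
proof
  fix x
  have "(\<Sum>b\<in>Basis. fscale (u b) (to_ext b)) x = (\<Sum>b\<in>Basis. if b = x then u x else 0)"
    unfolding sum_fun_apply by (rule sum.cong) (auto simp: to_ext_basis fun_apply)
  also have "\<dots> = u x" using assms finite_Basis by (auto simp: ext_space_def)
  finally show "u x = (\<Sum>b\<in>Basis. fscale (u b) (to_ext b)) x" by simp
qed

lemma subspace_ext_space: "fs.subspace ext_space"
  by (auto simp: fs.subspace_def ext_space_def fun_apply)

lemma ext_space_eq_span: "ext_space = fs.span (range to_ext)"
proof
  show "ext_space \<subseteq> fs.span (range to_ext)"
  proof
    fix u assume "u \<in> ext_space"
    from ext_space_expansion[OF this] show "u \<in> fs.span (range to_ext)"
      by (metis (no_types, lifting) fs.span_sum fs.span_scale fs.span_base rangeI)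
  qed
  show "fs.span (range to_ext) \<subseteq> ext_space"
    using to_ext_in_ext_space by (intro fs.span_minimal subspace_ext_space) auto
qed

lemma linear_fext: "Vector_Spaces.linear fscale (*) (fext f)"
proof -
  interpret v: vector_space "(*) :: 'k alg_closure \<Rightarrow> _" by (rule vector_space_over_itself.vector_space_axioms)
  show ?thesis
    by unfold_locales (auto simp: fext_def fun_apply algebra_simps sum.distrib sum_distrib_left)
qed

lemma fext_to_ext:
  assumes "Vector_Spaces.linear smul (*) f"
  shows "fext f (to_ext v) = to_ac (f v)"
proof -
  interpret f: Vector_Spaces.linear smul "(*)" f by fact
  have "f v = f (\<Sum>b\<in>Basis. smul (representation Basis v b) b)" by (simp add: basis_expansion)
  also have "\<dots> = (\<Sum>b\<in>Basis. representation Basis v b * f b)" by (simp add: f.sum f.scale)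
  finally show ?thesis by (simp add: fext_def to_ext_def to_ac_sum)
qed

lemma fext_coord_polys: "fext f \<in> coord_polys"
proof -
  have "(\<lambda>u. \<Sum>x\<in>Basis. u x * to_ac (f x)) \<in> coord_polys"
    by (intro coord_polys_sum coord_polys.intros)
  thus ?thesis by (simp add: fext_def[abs_def])
qed

lemma linear_mext: "Vector_Spaces.linear fscale fscale (mext s)"
proof -
  have "fext f (u + v) = fext f u + fext f v" "fext f (fscale c u) = c * fext f u" for f u v c
    by (auto simp: fext_def fun_apply algebra_simps sum.distrib sum_distrib_left)
  thus ?thesis by unfold_locales (auto simp: mext_def fun_eq_iff fun_apply)
qed

lemma mext_to_ext:
  assumes "Vector_Spaces.linear smul smul s"
  shows "mext s (to_ext v) = to_ext (s v)"
proof
  fix b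
  have "Vector_Spaces.linear smul (*) ((\<lambda>v. representation Basis v b) \<circ> s)"
    by (rule Vector_Spaces.linear_compose[OF assms linear_coordinate])
  from fext_to_ext[OF this] show "mext s (to_ext v) b = to_ext (s v) b"
    by (simp add: mext_def to_ext_def o_def)
qed

lemma ext_map_eq_mext: "u \<in> ext_space \<Longrightarrow> ext_map s u = mext s u"
  by (simp add: ext_map_def mext_def fext_def)

lemma linear_ext_bracket_left: "Vector_Spaces.linear fscale fscale (\<lambda>u. ext_bracket u w)"
  by unfold_locales
    (auto simp: ext_bracket_def fun_eq_iff fun_apply algebra_simps sum.distrib sum_distrib_left)

lemma linear_ext_bracket_right: "Vector_Spaces.linear fscale fscale (ext_bracket u)"
  by unfold_locales
    (auto simp: ext_bracket_def fun_eq_iff fun_apply algebra_simps sum.distrib sum_distrib_left)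

lemma ext_bracket_add_left: "ext_bracket (u + v) w = ext_bracket u w + ext_bracket v w"
  and ext_bracket_scale_left: "ext_bracket (fscale c u) w = fscale c (ext_bracket u w)"
  and ext_bracket_0_left [simp]: "ext_bracket 0 w = 0"
  and ext_bracket_sum_left: "ext_bracket (sum g A) w = (\<Sum>a\<in>A. ext_bracket (g a) w)"
proof -
  interpret Vector_Spaces.linear fscale fscale "\<lambda>u. ext_bracket u w" by (rule linear_ext_bracket_left)
  show "ext_bracket (u + v) w = ext_bracket u w + ext_bracket v w"
    "ext_bracket (fscale c u) w = fscale c (ext_bracket u w)" "ext_bracket 0 w = 0"
    "ext_bracket (sum g A) w = (\<Sum>a\<in>A. ext_bracket (g a) w)"
    by (rule add scale zero sum)+
qed

lemma ext_bracket_add_right: "ext_bracket w (u + v) = ext_bracket w u + ext_bracket w v"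
  and ext_bracket_scale_right: "ext_bracket w (fscale c u) = fscale c (ext_bracket w u)"
  and ext_bracket_0_right [simp]: "ext_bracket w 0 = 0"
  and ext_bracket_sum_right: "ext_bracket w (sum g A) = (\<Sum>a\<in>A. ext_bracket w (g a))"
proof -
  interpret Vector_Spaces.linear fscale fscale "ext_bracket w" by (rule linear_ext_bracket_right)
  show "ext_bracket w (u + v) = ext_bracket w u + ext_bracket w v"
    "ext_bracket w (fscale c u) = fscale c (ext_bracket w u)" "ext_bracket w 0 = 0"
    "ext_bracket w (sum g A) = (\<Sum>a\<in>A. ext_bracket w (g a))"
    by (rule add scale zero sum)+
qed

lemma ext_bracket_in_ext_space: "ext_bracket u w \<in> ext_space"
proof -
  have "representation Basis v b = 0" if "b \<notin> Basis" for v b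
    using that representation_ne_zero by blast
  thus ?thesis by (simp add: ext_space_def ext_bracket_def)
qed

lemma ext_bracket_to_ext: "ext_bracket (to_ext u) (to_ext v) = to_ext (bracket u v)"
proof -
  have basis: "ext_bracket (to_ext x) (to_ext y) = to_ext (bracket x y)"
    if xy: "x \<in> Basis" "y \<in> Basis" for x y
  proof
    fix b
    have "ext_bracket (to_ext x) (to_ext y) b
        = (\<Sum>x'\<in>Basis. if x' = x then (\<Sum>y'\<in>Basis. if y' = y then to_ac (representation Basis (bracket x y) b) else 0) else 0)"
      unfolding ext_bracket_def using xy by (auto simp: to_ext_basis intro!: sum.cong)
    thus "ext_bracket (to_ext x) (to_ext y) b = to_ext (bracket x y) b"
      using xy finite_Basis by (simp add: to_ext_def)
  qed
  have expand: "to_ext w = (\<Sum>x\<in>Basis. fscale (to_ac (representation Basis w x)) (to_ext x))" for w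
    by (subst basis_expansion[of w, symmetric]) (simp add: to_ext_sum to_ext_scale)
  have "ext_bracket (to_ext u) (to_ext v) = (\<Sum>x\<in>Basis. \<Sum>y\<in>Basis.
      fscale (to_ac (representation Basis u x)) (fscale (to_ac (representation Basis v y)) (to_ext (bracket x y))))"
    unfolding expand[of u] expand[of v]
    by (simp only: ext_bracket_sum_left ext_bracket_scale_left)
      (simp only: ext_bracket_sum_right ext_bracket_scale_right fs.scale_sum_right basis cong: sum.cong)
  also have "\<dots> = to_ext (\<Sum>x\<in>Basis. \<Sum>y\<in>Basis.
      smul (representation Basis u x) (smul (representation Basis v y) (bracket x y)))"
    by (simp only: to_ext_sum to_ext_scale)
  also have "(\<Sum>x\<in>Basis. \<Sum>y\<in>Basis.
      smul (representation Basis u x) (smul (representation Basis v y) (bracket x y)))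
      = bracket (\<Sum>x\<in>Basis. smul (representation Basis u x) x)
        (\<Sum>y\<in>Basis. smul (representation Basis v y) y)"
    by (simp only: bracket_sum_left bracket_scale_left)
      (simp only: bracket_sum_right bracket_scale_right scale_sum_right)
  finally show ?thesis by (simp add: basis_expansion)
qed

text \<open>\<open>ext_space\<close> is spanned by the image of \<open>to_ext\<close>, where the
  identity is known; it is extended by linearity in one argument after the other.\<close>

lemma ext_bracket_derivation:
  assumes "u \<in> ext_space" "v \<in> ext_space" "w \<in> ext_space"
  shows "ext_bracket u (ext_bracket v w) = ext_bracket (ext_bracket u v) w + ext_bracket v (ext_bracket u w)"
proof -
  note lin = ext_bracket_add_left ext_bracket_add_right ext_bracket_scale_left ext_bracket_scale_right
    fs.scale_right_distrib
  have 1: "ext_bracket (to_ext a) (ext_bracket (to_ext b) w) = ext_bracket (ext_bracket (to_ext a) (to_ext b)) w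
      + ext_bracket (to_ext b) (ext_bracket (to_ext a) w)" for a b
    using assms(3) unfolding ext_space_eq_span
  proof (induction rule: fs.span_induct_alt)
    case (step c x y)
    then obtain d where x: "x = to_ext d" by blast
    show ?case
      by (simp only: lin step.IH x ext_bracket_to_ext bracket_derivation[of a b d] to_ext_add ac_simps)
  qed simp
  have 2: "ext_bracket (to_ext a) (ext_bracket v w) = ext_bracket (ext_bracket (to_ext a) v) w
      + ext_bracket v (ext_bracket (to_ext a) w)" for a
    using assms(2) unfolding ext_space_eq_span
  proof (induction rule: fs.span_induct_alt)
    case (step c x y)
    then obtain d where x: "x = to_ext d" by blast
    show ?case by (simp only: lin step.IH x 1[of a d] ac_simps)
  qed simp
  show ?thesis
    using assms(1) unfolding ext_space_eq_span
  proof (induction rule: fs.span_induct_alt)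
    case (step c x y)
    then obtain d where x: "x = to_ext d" by blast
    show ?case by (simp only: lin step.IH x 2[of d] ac_simps)
  qed simp
qed

lemma ext_bracket_coord_polys:
  assumes "\<And>b. (\<lambda>u. f u b) \<in> coord_polys" "\<And>b. (\<lambda>u. g u b) \<in> coord_polys"
  shows "(\<lambda>u. ext_bracket (f u) (g u) b) \<in> coord_polys"
  unfolding ext_bracket_def by (intro coord_polys_sum coord_polys.intros assms)

lemma fext_comp_coord_polys:
  assumes "\<And>b. (\<lambda>u. g u b) \<in> coord_polys"
  shows "(\<lambda>u. fext f (g u)) \<in> coord_polys"
  unfolding fext_def by (intro coord_polys_sum coord_polys.intros assms)

lemma polynomial_functions_extend:
  assumes "p \<in> polynomial_functions smul W"
  shows "\<exists>q\<in>coord_polys. \<forall>x\<in>W. q (to_ext x) = to_ac (p x)"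
  using assms
proof induction
  case (const c)
  show ?case by (rule bexI[of _ "\<lambda>_. to_ac c"]) (auto intro: coord_polys.intros)
next
  case (functional f)
  thus ?case by (intro bexI[of _ "fext f"]) (auto simp: fext_to_ext fext_coord_polys)
next
  case (add p q)
  then obtain p' q' where "p' \<in> coord_polys" "q' \<in> coord_polys"
    "\<forall>x\<in>W. p' (to_ext x) = to_ac (p x)" "\<forall>x\<in>W. q' (to_ext x) = to_ac (q x)" by blast
  thus ?case by (intro bexI[of _ "\<lambda>u. p' u + q' u"]) (auto intro: coord_polys.intros)
next
  case (mult p q)
  then obtain p' q' where "p' \<in> coord_polys" "q' \<in> coord_polys"
    "\<forall>x\<in>W. p' (to_ext x) = to_ac (p x)" "\<forall>x\<in>W. q' (to_ext x) = to_ac (q x)" by blast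
  thus ?case by (intro bexI[of _ "\<lambda>u. p' u * q' u"]) (auto intro: coord_polys.intros)
qed

text \<open>The rational points are Zariski dense because the base field is infinite.\<close>

lemma coord_polys_density:
  assumes p: "p \<in> coord_polys" and W: "subspace W" and 0: "\<And>x. x \<in> W \<Longrightarrow> p (to_ext x) = 0"
    and u: "u \<in> fs.span (to_ext ` W)"
  shows "p u = 0"
proof -
  \<comment> \<open>The induction needs all rational translates of \<open>u\<close>: on the line in
    direction \<open>to_ext w\<close> the polynomial vanishes at every rational parameter, hence
    also at \<open>c\<close>.\<close>
  have "\<forall>x\<in>W. p (to_ext x + u) = 0"
    using u
  proof (induction rule: fs.span_induct_alt)
    case base
    thus ?case using 0 by simp
  next
    case (step c y v)
    then obtain w where w: "y = to_ext w" "w \<in> W" by blast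
    show ?case
    proof
      fix x assume x: "x \<in> W"
      obtain q where q: "\<And>s. p ((to_ext x + v) + fscale s (to_ext w)) = poly q s"
        using coord_polys_line[OF p] by blast
      have "poly q (to_ac a) = 0" for a
      proof -
        have "x + smul a w \<in> W" using x w W by (intro subspace_add subspace_scale)
        with step.IH have "p (to_ext (x + smul a w) + v) = 0" by blast
        moreover have "to_ext (x + smul a w) + v = (to_ext x + v) + fscale (to_ac a) (to_ext w)"
          by (simp add: to_ext_add to_ext_scale algebra_simps)
        ultimately show ?thesis using q by metis
      qed
      hence "range (to_ac :: 'k \<Rightarrow> _) \<subseteq> {s. poly q s = 0}" by blast
      moreover have "infinite (range (to_ac :: 'k \<Rightarrow> _))"
        using range_inj_infinite[of "to_ac \<circ> (of_nat :: nat \<Rightarrow> 'k)"]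
        by (metis (no_types) comp_apply inj_def inj_of_nat infinite_UNIV_char_0 finite_imageD inj_to_ac)
      ultimately have "q = 0" using poly_roots_finite finite_subset by blast
      with q[of c] show "p (to_ext x + (fscale c y + v)) = 0" by (simp add: w algebra_simps)
    qed
  qed
  from bspec[OF this, of 0] W show ?thesis by (simp add: subspace_0)
qed

end

section \<open>Projections to graded pieces, before and after extension of scalars\<close>

context graded_semisimple_lie_algebra
begin

text \<open>Lagrange interpolation in \<open>bracket H0\<close>: the map is the product of the
  \<open>(bracket H0 - j) / (i - j)\<close> over \<open>j \<in> J\<close>. As a polynomial in
  \<open>bracket H0\<close> it preserves every ideal.\<close>

lemma single_gr_projection:
  assumes "finite J" "i \<notin> J"
  shows "\<exists>\<pi>. Vector_Spaces.linear smul smul \<pi> \<and> (\<forall>I. ideal I \<longrightarrow> \<pi> ` I \<subseteq> I) \<and>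
    (\<forall>k. \<forall>v\<in>gr k. \<pi> v = smul (\<Prod>j\<in>J. of_int (k - j) / of_int (i - j)) v)"
  using assms
proof (induction J rule: finite_induct)
  case empty
  show ?case by (rule exI[of _ "\<lambda>v. v"]) (auto simp: linear_id[unfolded id_def])
next
  case (insert j J)
  then obtain \<pi> where \<pi>: "Vector_Spaces.linear smul smul \<pi>" "\<And>I. ideal I \<Longrightarrow> \<pi> ` I \<subseteq> I"
    "\<And>k v. v \<in> gr k \<Longrightarrow> \<pi> v = smul (\<Prod>j\<in>J. of_int (k - j) / of_int (i - j)) v" by auto
  interpret \<pi>: Vector_Spaces.linear smul smul \<pi> by fact
  let ?\<rho> = "\<lambda>v. smul (1 / of_int (i - j)) (bracket H0 (\<pi> v) - smul (of_int j) (\<pi> v))"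
  show ?case
  proof (intro exI[of _ ?\<rho>] conjI allI ballI impI)
    show "Vector_Spaces.linear smul smul ?\<rho>"
      by unfold_locales
        (simp_all only: \<pi>.add \<pi>.scale bracket_add_right bracket_scale_right scale_right_distrib
          scale_right_diff_distrib scale_scale add_diff_add ac_simps)
    show "?\<rho> ` I \<subseteq> I" if "ideal I" for I
      using that \<pi>(2)[OF that]
      by (auto intro!: subspace_scale subspace_diff ideal_subspace ideal_bracket_right)
    fix k v assume v: "v \<in> gr k"
    let ?c = "\<Prod>j\<in>J. of_int (k - j) / of_int (i - j) :: 'k"
    have "?\<rho> v = smul (1 / of_int (i - j)) (smul ?c (smul (of_int k) v) - smul (of_int j) (smul ?c v))"
      using v by (simp add: \<pi>(3)[OF v] bracket_scale_right gr_eigenspace del: scale_scale)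
    also have "\<dots> = smul (1 / of_int (i - j) * (?c * of_int k - of_int j * ?c)) v"
      by (simp only: scale_scale scale_left_diff_distrib[symmetric])
    also have "1 / of_int (i - j) * (?c * of_int k - of_int j * ?c)
        = (\<Prod>j\<in>insert j J. of_int (k - j) / of_int (i - j))"
      using insert.hyps by (simp add: field_simps diff_divide_distrib)
    finally show "?\<rho> v = smul (\<Prod>j\<in>insert j J. of_int (k - j) / of_int (i - j)) v" .
  qed
qed

lemma exists_gr_projection:
  "\<exists>\<pi>. Vector_Spaces.linear smul smul \<pi> \<and> (\<forall>I. ideal I \<longrightarrow> \<pi> ` I \<subseteq> I) \<and>
    (\<forall>k\<in>S. \<forall>v\<in>gr k. \<pi> v = v) \<and> (\<forall>k\<in>-S. \<forall>v\<in>gr k. \<pi> v = 0)"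
proof -
  obtain N where N: "\<And>i. \<bar>i\<bar> > N \<Longrightarrow> gr i = {0}" using gr_bounded by blast
  let ?J = "{- N..N}"
  have "\<exists>\<pi>. Vector_Spaces.linear smul smul \<pi> \<and> (\<forall>I. ideal I \<longrightarrow> \<pi> ` I \<subseteq> I) \<and>
    (\<forall>k\<in>?J. \<forall>v\<in>gr k. \<pi> v = (if k = i then v else 0))" for i
  proof -
    obtain \<pi> where \<pi>: "Vector_Spaces.linear smul smul \<pi>" "\<And>I. ideal I \<Longrightarrow> \<pi> ` I \<subseteq> I"
      "\<And>k v. v \<in> gr k \<Longrightarrow> \<pi> v = smul (\<Prod>j\<in>?J - {i}. of_int (k - j) / of_int (i - j)) v"
      using single_gr_projection[of "?J - {i}" i] by auto
    have "\<pi> v = (if k = i then v else 0)" if v: "v \<in> gr k" "k \<in> ?J" for k v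
    proof (cases "k = i")
      case True
      have "(\<Prod>j\<in>?J - {i}. of_int (i - j) / of_int (i - j) :: 'k) = 1" by (rule prod.neutral) auto
      with True \<pi>(3)[OF v(1)] show ?thesis by simp
    next
      case False
      hence "k \<in> ?J - {i}" using v by simp
      hence "(\<Prod>j\<in>?J - {i}. of_int (k - j) / of_int (i - j) :: 'k) = 0" by (intro prod_zero) auto
      with False \<pi>(3)[OF v(1)] show ?thesis by simp
    qed
    with \<pi> show ?thesis by blast
  qed
  then obtain \<pi> where \<pi>: "\<And>i. Vector_Spaces.linear smul smul (\<pi> i)" "\<And>i I. ideal I \<Longrightarrow> \<pi> i ` I \<subseteq> I"
    "\<And>i k v. k \<in> ?J \<Longrightarrow> v \<in> gr k \<Longrightarrow> \<pi> i v = (if k = i then v else 0)" by metis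
  interpret pi: Vector_Spaces.linear smul smul "\<pi> i" for i by (rule \<pi>(1))
  \<comment> \<open>\<open>S\<close> may be infinite, typically a half-line; only the degrees in
    \<open>?J\<close> carry anything.\<close>
  let ?\<rho> = "\<lambda>v. \<Sum>i\<in>S \<inter> ?J. \<pi> i v"
  have val: "?\<rho> v = (if k \<in> S then v else 0)" if v: "v \<in> gr k" for k v
  proof (cases "k \<in> ?J")
    case True
    have "?\<rho> v = (\<Sum>i\<in>S \<inter> ?J. if k = i then v else 0)" using \<pi>(3)[OF True v] by simp
    also have "\<dots> = (if k \<in> S then v else 0)" using True by simp
    finally show ?thesis .
  next
    case False
    hence "v = 0" using N[of k] v by auto
    moreover have "\<pi> i 0 = 0" for i by (rule pi.zero)
    ultimately show ?thesis by simp
  qed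
  have "Vector_Spaces.linear smul smul ?\<rho>"
  proof -
    show ?thesis by unfold_locales (simp_all add: pi.add pi.scale sum.distrib scale_sum_right)
  qed
  moreover have "?\<rho> ` I \<subseteq> I" if "ideal I" for I
    using \<pi>(2)[OF that] by (auto intro!: subspace_sum ideal_subspace that)
  ultimately show ?thesis using val by (intro exI[of _ ?\<rho>]) auto
qed

definition gr_projection :: "int set \<Rightarrow> 'v \<Rightarrow> 'v" where
  "gr_projection S = (SOME \<pi>. Vector_Spaces.linear smul smul \<pi> \<and> (\<forall>I. ideal I \<longrightarrow> \<pi> ` I \<subseteq> I) \<and>
    (\<forall>k\<in>S. \<forall>v\<in>gr k. \<pi> v = v) \<and> (\<forall>k\<in>-S. \<forall>v\<in>gr k. \<pi> v = 0))"

lemma linear_gr_projection: "Vector_Spaces.linear smul smul (gr_projection S)"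
  and gr_projection_ideal: "ideal I \<Longrightarrow> v \<in> I \<Longrightarrow> gr_projection S v \<in> I"
  and gr_projection_in: "k \<in> S \<Longrightarrow> v \<in> gr k \<Longrightarrow> gr_projection S v = v"
  and gr_projection_out: "k \<notin> S \<Longrightarrow> v \<in> gr k \<Longrightarrow> gr_projection S v = 0"
  using someI_ex[OF exists_gr_projection[of S], folded gr_projection_def] by blast+

text \<open>The scalar extension of the sum of the \<open>I \<inter> gr i\<close> over
  \<open>i \<in> S\<close>. Half-lines \<open>S\<close> give two opposite filtrations by degree,
  with respect to which the block LU decomposition is taken.\<close>

definition egr :: "'v set \<Rightarrow> int set \<Rightarrow> ('v \<Rightarrow> 'k alg_closure) set" where
  "egr I S = fs.span (to_ext ` (\<Union>i\<in>S. I \<inter> gr i))"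

definition eproj :: "int set \<Rightarrow> ('v \<Rightarrow> 'k alg_closure) \<Rightarrow> 'v \<Rightarrow> 'k alg_closure" where
  "eproj S = mext (gr_projection S)"

lemma linear_eproj: "Vector_Spaces.linear fscale fscale (eproj S)"
  unfolding eproj_def by (rule linear_mext)

lemma eproj_add: "eproj S (u + v) = eproj S u + eproj S v"
  and eproj_scale: "eproj S (fscale c u) = fscale c (eproj S u)"
  and eproj_0 [simp]: "eproj S 0 = 0"
  and eproj_diff: "eproj S (u - v) = eproj S u - eproj S v"
proof -
  interpret Vector_Spaces.linear fscale fscale "eproj S" by (rule linear_eproj)
  show "eproj S (u + v) = eproj S u + eproj S v" "eproj S (fscale c u) = fscale c (eproj S u)"
    "eproj S 0 = 0" "eproj S (u - v) = eproj S u - eproj S v"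
    by (rule add scale zero diff)+
qed

lemma eproj_to_ext: "eproj S (to_ext v) = to_ext (gr_projection S v)"
  unfolding eproj_def by (rule mext_to_ext[OF linear_gr_projection])

lemma subspace_egr: "fs.subspace (egr I S)"
  by (simp add: egr_def)

lemmas egr_add = fs.subspace_add[OF subspace_egr]
  and egr_scale = fs.subspace_scale[OF subspace_egr]
  and egr_diff = fs.subspace_diff[OF subspace_egr]
  and egr_neg = fs.subspace_neg[OF subspace_egr]

lemma egr_mono: "I \<subseteq> J \<Longrightarrow> S \<subseteq> T \<Longrightarrow> egr I S \<subseteq> egr J T"
  unfolding egr_def by (intro fs.span_mono image_mono) blast

lemma to_ext_egr: "v \<in> I \<Longrightarrow> v \<in> gr i \<Longrightarrow> i \<in> S \<Longrightarrow> to_ext v \<in> egr I S"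
  unfolding egr_def by (intro fs.span_base) blast

lemma eproj_egr:
  assumes "u \<in> egr I T"
  shows "eproj S u \<in> egr I (S \<inter> T)"
  using assms unfolding egr_def
proof (induction rule: fs.span_induct_alt)
  case base
  show ?case by (simp add: fs.span_zero)
next
  case (step c x y)
  then obtain i v where v: "x = to_ext v" "i \<in> T" "v \<in> I" "v \<in> gr i" by blast
  have "eproj S x \<in> fs.span (to_ext ` (\<Union>i\<in>S \<inter> T. I \<inter> gr i))"
  proof (cases "i \<in> S")
    case True
    have "eproj S x = x" unfolding v(1) eproj_to_ext gr_projection_in[OF True v(4)] ..
    with v True show ?thesis by (auto intro!: fs.span_base)
  next
    case False
    have "eproj S x = 0" unfolding v(1) eproj_to_ext gr_projection_out[OF False v(4)] by simp
    thus ?thesis by (simp add: fs.span_zero)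
  qed
  with step.IH show ?case by (simp add: eproj_add eproj_scale fs.span_add fs.span_scale)
qed

lemma eproj_id:
  assumes "u \<in> egr I T" "T \<subseteq> S"
  shows "eproj S u = u"
  using assms(1) unfolding egr_def
proof (induction rule: fs.span_induct_alt)
  case (step c x y)
  then obtain i v where v: "x = to_ext v" "i \<in> T" "v \<in> gr i" by blast
  hence "i \<in> S" using assms(2) by blast
  hence "eproj S x = x" unfolding v(1) eproj_to_ext using gr_projection_in v(3) by metis
  with step.IH show ?case by (simp add: eproj_add eproj_scale)
qed simp

lemma egr_empty: "egr I {} = {0}"
  by (simp add: egr_def)

lemma eproj_zero:
  assumes "u \<in> egr I T" "S \<inter> T = {}"
  shows "eproj S u = 0"
  using eproj_egr[OF assms(1), of S] assms(2) by (simp add: egr_empty)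

text \<open>Every ideal is graded, because the projections to the \<open>gr i\<close> preserve
  it.\<close>

lemma egr_UNIV:
  assumes I: "ideal I"
  shows "egr I UNIV = fs.span (to_ext ` I)"
proof
  show "egr I UNIV \<subseteq> fs.span (to_ext ` I)"
    unfolding egr_def by (intro fs.span_mono image_mono) blast
  have "to_ext v \<in> egr I UNIV" if v: "v \<in> I" for v
  proof -
    have "v \<in> span (\<Union>i. gr i)" by (simp add: gr_span)
    then obtain S a where S: "finite S" "\<And>i. i \<in> S \<Longrightarrow> a i \<in> gr i" "v = (\<Sum>i\<in>S. a i)"
      by (rule span_Union_subspaces[OF gr_subspace]) blast
    have "a i \<in> I" if i: "i \<in> S" for i
    proof -
      have "gr_projection {i} v = (\<Sum>j\<in>S. gr_projection {i} (a j))"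
        unfolding S(3) using linear_gr_projection[of "{i}"] by (rule module_hom.sum[OF Vector_Spaces.linear.axioms(3)])
      also have "\<dots> = (\<Sum>j\<in>S. if i = j then a i else 0)"
      proof (rule sum.cong[OF refl])
        fix j assume "j \<in> S"
        with S(2) show "gr_projection {i} (a j) = (if i = j then a i else 0)"
          using gr_projection_in[of i "{i}" "a j"] gr_projection_out[of j "{i}" "a j"] by (cases "i = j") auto
      qed
      also have "\<dots> = a i" using S(1) i by simp
      finally show ?thesis using gr_projection_ideal[OF I v, of "{i}"] by simp
    qed
    hence "to_ext (a i) \<in> egr I UNIV" if "i \<in> S" for i
      using that S(2) by (intro to_ext_egr) auto
    thus ?thesis unfolding S(3) to_ext_sum by (intro fs.subspace_sum subspace_egr)
  qed
  thus "fs.span (to_ext ` I) \<subseteq> egr I UNIV" by (intro fs.span_minimal subspace_egr) blast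
qed

lemma egr_UNIV_UNIV: "egr UNIV UNIV = ext_space"
  using egr_UNIV[OF ideal_UNIV] by (simp add: ext_space_eq_span)

lemma egr_ext_space: "u \<in> egr I S \<Longrightarrow> u \<in> ext_space"
  using egr_mono[of I UNIV S UNIV] egr_UNIV_UNIV by blast

lemma eproj_decomp:
  assumes "u \<in> egr I UNIV"
  shows "u = eproj S u + eproj (- S) u"
  using assms unfolding egr_def
proof (induction rule: fs.span_induct_alt)
  case (step c x y)
  then obtain i v where v: "x = to_ext v" "v \<in> gr i" by blast
  have "gr_projection S v + gr_projection (- S) v = v"
    by (cases "i \<in> S") (use v(2) gr_projection_in[of i] gr_projection_out[of i] in auto)
  hence x: "x = eproj S x + eproj (- S) x"
    unfolding v(1) eproj_to_ext to_ext_add[symmetric] by simp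
  have "fscale c x + y = fscale c (eproj S x + eproj (- S) x) + (eproj S y + eproj (- S) y)"
    by (rule arg_cong2[of x _ y _ "\<lambda>x y. fscale c x + y", OF x step.IH])
  also have "\<dots> = eproj S (fscale c x + y) + eproj (- S) (fscale c x + y)"
    by (simp only: eproj_add eproj_scale fs.scale_right_distrib ac_simps)
  finally show ?case .
qed simp

lemma egr_bracket:
  assumes I: "ideal I" and STU: "\<And>i j. i \<in> S \<Longrightarrow> j \<in> T \<Longrightarrow> i + j \<in> U"
    and u: "u \<in> egr UNIV S" and v: "v \<in> egr I T"
  shows "ext_bracket u v \<in> egr I U"
proof -
  have 1: "ext_bracket (to_ext a) v \<in> egr I U" if a: "i \<in> S" "a \<in> gr i" for a i
    using v unfolding egr_def[of I T]
  proof (induction rule: fs.span_induct_alt)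
    case base
    show ?case by (simp add: fs.subspace_0 subspace_egr)
  next
    case (step c x y)
    then obtain j b where b: "x = to_ext b" "j \<in> T" "b \<in> I" "b \<in> gr j" by blast
    have "to_ext (bracket a b) \<in> egr I U"
      using to_ext_egr[OF ideal_bracket_right[OF I b(3)] gr_bracket[OF a(2) b(4)] STU[OF a(1) b(2)]] .
    thus ?case unfolding b(1) ext_bracket_add_right ext_bracket_scale_right ext_bracket_to_ext
      using step.IH by (intro fs.subspace_add fs.subspace_scale subspace_egr)
  qed
  show ?thesis
    using u unfolding egr_def[of UNIV S]
  proof (induction rule: fs.span_induct_alt)
    case base
    show ?case by (simp add: fs.subspace_0 subspace_egr)
  next
    case (step c x y)
    then obtain i a where a: "x = to_ext a" "i \<in> S" "a \<in> gr i" by blast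
    show ?case unfolding a(1) ext_bracket_add_left ext_bracket_scale_left
      using step.IH 1[OF a(2,3)] by (intro fs.subspace_add fs.subspace_scale subspace_egr)
  qed
qed

lemma egr_finite_span: "\<exists>F. finite F \<and> egr I S = fs.span F"
proof -
  let ?A = "\<Union>i\<in>S. I \<inter> gr i"
  obtain B where B: "B \<subseteq> ?A" "independent B" "?A \<subseteq> span B"
    using maximal_independent_subset by blast
  have "to_ext v \<in> fs.span (to_ext ` B)" if "v \<in> span B" for v
    using that
  proof (induction rule: span_induct_alt)
    case (step c x y)
    thus ?case unfolding to_ext_add to_ext_scale
      by (intro fs.span_add fs.span_scale) (auto intro: fs.span_base)
  qed (simp add: fs.span_zero)
  hence "egr I S \<subseteq> fs.span (to_ext ` B)"
    unfolding egr_def using B(3) by (intro fs.span_minimal) auto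
  moreover have "fs.span (to_ext ` B) \<subseteq> egr I S"
    unfolding egr_def using B(1) by (intro fs.span_mono image_mono)
  moreover have "finite B" using B(2) by (rule finiteI_independent)
  ultimately show ?thesis by blast
qed

end


section \<open>Polynomial paths in the group of elementary automorphisms\<close>

text \<open>Non-zero terms have \<open>i < m\<close> and \<open>j < m\<close>, hence
  \<open>i + j < 2 * m\<close>: the square and the triangle contain the same ones.\<close>

lemma sum_square_eq_sum_triangle:
  fixes F :: "nat \<Rightarrow> nat \<Rightarrow> 'a::comm_monoid_add"
  assumes "\<And>i j. i \<ge> m \<or> j \<ge> m \<Longrightarrow> F i j = 0"
  shows "(\<Sum>i<2 * m. \<Sum>j<2 * m. F i j) = (\<Sum>k<2 * m. \<Sum>i\<le>k. F i (k - i))"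
proof -
  have "(\<Sum>i<2 * m. \<Sum>j<2 * m. F i j) = (\<Sum>(i, j)\<in>{..<2 * m} \<times> {..<2 * m}. F i j)"
    by (rule sum.cartesian_product)
  also have "\<dots> = (\<Sum>(i, j)\<in>{(i, j). i + j < 2 * m}. F i j)"
  proof (rule sum.mono_neutral_right)
    show "\<forall>p\<in>{..<2 * m} \<times> {..<2 * m} - {(i, j). i + j < 2 * m}. (case p of (i, j) \<Rightarrow> F i j) = 0"
      by (auto intro!: assms)
  qed auto
  also have "\<dots> = (\<Sum>k<2 * m. \<Sum>i\<le>k. F i (k - i))"
    by (rule sum.triangle_reindex)
  finally show ?thesis .
qed

lemma divided_power_add:
  fixes s t :: "'a::field_char_0"
  shows "(s + t) ^ n / fact n = (\<Sum>i\<le>n. s ^ i / fact i * (t ^ (n - i) / fact (n - i)))"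
proof -
  have "(s + t) ^ n / fact n = (\<Sum>i\<le>n. of_nat (n choose i) * s ^ i * t ^ (n - i)) / fact n"
    by (simp add: binomial_ring)
  also have "\<dots> = (\<Sum>i\<le>n. s ^ i / fact i * (t ^ (n - i) / fact (n - i)))"
    unfolding sum_divide_distrib by (rule sum.cong) (auto simp: binomial_fact)
  finally show ?thesis .
qed

context graded_semisimple_lie_algebra
begin

definition polynomial_family :: "('k alg_closure \<Rightarrow> 'v \<Rightarrow> 'k alg_closure) \<Rightarrow> bool" where
  "polynomial_family v \<longleftrightarrow> (\<forall>t. v t \<in> ext_space) \<and> (\<forall>b. \<exists>q. \<forall>t. v t b = poly q t)"

lemma polynomial_family_add:
  assumes "polynomial_family v" "polynomial_family w"
  shows "polynomial_family (\<lambda>t. v t + w t)"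
proof -
  have "\<exists>q. \<forall>t. (v t + w t) b = poly q t" for b
  proof -
    obtain p q where "\<forall>t. v t b = poly p t" "\<forall>t. w t b = poly q t"
      using assms unfolding polynomial_family_def by meson
    thus ?thesis by (intro exI[of _ "p + q"]) (simp add: fun_apply)
  qed
  with assms subspace_ext_space show ?thesis by (auto simp: polynomial_family_def fs.subspace_add)
qed

lemma polynomial_family_scale:
  assumes "polynomial_family v"
  shows "polynomial_family (\<lambda>t. fscale (poly p t) (v t))"
proof -
  have "\<exists>q. \<forall>t. fscale (poly p t) (v t) b = poly q t" for b
  proof -
    obtain q where "\<forall>t. v t b = poly q t" using assms unfolding polynomial_family_def by meson
    thus ?thesis by (intro exI[of _ "p * q"]) (simp add: fun_apply)
  qed
  with assms subspace_ext_space show ?thesis by (auto simp: polynomial_family_def fs.subspace_scale)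
qed

lemma polynomial_family_const: "v \<in> ext_space \<Longrightarrow> polynomial_family (\<lambda>t. v)"
  unfolding polynomial_family_def by (auto intro: exI[of _ "[:_:]"])

lemma polynomial_family_sum:
  "(\<And>a. a \<in> A \<Longrightarrow> polynomial_family (v a)) \<Longrightarrow> polynomial_family (\<lambda>t. \<Sum>a\<in>A. v a t)"
  by (induction A rule: infinite_finite_induct)
    (auto intro: polynomial_family_add polynomial_family_const fs.subspace_0[OF subspace_ext_space])

definition polynomial_path :: "('k alg_closure \<Rightarrow> ('v \<Rightarrow> 'k alg_closure) \<Rightarrow> 'v \<Rightarrow> 'k alg_closure) \<Rightarrow> bool" where
  "polynomial_path T \<longleftrightarrow> (\<forall>t. Vector_Spaces.linear fscale fscale (T t)) \<and>
     (\<forall>u\<in>ext_space. polynomial_family (\<lambda>t. T t u))"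

lemma linear_fs_expand:
  assumes f: "Vector_Spaces.linear fscale fscale f" and u: "u \<in> ext_space"
  shows "f u = (\<Sum>b\<in>Basis. fscale (u b) (f (to_ext b)))"
proof -
  interpret f: Vector_Spaces.linear fscale fscale f by fact
  have "f u = f (\<Sum>b\<in>Basis. fscale (u b) (to_ext b))"
    using ext_space_expansion[OF u] by simp
  thus ?thesis by (simp add: f.sum f.scale)
qed

lemma polynomial_path_family:
  assumes T: "polynomial_path T" and v: "polynomial_family v"
  shows "polynomial_family (\<lambda>t. T t (v t))"
proof -
  have "T t (v t) = (\<Sum>b\<in>Basis. fscale (v t b) (T t (to_ext b)))" for t
    using T v by (intro linear_fs_expand) (auto simp: polynomial_path_def polynomial_family_def)
  moreover have "polynomial_family (\<lambda>t. \<Sum>b\<in>Basis. fscale (v t b) (T t (to_ext b)))"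
  proof (rule polynomial_family_sum)
    fix b
    obtain q where "\<And>t. v t b = poly q t" using v unfolding polynomial_family_def by meson
    thus "polynomial_family (\<lambda>t. fscale (v t b) (T t (to_ext b)))"
      using T to_ext_in_ext_space by (simp add: polynomial_family_scale polynomial_path_def)
  qed
  ultimately show ?thesis by simp
qed

text \<open>The grading is deliberately absent: exponentials of non-homogeneous elements destroy it.
  The ideal \<open>I\<close> is preserved, which keeps the determinant attached to \<open>I\<close>
  meaningful along the path.\<close>

definition automorphism_path ::
    "'v set \<Rightarrow> ('k alg_closure \<Rightarrow> ('v \<Rightarrow> 'k alg_closure) \<Rightarrow> 'v \<Rightarrow> 'k alg_closure) \<Rightarrow> bool" where
  "automorphism_path I \<gamma> \<longleftrightarrow> polynomial_path \<gamma> \<and>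
     (\<forall>t. \<forall>u\<in>ext_space. \<forall>v\<in>ext_space. \<gamma> t (ext_bracket u v) = ext_bracket (\<gamma> t u) (\<gamma> t v)) \<and>
     (\<forall>t. \<forall>u\<in>egr I UNIV. \<gamma> t u \<in> egr I UNIV) \<and>
     (\<forall>u\<in>ext_space. \<gamma> 0 u = u)"

lemma automorphism_pathD:
  assumes "automorphism_path I \<gamma>"
  shows "polynomial_path \<gamma>"
    and "u \<in> ext_space \<Longrightarrow> v \<in> ext_space \<Longrightarrow> \<gamma> t (ext_bracket u v) = ext_bracket (\<gamma> t u) (\<gamma> t v)"
    and "u \<in> egr I UNIV \<Longrightarrow> \<gamma> t u \<in> egr I UNIV"
    and "u \<in> ext_space \<Longrightarrow> \<gamma> 0 u = u"
  using assms unfolding automorphism_path_def by blast+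

lemma polynomial_pathD:
  assumes "polynomial_path T"
  shows "Vector_Spaces.linear fscale fscale (T t)"
    and "u \<in> ext_space \<Longrightarrow> polynomial_family (\<lambda>t. T t u)"
    and "u \<in> ext_space \<Longrightarrow> T t u \<in> ext_space"
  using assms unfolding polynomial_path_def polynomial_family_def by blast+

lemma automorphism_path_compose:
  assumes g: "automorphism_path I \<gamma>" and d: "automorphism_path I \<delta>"
  shows "automorphism_path I (\<lambda>t u. \<gamma> t (\<delta> t u))"
proof -
  note G = automorphism_pathD[OF g] and D = automorphism_pathD[OF d]
  have "Vector_Spaces.linear fscale fscale (\<gamma> t \<circ> \<delta> t)" for t
    by (rule Vector_Spaces.linear_compose[OF polynomial_pathD(1)[OF D(1)] polynomial_pathD(1)[OF G(1)]])
  hence lin: "Vector_Spaces.linear fscale fscale (\<lambda>u. \<gamma> t (\<delta> t u))" for t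
    by (simp only: o_def)
  have "polynomial_family (\<lambda>t. \<gamma> t (\<delta> t u))" if "u \<in> ext_space" for u
    by (rule polynomial_path_family[OF G(1) polynomial_pathD(2)[OF D(1) that]])
  with lin have "polynomial_path (\<lambda>t u. \<gamma> t (\<delta> t u))" unfolding polynomial_path_def by blast
  moreover have "\<gamma> t (\<delta> t (ext_bracket u v)) = ext_bracket (\<gamma> t (\<delta> t u)) (\<gamma> t (\<delta> t v))"
    if uv: "u \<in> ext_space" "v \<in> ext_space" for t u v
    unfolding D(2)[OF uv]
    by (rule G(2)[OF polynomial_pathD(3)[OF D(1) uv(1)] polynomial_pathD(3)[OF D(1) uv(2)]])
  moreover have "\<gamma> t (\<delta> t u) \<in> egr I UNIV" if "u \<in> egr I UNIV" for t u
    by (rule G(3)[OF D(3)[OF that]])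
  moreover have "\<gamma> 0 (\<delta> 0 u) = u" if "u \<in> ext_space" for u
    unfolding D(4)[OF that] by (rule G(4)[OF that])
  ultimately show ?thesis unfolding automorphism_path_def by blast
qed

text \<open>exp(t ad x) for \<open>x\<close> with vanishing \<open>m\<close>-th power of ad x.
  Summing up to \<open>2 * m\<close> instead of \<open>m\<close> adds only zeros, but makes
  \<open>sum_square_eq_sum_triangle\<close> applicable to products of two such sums.\<close>

definition exp_path :: "('v \<Rightarrow> 'k alg_closure) \<Rightarrow> nat \<Rightarrow> 'k alg_closure \<Rightarrow>
    ('v \<Rightarrow> 'k alg_closure) \<Rightarrow> 'v \<Rightarrow> 'k alg_closure" where
  "exp_path x m t u = (\<Sum>n<2 * m. fscale (t ^ n / fact n) ((ext_bracket x ^^ n) u))"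

lemma ad_pow_linear:
  "(ext_bracket x ^^ n) (u + v) = (ext_bracket x ^^ n) u + (ext_bracket x ^^ n) v"
  "(ext_bracket x ^^ n) (fscale c u) = fscale c ((ext_bracket x ^^ n) u)"
  by (induction n) (simp_all add: ext_bracket_add_right ext_bracket_scale_right)

lemma ad_pow_0: "(ext_bracket x ^^ n) 0 = 0"
  by (induction n) simp_all

lemma ad_pow_egr:
  assumes I: "ideal I" and x: "x \<in> ext_space" and u: "u \<in> egr I UNIV"
  shows "(ext_bracket x ^^ n) u \<in> egr I UNIV"
proof (induction n)
  case (Suc n)
  have "x \<in> egr UNIV UNIV" using x egr_UNIV_UNIV by simp
  from egr_bracket[OF I _ this Suc] show ?case by simp
qed (simp add: u)

text \<open>The Leibniz rule for the divided powers of t ad x. The induction uses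
  \<open>(n + 1) D (n + 1) = t (ad x) D n\<close>; the two sums produced by the derivation rule
  carry the coefficients \<open>i\<close> and \<open>n + 1 - i\<close>, which add up to the common
  factor \<open>n + 1\<close>.\<close>

lemma divided_power_derivation:
  fixes t :: "'k alg_closure"
  assumes x: "x \<in> ext_space" and u: "u \<in> ext_space" and v: "v \<in> ext_space"
  defines "D \<equiv> \<lambda>n w. fscale (t ^ n / fact n) ((ext_bracket x ^^ n) w)"
  shows "D n (ext_bracket u v) = (\<Sum>i\<le>n. ext_bracket (D i u) (D (n - i) v))"
proof (induction n)
  case 0
  show ?case by (simp add: D_def)
next
  case (Suc n)
  have D_Suc: "fscale (of_nat (Suc k)) (D (Suc k) w) = fscale t (ext_bracket x (D k w))" for k w
    by (simp add: D_def ext_bracket_scale_right field_simps del: of_nat_Suc)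
  have E: "D k w \<in> ext_space" if "w \<in> ext_space" for k w
    unfolding D_def using ad_pow_egr[OF ideal_UNIV x, of w k] that
    by (intro fs.subspace_scale[OF subspace_ext_space]) (simp add: egr_UNIV_UNIV)
  have der: "ext_bracket x (ext_bracket (D i u) (D j v))
      = ext_bracket (ext_bracket x (D i u)) (D j v) + ext_bracket (D i u) (ext_bracket x (D j v))" for i j
    by (rule ext_bracket_derivation[OF x E[OF u] E[OF v]])
  let ?B = "\<lambda>i. ext_bracket (D i u) (D (Suc n - i) v)"
  have "fscale (of_nat (Suc n)) (D (Suc n) (ext_bracket u v))
      = fscale t (ext_bracket x (\<Sum>i\<le>n. ext_bracket (D i u) (D (n - i) v)))"
    unfolding D_Suc Suc ..
  also have "\<dots> = (\<Sum>i\<le>n. ext_bracket (fscale t (ext_bracket x (D i u))) (D (n - i) v))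
      + (\<Sum>i\<le>n. ext_bracket (D i u) (fscale t (ext_bracket x (D (n - i) v))))"
    by (simp only: ext_bracket_sum_right der fs.scale_sum_right fs.scale_right_distrib sum.distrib
        ext_bracket_scale_left ext_bracket_scale_right)
  also have "(\<Sum>i\<le>n. ext_bracket (fscale t (ext_bracket x (D i u))) (D (n - i) v))
      = (\<Sum>i\<le>n. fscale (of_nat (Suc i)) (?B (Suc i)))"
    by (intro sum.cong refl) (simp only: D_Suc[symmetric] ext_bracket_scale_left diff_Suc_Suc)
  also have "\<dots> = (\<Sum>i\<le>Suc n. fscale (of_nat i) (?B i))"
    by (simp only: sum.atMost_Suc_shift) simp
  also have "(\<Sum>i\<le>n. ext_bracket (D i u) (fscale t (ext_bracket x (D (n - i) v))))
      = (\<Sum>i\<le>n. fscale (of_nat (Suc n - i)) (?B i))"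
  proof (intro sum.cong refl)
    fix i assume "i \<in> {..n}"
    hence "Suc n - i = Suc (n - i)" by (simp add: Suc_diff_le)
    thus "ext_bracket (D i u) (fscale t (ext_bracket x (D (n - i) v))) = fscale (of_nat (Suc n - i)) (?B i)"
      by (simp only: D_Suc[symmetric] ext_bracket_scale_right)
  qed
  also have "\<dots> = (\<Sum>i\<le>Suc n. fscale (of_nat (Suc n - i)) (?B i))" by simp
  also have "(\<Sum>i\<le>Suc n. fscale (of_nat i) (?B i)) + (\<Sum>i\<le>Suc n. fscale (of_nat (Suc n - i)) (?B i))
      = (\<Sum>i\<le>Suc n. fscale (of_nat (Suc n)) (?B i))"
    unfolding sum.distrib[symmetric] fs.scale_left_distrib[symmetric] of_nat_add[symmetric]
    by (intro sum.cong refl) (simp del: of_nat_Suc)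
  also have "\<dots> = fscale (of_nat (Suc n)) (\<Sum>i\<le>Suc n. ?B i)" by (simp only: fs.scale_sum_right)
  finally show ?case by (simp del: of_nat_Suc sum.atMost_Suc)
qed

context
  fixes x m
  assumes x: "x \<in> ext_space" and m: "m > 0" and nil: "\<And>u. u \<in> ext_space \<Longrightarrow> (ext_bracket x ^^ m) u = 0"
begin

lemma ad_pow_eq_0:
  assumes "u \<in> ext_space" "n \<ge> m"
  shows "(ext_bracket x ^^ n) u = 0"
proof -
  have "(ext_bracket x ^^ n) u = (ext_bracket x ^^ (n - m)) ((ext_bracket x ^^ m) u)"
    using assms(2) by (simp add: funpow_add[symmetric] flip: comp_apply[of "ext_bracket x ^^ (n - m)" "ext_bracket x ^^ m"])
  thus ?thesis using nil[OF assms(1)] by (simp add: ad_pow_0)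
qed

lemma linear_exp_path: "Vector_Spaces.linear fscale fscale (exp_path x m t)"
  by unfold_locales
    (simp_all add: exp_path_def ad_pow_linear fs.scale_right_distrib sum.distrib fs.scale_sum_right mult.commute)

lemma exp_path_egr: "ideal I \<Longrightarrow> u \<in> egr I UNIV \<Longrightarrow> exp_path x m t u \<in> egr I UNIV"
  unfolding exp_path_def by (intro fs.subspace_sum fs.subspace_scale subspace_egr ad_pow_egr x)

lemma exp_path_ext_space: "u \<in> ext_space \<Longrightarrow> exp_path x m t u \<in> ext_space"
  using exp_path_egr[OF ideal_UNIV] by (simp add: egr_UNIV_UNIV)

lemma exp_path_0: "exp_path x m 0 u = u"
proof -
  have "exp_path x m 0 u = (\<Sum>n<2 * m. if n = 0 then u else 0)"
    unfolding exp_path_def by (rule sum.cong) auto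
  thus ?thesis using m by simp
qed

lemma exp_path_add:
  assumes u: "u \<in> ext_space"
  shows "exp_path x m s (exp_path x m t u) = exp_path x m (s + t) u"
proof -
  let ?N = "\<lambda>n. ext_bracket x ^^ n"
  define F where "F = (\<lambda>i j. fscale (s ^ i / fact i * (t ^ j / fact j)) (?N (i + j) u))"
  interpret l: Vector_Spaces.linear fscale fscale "exp_path x m s" by (rule linear_exp_path)
  have "exp_path x m s (exp_path x m t u) = (\<Sum>j<2 * m. fscale (t ^ j / fact j) (exp_path x m s (?N j u)))"
    by (subst (2) exp_path_def) (simp add: l.sum l.scale)
  also have "\<dots> = (\<Sum>j<2 * m. \<Sum>i<2 * m. F i j)"
    unfolding exp_path_def F_def by (simp add: fs.scale_sum_right funpow_add mult.commute)
  also have "\<dots> = (\<Sum>i<2 * m. \<Sum>j<2 * m. F i j)" by (rule sum.swap)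
  also have "\<dots> = (\<Sum>k<2 * m. \<Sum>i\<le>k. F i (k - i))"
    by (rule sum_square_eq_sum_triangle) (auto simp: F_def ad_pow_eq_0[OF u])
  also have "\<dots> = exp_path x m (s + t) u"
    unfolding exp_path_def
  proof (rule sum.cong[OF refl])
    fix k
    show "(\<Sum>i\<le>k. F i (k - i)) = fscale ((s + t) ^ k / fact k) (?N k u)"
      unfolding divided_power_add fs.scale_sum_left F_def by (rule sum.cong) auto
  qed
  finally show ?thesis .
qed

lemma exp_path_bracket:
  assumes u: "u \<in> ext_space" and v: "v \<in> ext_space"
  shows "exp_path x m t (ext_bracket u v) = ext_bracket (exp_path x m t u) (exp_path x m t v)"
proof -
  let ?D = "\<lambda>n w. fscale (t ^ n / fact n) ((ext_bracket x ^^ n) w)"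
  have "exp_path x m t (ext_bracket u v) = (\<Sum>k<2 * m. \<Sum>i\<le>k. ext_bracket (?D i u) (?D (k - i) v))"
    unfolding exp_path_def using divided_power_derivation[OF x u v] by simp
  also have "\<dots> = (\<Sum>i<2 * m. \<Sum>j<2 * m. ext_bracket (?D i u) (?D j v))"
    by (rule sum_square_eq_sum_triangle[symmetric]) (auto simp: ad_pow_eq_0 u v)
  also have "\<dots> = ext_bracket (exp_path x m t u) (exp_path x m t v)"
    unfolding exp_path_def by (simp only: ext_bracket_sum_left) (simp only: ext_bracket_sum_right)
  finally show ?thesis .
qed

lemma exp_path_polynomial_family:
  assumes u: "u \<in> ext_space"
  shows "polynomial_family (\<lambda>t. exp_path x m t u)"
  unfolding exp_path_def
proof (rule polynomial_family_sum)
  fix n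
  have "(ext_bracket x ^^ n) u \<in> ext_space"
    using ad_pow_egr[OF ideal_UNIV x, of u n] u by (simp add: egr_UNIV_UNIV)
  from polynomial_family_scale[OF polynomial_family_const[OF this], of "monom (1 / fact n) n"]
  show "polynomial_family (\<lambda>t. fscale (t ^ n / fact n) ((ext_bracket x ^^ n) u))"
    by (simp add: poly_monom)
qed

lemma automorphism_path_exp: "ideal I \<Longrightarrow> automorphism_path I (exp_path x m)"
  by (simp add: automorphism_path_def polynomial_path_def linear_exp_path exp_path_polynomial_family
      exp_path_bracket exp_path_egr exp_path_0)

lemma automorphism_path_exp_neg:
  assumes "ideal I"
  shows "automorphism_path I (\<lambda>t. exp_path x m (- t))"
proof -
  have "polynomial_family (\<lambda>t. exp_path x m (- t) u)" if u: "u \<in> ext_space" for u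
  proof -
    have "\<exists>q. \<forall>t. exp_path x m (- t) u b = poly q t" for b
    proof -
      obtain q where "\<And>t. exp_path x m t u b = poly q t"
        using exp_path_polynomial_family[OF u] unfolding polynomial_family_def by meson
      thus ?thesis by (intro exI[of _ "pcompose q [:0, -1:]"]) (simp add: poly_pcompose)
    qed
    with exp_path_ext_space[OF u] show ?thesis by (simp add: polynomial_family_def)
  qed
  with assms show ?thesis
    by (simp add: automorphism_path_def polynomial_path_def linear_exp_path exp_path_bracket exp_path_egr exp_path_0)
qed

lemma ext_exp_eq_exp_path:
  assumes u: "u \<in> ext_space"
  shows "ext_exp (ext_bracket x) u = exp_path x m 1 u"
proof
  fix b
  let ?N = "\<lambda>n. ext_bracket x ^^ n"
  have "ext_exp (ext_bracket x) u b = (\<Sum>n | ?N n u \<noteq> 0. ?N n u b / fact n)"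
    using u by (simp add: ext_exp_def zero_fun_def)
  also have "\<dots> = (\<Sum>n<2 * m. ?N n u b / fact n)"
  proof (rule sum.mono_neutral_left)
    show "{n. ?N n u \<noteq> 0} \<subseteq> {..<2 * m}"
    proof
      fix n assume "n \<in> {n. ?N n u \<noteq> 0}"
      hence "\<not> n \<ge> m" using ad_pow_eq_0[OF u] by blast
      thus "n \<in> {..<2 * m}" by simp
    qed
  qed (auto simp: fun_apply)
  also have "\<dots> = exp_path x m 1 u b"
    by (simp add: exp_path_def sum_fun_apply fscale_apply)
  finally show "ext_exp (ext_bracket x) u b = exp_path x m 1 u b" .
qed

lemma ext_exp_Bij: "ext_exp (ext_bracket x) \<in> Bij ext_space"
proof -
  have "bij_betw (ext_exp (ext_bracket x)) ext_space ext_space"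
  proof (rule bij_betw_byWitness[where f' = "exp_path x m (- 1)"])
    show "\<forall>u\<in>ext_space. exp_path x m (- 1) (ext_exp (ext_bracket x) u) = u"
      by (simp add: ext_exp_eq_exp_path exp_path_add exp_path_0)
    show "\<forall>u\<in>ext_space. ext_exp (ext_bracket x) (exp_path x m (- 1) u) = u"
      by (simp add: ext_exp_eq_exp_path exp_path_ext_space exp_path_add exp_path_0)
    show "ext_exp (ext_bracket x) ` ext_space \<subseteq> ext_space"
      by (auto simp: ext_exp_eq_exp_path exp_path_ext_space)
    show "exp_path x m (- 1) ` ext_space \<subseteq> ext_space"
      by (auto simp: exp_path_ext_space)
  qed
  moreover have "ext_exp (ext_bracket x) \<in> extensional ext_space"
    by (simp add: ext_exp_def)
  ultimately show ?thesis by (simp add: Bij_def)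
qed

lemma inv_ext_exp:
  assumes u: "u \<in> ext_space"
  shows "(inv\<^bsub>BijGroup ext_space\<^esub> (ext_exp (ext_bracket x))) u = exp_path x m (- 1) u"
proof -
  have "(inv\<^bsub>BijGroup ext_space\<^esub> (ext_exp (ext_bracket x))) u = inv_into ext_space (ext_exp (ext_bracket x)) u"
    using u by (simp add: inv_BijGroup[OF ext_exp_Bij])
  also have "\<dots> = exp_path x m (- 1) u"
  proof (rule inv_into_f_eq)
    show "inj_on (ext_exp (ext_bracket x)) ext_space"
      using ext_exp_Bij by (simp add: Bij_def bij_betw_def)
    show "exp_path x m (- 1) u \<in> ext_space" by (rule exp_path_ext_space[OF u])
    show "ext_exp (ext_bracket x) (exp_path x m (- 1) u) = u"
      using u by (simp add: ext_exp_eq_exp_path exp_path_ext_space exp_path_add exp_path_0)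
  qed
  finally show ?thesis .
qed

end

text \<open>A generator exp(ad x) is joined to the identity by exp(t ad x), its inverse by exp(- t
  ad x), and products by pointwise composition. Membership in \<open>Bij\<close> is carried along
  because the multiplication of \<open>BijGroup\<close> is composition only there.\<close>

lemma ext_elementary_path:
  assumes I: "ideal I" and \<sigma>: "\<sigma> \<in> ext_elementary_automorphisms"
  shows "\<sigma> \<in> Bij ext_space \<and> (\<exists>\<gamma>. automorphism_path I \<gamma> \<and> (\<forall>u\<in>ext_space. \<gamma> 1 u = \<sigma> u))"
proof -
  have gen: "\<exists>m>0. \<forall>u\<in>ext_space. (ext_bracket x ^^ m) u = 0" if "ext_nilpotent (ext_bracket x)" for x
  proof -
    from that obtain m where "\<forall>u\<in>ext_space. (ext_bracket x ^^ m) u = 0"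
      by (auto simp: ext_nilpotent_def zero_fun_def)
    \<comment> \<open>\<open>Suc m\<close> secures a positive exponent; otherwise
      \<open>exp_path\<close> could be an empty sum.\<close>
    hence "\<forall>u\<in>ext_space. (ext_bracket x ^^ Suc m) u = 0" by simp
    thus ?thesis by blast
  qed
  interpret B: group "BijGroup ext_space" by (rule group_BijGroup)
  have carrier: "carrier (BijGroup ext_space) = Bij ext_space" by (simp add: BijGroup_def)
  show ?thesis
    using \<sigma> unfolding ext_elementary_automorphisms_def
  proof (induction rule: generate.induct)
    case one
    have "automorphism_path I (\<lambda>t u. u)"
      unfolding automorphism_path_def polynomial_path_def
      using polynomial_family_const fs.linear_id by (auto simp: id_def)
    moreover have "\<one>\<^bsub>BijGroup ext_space\<^esub> u = u" if "u \<in> ext_space" for u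
      using that by (simp add: BijGroup_def)
    ultimately show ?case using B.one_closed carrier by (metis (no_types, lifting))
  next
    case (incl h)
    then obtain x where h: "h = ext_exp (ext_bracket x)" and x: "x \<in> ext_space"
      and nil: "ext_nilpotent (ext_bracket x)" by blast
    obtain m where m: "m > 0" "\<And>u. u \<in> ext_space \<Longrightarrow> (ext_bracket x ^^ m) u = 0"
      using gen[OF nil] by blast
    show ?case unfolding h
      using ext_exp_Bij[OF x m] automorphism_path_exp[OF x m I] ext_exp_eq_exp_path[OF x m] by auto
  next
    case (inv h)
    then obtain x where h: "h = ext_exp (ext_bracket x)" and x: "x \<in> ext_space"
      and nil: "ext_nilpotent (ext_bracket x)" by blast
    obtain m where m: "m > 0" "\<And>u. u \<in> ext_space \<Longrightarrow> (ext_bracket x ^^ m) u = 0"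
      using gen[OF nil] by blast
    have "inv\<^bsub>BijGroup ext_space\<^esub> h \<in> Bij ext_space"
      using B.inv_closed[of h] ext_exp_Bij[OF x m] unfolding h carrier by blast
    thus ?case
      using automorphism_path_exp_neg[OF x m I] inv_ext_exp[OF x m] unfolding h
      by (intro conjI exI[of _ "\<lambda>t. exp_path x m (- t)"]) auto
  next
    case (eng h1 h2)
    then obtain \<gamma> \<delta> where p: "automorphism_path I \<gamma>" "\<And>u. u \<in> ext_space \<Longrightarrow> \<gamma> 1 u = h1 u"
      "automorphism_path I \<delta>" "\<And>u. u \<in> ext_space \<Longrightarrow> \<delta> 1 u = h2 u" by blast
    have Bij: "h1 \<in> Bij ext_space" "h2 \<in> Bij ext_space" using eng by auto
    have "h1 \<otimes>\<^bsub>BijGroup ext_space\<^esub> h2 \<in> Bij ext_space"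
      using B.m_closed[of h1 h2] Bij unfolding carrier by blast
    moreover have "\<gamma> 1 (\<delta> 1 u) = (h1 \<otimes>\<^bsub>BijGroup ext_space\<^esub> h2) u" if u: "u \<in> ext_space" for u
    proof -
      have "h2 u \<in> ext_space" using Bij(2) u by (auto simp: Bij_def bij_betw_def)
      with u p Bij show ?thesis by (simp add: BijGroup_def compose_def)
    qed
    ultimately show ?case using automorphism_path_compose[OF p(1,3)] by blast
  qed
qed

section \<open>Solving linear systems along a polynomial path\<close>

text \<open>Cramer's rule with a parameter: \<open>D\<close> is the determinant of
  \<open>T t\<close> in the coordinates of \<open>Basis\<close>, and the adjugate solves the system
  up to the factor \<open>D\<close> with polynomial entries.\<close>

lemma polynomial_path_adjugate:
  assumes T: "polynomial_path T"
  shows "\<exists>D. (\<forall>t. poly D t = 0 \<longleftrightarrow> (\<exists>u\<in>ext_space. u \<noteq> 0 \<and> T t u = 0)) \<and>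
    (\<forall>v. polynomial_family v \<longrightarrow>
      (\<exists>w. polynomial_family w \<and> (\<forall>t. T t (w t) = fscale (poly D t) (v t))))"
proof -
  obtain bs where bs: "set bs = Basis" "distinct bs" using finite_distinct_list[OF finite_Basis] by blast
  let ?n = "length bs"
  let ?d = "\<lambda>i. to_ext (bs ! i)"
  have reindex: "(\<Sum>b\<in>Basis. f b) = (\<Sum>i<?n. f (bs ! i))" for f :: "'v \<Rightarrow> 'x::comm_monoid_add"
    using sum.reindex_bij_betw[OF bij_betw_nth[OF bs(2) refl bs(1)[symmetric]], of f] by simp
  have lin: "Vector_Spaces.linear fscale fscale (T t)" for t
    using T by (simp add: polynomial_path_def)
  have TE: "T t (?d j) \<in> ext_space" for t j
    using T to_ext_in_ext_space by (auto simp: polynomial_path_def polynomial_family_def)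
  have "\<forall>i j. \<exists>q. \<forall>t. T t (?d j) (bs ! i) = poly q t"
    using T to_ext_in_ext_space by (auto simp: polynomial_path_def polynomial_family_def)
  then obtain F where F: "\<And>i j t. T t (?d j) (bs ! i) = poly (F i j) t" by metis
  let ?D = "detf ?n F"
  have expand: "u = (\<Sum>i<?n. fscale (u (bs ! i)) (?d i))" if "u \<in> ext_space" for u
    using ext_space_expansion[OF that] unfolding reindex .
  have ind: "\<forall>i<?n. a i = 0" if "(\<Sum>i<?n. fscale (a i) (?d i)) = 0" for a :: "nat \<Rightarrow> 'k alg_closure"
  proof (intro allI impI)
    fix k assume k: "k < ?n"
    have "(\<Sum>i<?n. fscale (a i) (?d i)) (bs ! k) = (\<Sum>i<?n. if i = k then a k else 0)"
      unfolding sum_fun_apply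
    proof (rule sum.cong[OF refl])
      fix i assume i: "i \<in> {..<?n}"
      hence "bs ! i \<in> Basis" unfolding bs(1)[symmetric] by simp
      thus "fscale (a i) (?d i) (bs ! k) = (if i = k then a k else 0)"
        using i k bs(2) by (auto simp: fscale_apply to_ext_basis nth_eq_iff_index_eq)
    qed
    with that k show "a k = 0" by (simp add: fun_apply)
  qed
  have span: "fs.span (?d ` {..<?n}) = ext_space"
  proof
    show "fs.span (?d ` {..<?n}) \<subseteq> ext_space"
      using to_ext_in_ext_space by (intro fs.span_minimal subspace_ext_space) auto
    show "ext_space \<subseteq> fs.span (?d ` {..<?n})"
    proof
      fix u assume "u \<in> ext_space"
      have "(\<Sum>i<?n. fscale (u (bs ! i)) (?d i)) \<in> fs.span (?d ` {..<?n})"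
        by (intro fs.span_sum fs.span_scale fs.span_base) auto
      with expand[OF \<open>u \<in> ext_space\<close>] show "u \<in> fs.span (?d ` {..<?n})" by simp
    qed
  qed
  have "poly ?D t = 0 \<longleftrightarrow> (\<exists>u\<in>ext_space. u \<noteq> 0 \<and> T t u = 0)" for t
  proof -
    interpret h: comm_ring_hom "\<lambda>p :: 'k alg_closure poly. poly p t" by unfold_locales auto
    have "poly ?D t = detf ?n (\<lambda>i j. poly (F i j) t)" by (rule h.hom_detf)
    moreover have "T t (?d j) = (\<Sum>i<?n. fscale (poly (F i j) t) (?d i))" for j
      using expand[OF TE[of t j]] by (simp add: F)
    from fs.detf_eq_0_iff_kernel[OF lin this ind ind]
    have "detf ?n (\<lambda>i j. poly (F i j) t) = 0 \<longleftrightarrow> (\<exists>u\<in>fs.span (?d ` {..<?n}). u \<noteq> 0 \<and> T t u = 0)" .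
    ultimately show ?thesis unfolding span by simp
  qed
  moreover have "\<exists>w. polynomial_family w \<and> (\<forall>t. T t (w t) = fscale (poly ?D t) (v t))"
    if v: "polynomial_family v" for v
  proof -
    obtain A where A: "\<And>i k. i < ?n \<Longrightarrow> k < ?n \<Longrightarrow> (\<Sum>j<?n. F i j * A j k) = (if i = k then ?D else 0)"
      using detf_adjugate[of ?n F] by blast
    have "\<forall>i. \<exists>q. \<forall>t. v t (bs ! i) = poly q t" using v by (auto simp: polynomial_family_def)
    then obtain V where V: "\<And>i t. v t (bs ! i) = poly (V i) t" by metis
    let ?a = "\<lambda>j. \<Sum>k<?n. A j k * V k"
    let ?w = "\<lambda>t. \<Sum>j<?n. fscale (poly (?a j) t) (?d j)"
    have "polynomial_family ?w"
      by (intro polynomial_family_sum polynomial_family_scale polynomial_family_const to_ext_in_ext_space)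
    moreover have "T t (?w t) = fscale (poly ?D t) (v t)" for t
    proof -
      interpret l: Vector_Spaces.linear fscale fscale "T t" by (rule lin)
      have coeff: "(\<Sum>j<?n. F i j * ?a j) = ?D * V i" if i: "i < ?n" for i
      proof -
        have "(\<Sum>j<?n. F i j * ?a j) = (\<Sum>j<?n. \<Sum>k<?n. F i j * A j k * V k)"
          by (simp add: sum_distrib_left mult.assoc)
        also have "\<dots> = (\<Sum>k<?n. (\<Sum>j<?n. F i j * A j k) * V k)"
          unfolding sum_distrib_right by (rule sum.swap)
        also have "\<dots> = (\<Sum>k<?n. if i = k then ?D * V i else 0)"
          using A[OF i] by (intro sum.cong refl) auto
        also have "\<dots> = ?D * V i" using i by simp
        finally show ?thesis .
      qed
      have "T t (?w t) = (\<Sum>j<?n. fscale (poly (?a j) t) (\<Sum>i<?n. fscale (poly (F i j) t) (?d i)))"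
        using expand[OF TE] by (simp add: l.sum l.scale F)
      also have "\<dots> = (\<Sum>j<?n. \<Sum>i<?n. fscale (poly (F i j * ?a j) t) (?d i))"
        by (simp only: fs.scale_sum_right fs.scale_scale poly_mult mult.commute)
      also have "\<dots> = (\<Sum>i<?n. fscale (poly (\<Sum>j<?n. F i j * ?a j) t) (?d i))"
        by (subst sum.swap) (simp only: poly_sum fs.scale_sum_left)
      also have "\<dots> = (\<Sum>i<?n. fscale (poly ?D t) (fscale (v t (bs ! i)) (?d i)))"
        by (intro sum.cong refl) (simp add: coeff V)
      also have "\<dots> = fscale (poly ?D t) (v t)"
        using v expand[of "v t"] by (simp only: fs.scale_sum_right[symmetric]) (simp add: polynomial_family_def)
      finally show ?thesis .
    qed
    ultimately show ?thesis by blast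
  qed
  ultimately show ?thesis by blast
qed

end


section \<open>The Levi part of a path\<close>

lemma greaterThan_Int_atMost [simp]:
  "{k<..} \<inter> {..k :: 'a::linorder} = {}" "{..k} \<inter> {k<..} = {}"
  by auto

text \<open>The ratio is the product of the \<open>(1 - r) / (- r)\<close> over the roots
  \<open>r\<close> of \<open>q\<close>, at most \<open>n\<close> of them, all taken from the finite
  set \<open>S\<close>.\<close>

lemma finite_root_ratios:
  fixes S :: "'a::alg_closed_field set"
  assumes S: "finite S"
  shows "\<exists>V. finite V \<and> (\<forall>q. degree q \<le> n \<longrightarrow> poly q 0 \<noteq> 0 \<longrightarrow> (\<forall>s. poly q s = 0 \<longrightarrow> s \<in> S) \<longrightarrow>
    poly q 1 / poly q 0 \<in> V)"
proof (induction n)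
  case 0
  have "poly q 1 / poly q 0 \<in> {1}" if deg: "degree q \<le> 0" and q0: "poly q 0 \<noteq> 0" for q :: "'a poly"
  proof -
    obtain c where "q = [:c:]" using deg degree_eq_zeroE by blast
    with q0 show ?thesis by simp
  qed
  thus ?case by (intro exI[of _ "{1}"]) blast
next
  case (Suc n)
  then obtain V where V: "finite V" "\<And>q :: 'a poly. degree q \<le> n \<Longrightarrow> poly q 0 \<noteq> 0 \<Longrightarrow>
      (\<And>s. poly q s = 0 \<Longrightarrow> s \<in> S) \<Longrightarrow> poly q 1 / poly q 0 \<in> V" by blast
  let ?V = "V \<union> (\<Union>r\<in>S. (\<lambda>v. (1 - r) / (- r) * v) ` V)"
  have "poly q 1 / poly q 0 \<in> ?V"
    if q: "degree q \<le> Suc n" "poly q 0 \<noteq> 0" and roots: "\<And>s. poly q s = 0 \<Longrightarrow> s \<in> S" for q :: "'a poly"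
  proof (cases "degree q \<le> n")
    case True
    from V(2)[OF True q(2) roots] show ?thesis by blast
  next
    case False
    hence "degree q > 0" by simp
    then obtain r where r: "poly q r = 0" using alg_closed_imp_poly_has_root by blast
    then obtain q' where q': "q = [:- r, 1:] * q'" using poly_eq_0_iff_dvd by blast
    have "q' \<noteq> 0" using q' q(2) by auto
    hence "degree q = Suc (degree q')" unfolding q' by (subst degree_mult_eq) auto
    hence "degree q' \<le> n" using q(1) by simp
    moreover have "poly q' 0 \<noteq> 0" using q(2) unfolding q' by simp
    moreover have "s \<in> S" if "poly q' s = 0" for s using that roots[of s] unfolding q' by simp
    ultimately have "poly q' 1 / poly q' 0 \<in> V" by (rule V(2))
    moreover have "poly q 1 / poly q 0 = (1 - r) / (- r) * (poly q' 1 / poly q' 0)"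
      unfolding q' by (simp add: algebra_simps)
    ultimately show ?thesis using roots[OF r] by blast
  qed
  moreover have "finite ?V" using V(1) S by blast
  ultimately show ?case by (intro exI[of _ ?V]) blast
qed

context graded_semisimple_lie_algebra
begin

lemma egr_lo: 
  assumes "u \<in> ext_space" "eproj {k<..} u = 0"
  shows "u \<in> egr UNIV {..k}"
proof -
  have u: "u \<in> egr UNIV UNIV" using assms(1) by (simp add: egr_UNIV_UNIV)
  have "u = eproj {..k} u" using eproj_decomp[OF u, of "{..k}"] assms(2) by (simp add: Compl_atMost)
  with eproj_egr[OF u, of "{..k}"] show ?thesis by simp
qed

lemma egr_hi:
  assumes "u \<in> egr I UNIV" "eproj {..k} u = 0"
  shows "u \<in> egr I {k<..}"
proof -
  have "u = eproj {k<..} u" using eproj_decomp[OF assms(1), of "{..k}"] assms(2) by (simp add: Compl_atMost)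
  with eproj_egr[OF assms(1), of "{k<..}"] show ?thesis by simp
qed

lemma egr_disjoint:
  assumes "u \<in> egr I S" "u \<in> egr J T" "S \<inter> T = {}"
  shows "u = 0"
  using eproj_id[OF assms(1) order_refl] eproj_zero[OF assms(2,3)] by simp

text \<open>For a linear \<open>\<delta>\<close> on \<open>ext_space\<close> this says that its
  diagonal block on the degrees above \<open>k\<close> is injective, the condition for splitting it
  by block elimination at \<open>k\<close>.\<close>

definition transversal :: "int \<Rightarrow> (('v \<Rightarrow> 'k alg_closure) \<Rightarrow> 'v \<Rightarrow> 'k alg_closure) \<Rightarrow> bool" where
  "transversal k \<delta> \<longleftrightarrow> (\<forall>u\<in>egr UNIV {k<..}. \<delta> u \<in> egr UNIV {..k} \<longrightarrow> u = 0)"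

text \<open>Where \<open>transversal\<close> holds, every \<open>z\<close> of degree \<open>k\<close> has a unique correction
  \<open>z'\<close> by higher terms whose image has no terms of degree above \<open>k\<close>; the degree \<open>k\<close> part
  of that image is the Levi (block diagonal) factor of \<open>\<gamma> t\<close> applied to \<open>z\<close>.\<close>

lemma transversal_polynomial:
  assumes \<gamma>: "polynomial_path \<gamma>"
  shows "\<exists>D. (\<forall>t. poly D t \<noteq> 0 \<longleftrightarrow> transversal k (\<gamma> t)) \<and>
    (\<forall>z\<in>egr UNIV {k}. \<exists>L. polynomial_family L \<and> (\<forall>t. poly D t \<noteq> 0 \<longrightarrow>
      (\<exists>z'. z' - z \<in> egr UNIV {k<..} \<and> \<gamma> t z' \<in> egr UNIV {..k} \<and>
        L t = fscale (poly D t) (eproj {k} (\<gamma> t z')))))"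
proof -
  let ?lo = "eproj {..k}" and ?hi = "eproj {k<..}"
  \<comment> \<open>The identity on degrees up to \<open>k\<close> together with the diagonal block
    of \<open>\<gamma> t\<close> above \<open>k\<close>; the determinant of \<open>T t\<close> is
    thus the block minor.\<close>
  define T where "T = (\<lambda>t u. ?lo u + ?hi (\<gamma> t (?hi u)))"
  interpret g: Vector_Spaces.linear fscale fscale "\<gamma> t" for t by (rule polynomial_pathD(1)[OF \<gamma>])
  have E: "eproj S u \<in> ext_space" if "u \<in> ext_space" for S u
    using eproj_egr[of u UNIV UNIV S] that egr_ext_space by (simp add: egr_UNIV_UNIV)
  have path_proj: "polynomial_path (\<lambda>t. eproj S)" for S
    unfolding polynomial_path_def using linear_eproj polynomial_family_const[OF E] by blast
  have pT: "polynomial_path T"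
    unfolding polynomial_path_def
  proof (intro conjI allI ballI)
    show "Vector_Spaces.linear fscale fscale (T t)" for t
      by unfold_locales (simp_all add: T_def eproj_add eproj_scale g.add g.scale fs.scale_right_distrib)
    fix u assume u: "u \<in> ext_space"
    show "polynomial_family (\<lambda>t. T t u)"
      unfolding T_def
      by (intro polynomial_family_add polynomial_family_const E u
          polynomial_path_family[OF path_proj] polynomial_pathD(2)[OF \<gamma>])
  qed
  obtain D where D: "\<And>t. poly D t = 0 \<longleftrightarrow> (\<exists>u\<in>ext_space. u \<noteq> 0 \<and> T t u = 0)"
    and adj: "\<And>v. polynomial_family v \<Longrightarrow>
      \<exists>w. polynomial_family w \<and> (\<forall>t. T t (w t) = fscale (poly D t) (v t))"
    using polynomial_path_adjugate[OF pT] by blast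
  have lo_T: "?lo (T t u) = ?lo u" and hi_T: "?hi (T t u) = ?hi (\<gamma> t (?hi u))" if u: "u \<in> ext_space" for t u
  proof -
    have u': "u \<in> egr UNIV UNIV" using u by (simp add: egr_UNIV_UNIV)
    have lo: "?lo u \<in> egr UNIV {..k}" using eproj_egr[OF u', of "{..k}"] by simp
    have "?hi (\<gamma> t (?hi u)) \<in> egr UNIV ({k<..} \<inter> UNIV)"
      using polynomial_pathD(3)[OF \<gamma> E[OF u]] by (intro eproj_egr) (simp add: egr_UNIV_UNIV)
    hence hi: "?hi (\<gamma> t (?hi u)) \<in> egr UNIV {k<..}" by simp
    have "?lo (?lo u) = ?lo u" "?hi (?lo u) = 0" using eproj_id[OF lo order_refl] eproj_zero[OF lo, of "{k<..}"] by auto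
    moreover have "?lo (?hi (\<gamma> t (?hi u))) = 0" "?hi (?hi (\<gamma> t (?hi u))) = ?hi (\<gamma> t (?hi u))"
      using eproj_zero[OF hi, of "{..k}"] eproj_id[OF hi order_refl] by auto
    ultimately show "?lo (T t u) = ?lo u" "?hi (T t u) = ?hi (\<gamma> t (?hi u))"
      unfolding T_def eproj_add by simp_all
  qed
  have hi_id: "?hi u = u" "?lo u = 0" if "u \<in> egr UNIV {k<..}" for u
    using eproj_id[OF that order_refl] eproj_zero[OF that, of "{..k}"] by auto
  have trans: "poly D t \<noteq> 0 \<longleftrightarrow> transversal k (\<gamma> t)" for t
  proof
    assume Dt: "poly D t \<noteq> 0"
    show "transversal k (\<gamma> t)" unfolding transversal_def
    proof (intro ballI impI)
      fix u assume u: "u \<in> egr UNIV {k<..}" "\<gamma> t u \<in> egr UNIV {..k}"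
      have "T t u = ?hi (\<gamma> t u)" unfolding T_def by (simp add: hi_id[OF u(1)])
      also have "\<dots> = 0" by (rule eproj_zero[OF u(2)]) auto
      finally show "u = 0" using D[of t] Dt egr_ext_space[OF u(1)] by blast
    qed
  next
    assume tr: "transversal k (\<gamma> t)"
    show "poly D t \<noteq> 0"
    proof
      assume "poly D t = 0"
      then obtain u where u: "u \<in> ext_space" "u \<noteq> 0" "T t u = 0" using D by blast
      have "?lo u = 0" using lo_T[OF u(1), of t] u(3) by simp
      with u(1) have hi: "u \<in> egr UNIV {k<..}" by (intro egr_hi) (simp_all add: egr_UNIV_UNIV)
      have "?hi (\<gamma> t u) = 0" using hi_T[OF u(1), of t] u(3) hi_id[OF hi] by simp
      hence "\<gamma> t u \<in> egr UNIV {..k}" by (rule egr_lo[OF polynomial_pathD(3)[OF \<gamma> u(1)]])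
      with tr hi u(2) show False unfolding transversal_def by blast
    qed
  qed
  have "\<exists>L. polynomial_family L \<and> (\<forall>t. poly D t \<noteq> 0 \<longrightarrow>
      (\<exists>z'. z' - z \<in> egr UNIV {k<..} \<and> \<gamma> t z' \<in> egr UNIV {..k} \<and>
        L t = fscale (poly D t) (eproj {k} (\<gamma> t z'))))" if z: "z \<in> egr UNIV {k}" for z
  proof -
    have zE: "z \<in> ext_space" by (rule egr_ext_space[OF z])
    \<comment> \<open>The correction \<open>?u\<close> must satisfy
      \<open>T t ?u = - ?hi (\<gamma> t z)\<close>, so that the part of
      \<open>\<gamma> t (z + ?u)\<close> above degree \<open>k\<close> cancels. Cramer's rule yields
      \<open>w t = poly D t\<close> times \<open>?u\<close>, which explains the factor in
      \<open>?L\<close>.\<close>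
    let ?v = "\<lambda>t. fscale (poly [:-1:] t) (?hi (\<gamma> t z))"
    have v: "polynomial_family ?v"
      by (intro polynomial_family_scale polynomial_path_family[OF path_proj] polynomial_pathD(2)[OF \<gamma> zE])
    obtain w where w: "polynomial_family w" "\<And>t. T t (w t) = fscale (poly D t) (?v t)"
      using adj[OF v] by blast
    let ?L = "\<lambda>t. eproj {k} (\<gamma> t (fscale (poly D t) z + w t))"
    have "polynomial_family ?L"
      by (intro polynomial_path_family[OF path_proj] polynomial_path_family[OF \<gamma>] polynomial_family_add
          polynomial_family_scale polynomial_family_const zE w(1))
    moreover have "\<exists>z'. z' - z \<in> egr UNIV {k<..} \<and> \<gamma> t z' \<in> egr UNIV {..k} \<and>
        ?L t = fscale (poly D t) (eproj {k} (\<gamma> t z'))" if Dt: "poly D t \<noteq> 0" for t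
    proof -
      let ?u = "fscale (inverse (poly D t)) (w t)"
      let ?z = "z + ?u"
      have wE: "w t \<in> ext_space" using w(1) by (simp add: polynomial_family_def)
      hence uE: "?u \<in> ext_space" by (rule fs.subspace_scale[OF subspace_ext_space])
      interpret T: Vector_Spaces.linear fscale fscale "T t" by (rule polynomial_pathD(1)[OF pT])
      have Tu: "T t ?u = - ?hi (\<gamma> t z)"
        using Dt by (simp add: T.scale w(2) fs.scale_minus_left)
      have gz: "?hi (\<gamma> t z) \<in> egr UNIV ({k<..} \<inter> UNIV)"
        using polynomial_pathD(3)[OF \<gamma> zE] by (intro eproj_egr) (simp add: egr_UNIV_UNIV)
      have "?lo ?u = ?lo (T t ?u)" by (rule lo_T[OF uE, symmetric])
      also have "\<dots> = - ?lo (?hi (\<gamma> t z))" unfolding Tu using eproj_diff[of _ 0] by simp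
      also have "\<dots> = 0" using eproj_zero[OF gz, of "{..k}"] by auto
      finally have hi: "?u \<in> egr UNIV {k<..}" using uE by (intro egr_hi) (simp_all add: egr_UNIV_UNIV)
      have "?hi (\<gamma> t ?u) = ?hi (T t ?u)" using hi_T[OF uE, of t] hi_id[OF hi] by simp
      also have "\<dots> = - ?hi (?hi (\<gamma> t z))" unfolding Tu using eproj_diff[of _ 0] by simp
      also have "?hi (?hi (\<gamma> t z)) = ?hi (\<gamma> t z)" using hi_id[of "?hi (\<gamma> t z)"] gz by simp
      finally have hm: "?hi (\<gamma> t ?u) = - ?hi (\<gamma> t z)" .
      have "?hi (\<gamma> t ?z) = 0" unfolding g.add eproj_add hm by (rule right_minus)
      hence "\<gamma> t ?z \<in> egr UNIV {..k}"
        by (rule egr_lo[OF polynomial_pathD(3)[OF \<gamma> fs.subspace_add[OF subspace_ext_space zE uE]]])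
      moreover have "fscale (poly D t) z + w t = fscale (poly D t) ?z"
        using Dt by (simp add: fs.scale_right_distrib)
      hence "?L t = fscale (poly D t) (eproj {k} (\<gamma> t ?z))"
        by (simp only: g.scale eproj_scale)
      moreover have "?z - z \<in> egr UNIV {k<..}" using hi by simp
      ultimately show ?thesis by blast
    qed
    ultimately show ?thesis by blast
  qed
  with trans show ?thesis by blast
qed

lemma egr_bracket_bracket:
  assumes "a \<in> egr UNIV S" "b \<in> egr UNIV T" "c \<in> egr UNIV U"
    and "\<And>i j k. i \<in> S \<Longrightarrow> j \<in> T \<Longrightarrow> k \<in> U \<Longrightarrow> i + (j + k) \<in> R"
  shows "ext_bracket a (ext_bracket b c) \<in> egr UNIV R"
proof -
  have "ext_bracket b c \<in> egr UNIV {j + k | j k. j \<in> T \<and> k \<in> U}"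
    by (rule egr_bracket[OF ideal_UNIV _ assms(2,3)]) blast
  thus ?thesis by (rule egr_bracket[OF ideal_UNIV _ assms(1), rotated]) (use assms(4) in blast)
qed

text \<open>Every term on the right contains \<open>u\<close> or \<open>v\<close>. With
  \<open>u\<close> and \<open>v\<close> further along a filtration than \<open>x\<close> and
  \<open>d\<close>, the double bracket keeps its leading term.\<close>

lemma ext_bracket_square_diff:
  "ext_bracket (x + u) (ext_bracket (x + u) (d + v)) - ext_bracket x (ext_bracket x d)
    = ext_bracket x (ext_bracket x v) + ext_bracket x (ext_bracket u (d + v))
      + ext_bracket u (ext_bracket (x + u) (d + v))"
  by (simp add: ext_bracket_add_left ext_bracket_add_right algebra_simps)

text \<open>Ideally \<open>d\<close> is the preimage of \<open>d'\<close> under the Levi factor. It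
  is found as the degree -1 part of some \<open>e\<close> in \<open>I\<close> of degrees above -2
  with image \<open>d'\<close> plus lower terms. The double bracket \<open>?w\<close> of
  \<open>x'\<close> with \<open>e\<close> starts with \<open>[x, [x, d]]\<close> in degree 1, while
  its image has the top term \<open>[lx, [lx, d']] = 0\<close> in degree 1. So \<open>?w\<close> has
  degrees above 0, its image degrees at most 0, and \<open>transversal 0\<close> gives
  \<open>?w = 0\<close>.\<close>

lemma Levi_kernel:
  assumes ap: "automorphism_path I \<gamma>" and I: "ideal I"
    and tr: "transversal (- 2) (\<gamma> t)" "transversal (- 1) (\<gamma> t)" "transversal 0 (\<gamma> t)"
    and x: "x \<in> egr UNIV {1}" and x': "x' - x \<in> egr UNIV {1<..}" "\<gamma> t x' \<in> egr UNIV {..1}"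
    and d': "d' \<in> egr I {- 1}" "d' \<noteq> 0"
    and ker: "ext_bracket (eproj {1} (\<gamma> t x')) (ext_bracket (eproj {1} (\<gamma> t x')) d') = 0"
  shows "\<exists>d\<in>egr I {- 1}. d \<noteq> 0 \<and> ext_bracket x (ext_bracket x d) = 0"
proof -
  note A = automorphism_pathD[OF ap]
  interpret g: Vector_Spaces.linear fscale fscale "\<gamma> t" by (rule polynomial_pathD(1)[OF A(1)])
  let ?S = "egr I {- 2<..}"
  let ?f = "\<lambda>u. eproj {- 2<..} (\<gamma> t u)"
  have mono: "egr I S \<subseteq> egr UNIV S" for S by (rule egr_mono) auto
  have linf: "Vector_Spaces.linear fscale fscale ?f"
    by unfold_locales (simp_all add: g.add g.scale eproj_add eproj_scale)
  interpret f: Vector_Spaces.linear fscale fscale ?f by (rule linf)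
  obtain F where F: "finite F" "?S = fs.span F" using egr_finite_span by blast
  have stable: "?f ` ?S \<subseteq> ?S"
  proof (intro image_subsetI)
    fix u assume "u \<in> ?S"
    hence "u \<in> egr I UNIV" using egr_mono[of I I "{- 2<..}" UNIV] by auto
    from eproj_egr[OF A(3)[OF this], of "{- 2<..}"] show "?f u \<in> ?S" by simp
  qed
  have "inj_on ?f ?S"
  proof (rule inj_onI)
    fix u v assume uv: "u \<in> ?S" "v \<in> ?S" "?f u = ?f v"
    have w: "u - v \<in> ?S" using uv(1,2) by (rule egr_diff)
    have "?f (u - v) = 0" using uv(3) by (simp only: f.diff) simp
    hence "\<gamma> t (u - v) \<in> egr UNIV {..- 2}"
      by (intro egr_lo polynomial_pathD(3)[OF A(1)] egr_ext_space[OF w])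
    moreover have "u - v \<in> egr UNIV {- 2<..}" using w mono by blast
    ultimately have "u - v = 0" using tr(1) unfolding transversal_def by blast
    thus "u = v" by simp
  qed
  \<comment> \<open>In finite dimension the injective block on the degrees of \<open>I\<close> above
    -2 is onto, so \<open>d'\<close> is hit up to terms of degree at most -2.\<close>
  hence "?f ` ?S = ?S"
    using fs.linear_inj_on_finite_span_surj[OF linf F(1)] stable unfolding F(2) by blast
  moreover have "d' \<in> ?S" using egr_mono[of I I "{- 1}" "{- 2<..}"] d'(1) by auto
  ultimately have "d' \<in> ?f ` ?S" by simp
  then obtain e where e: "e \<in> ?S" "d' = ?f e" by blast
  have eU: "e \<in> egr I UNIV" using egr_mono[of I I "{- 2<..}" UNIV] e(1) by auto
  have eE: "e \<in> ext_space" by (rule egr_ext_space[OF e(1)])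
  have geU: "\<gamma> t e \<in> egr I UNIV" by (rule A(3)[OF eU])
  define r where "r = eproj {..- 2} (\<gamma> t e)"
  have ge: "\<gamma> t e = d' + r"
    using eproj_decomp[OF geU, of "{- 2<..}"] unfolding e(2) r_def Compl_greaterThan .
  have r: "r \<in> egr UNIV {..- 2}" using eproj_egr[OF geU, of "{..- 2}"] mono unfolding r_def by auto
  have ge_lo: "\<gamma> t e \<in> egr UNIV {..- 1}"
    unfolding ge using r d'(1) egr_mono[of I UNIV "{- 1}" "{..- 1}"] egr_mono[of UNIV UNIV "{..- 2}" "{..- 1}"]
    by (intro egr_add) auto
  let ?d = "eproj {- 1} e" and ?v = "eproj (- {- 1}) e"
  have edv: "e = ?d + ?v" by (rule eproj_decomp[OF eU])
  have d: "?d \<in> egr I {- 1}" using eproj_egr[OF e(1), of "{- 1}"] by simp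
  have "- {- 1} \<inter> {- 2<..} = {- 1 :: int<..}" by auto
  hence v: "?v \<in> egr UNIV {- 1<..}" using eproj_egr[OF e(1), of "- {- 1}"] mono by auto
  \<comment> \<open>Otherwise \<open>e\<close> has degrees above -1 and its image degrees at most
    -1.\<close>
  have d_nz: "?d \<noteq> 0"
  proof
    assume "?d = 0"
    hence "e \<in> egr UNIV {- 1<..}" using v edv by simp
    with tr(2) ge_lo have "e = 0" unfolding transversal_def by blast
    with e(2) d'(2) show False by (simp add: f.zero)
  qed
  let ?u = "x' - x"
  have x'_eq: "x' = x + ?u" by simp
  have x'_hi: "x + ?u \<in> egr UNIV {0<..}"
    using x x'(1) egr_mono[of UNIV UNIV "{1}" "{0<..}"] egr_mono[of UNIV UNIV "{1<..}" "{0<..}"]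
    by (intro egr_add) auto
  have x'E: "x' \<in> ext_space" using egr_ext_space[OF x'_hi] by simp
  have dE: "?d \<in> egr UNIV {- 1}" using d mono by blast
  have e_hi: "?d + ?v \<in> egr UNIV {- 2<..}" using e(1) mono edv by auto
  let ?w = "ext_bracket x' (ext_bracket x' e)"
  have "ext_bracket (x + ?u) (ext_bracket (x + ?u) (?d + ?v)) - ext_bracket x (ext_bracket x ?d) \<in> egr UNIV {1<..}"
    unfolding ext_bracket_square_diff
    by (intro egr_add egr_bracket_bracket[OF x x v]
        egr_bracket_bracket[OF x x'(1) e_hi] egr_bracket_bracket[OF x'(1) x'_hi e_hi]) auto
  hence w: "?w - ext_bracket x (ext_bracket x ?d) \<in> egr UNIV {1<..}" using edv by simp
  have xxd: "ext_bracket x (ext_bracket x ?d) \<in> egr UNIV {1}"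
    by (rule egr_bracket_bracket[OF x x dE]) auto
  have "(?w - ext_bracket x (ext_bracket x ?d)) + ext_bracket x (ext_bracket x ?d) \<in> egr UNIV {0<..}"
    using w xxd egr_mono[of UNIV UNIV "{1}" "{0<..}"] egr_mono[of UNIV UNIV "{1<..}" "{0<..}"]
    by (intro egr_add) auto
  hence w_hi: "?w \<in> egr UNIV {0<..}" by simp
  define lx where "lx = eproj {1} (\<gamma> t x')"
  define q where "q = eproj (- {1}) (\<gamma> t x')"
  have gx: "\<gamma> t x' = lx + q"
    unfolding lx_def q_def using x'(2) egr_mono[of UNIV UNIV "{..1}" UNIV] by (intro eproj_decomp) auto
  have lx: "lx \<in> egr UNIV {1}" using eproj_egr[OF x'(2), of "{1}"] unfolding lx_def by simp
  have "- {1} \<inter> {..1} = {..0 :: int}" by auto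
  hence q: "q \<in> egr UNIV {..0}" using eproj_egr[OF x'(2), of "- {1}"] unfolding q_def by simp
  have gx_lo: "lx + q \<in> egr UNIV {..1}" using x'(2) gx by simp
  have d'U: "d' \<in> egr UNIV {- 1}" using d'(1) mono by blast
  have ge_lo': "d' + r \<in> egr UNIV {..- 1}" using ge_lo ge by simp
  have "\<gamma> t ?w = ext_bracket (\<gamma> t x') (ext_bracket (\<gamma> t x') (\<gamma> t e))"
    using A(2)[OF x'E ext_bracket_in_ext_space] A(2)[OF x'E eE] by simp
  also have "\<dots> = ext_bracket (lx + q) (ext_bracket (lx + q) (d' + r)) - ext_bracket lx (ext_bracket lx d')"
    unfolding gx ge ker[folded lx_def] by simp
  also have "\<dots> \<in> egr UNIV {..0}"
    unfolding ext_bracket_square_diff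
    by (intro egr_add egr_bracket_bracket[OF lx lx r]
        egr_bracket_bracket[OF lx q ge_lo'] egr_bracket_bracket[OF q gx_lo ge_lo']) auto
  finally have "\<gamma> t ?w \<in> egr UNIV {..0}" .
  with tr(3) w_hi have "?w = 0" unfolding transversal_def by blast
  with w have "- ext_bracket x (ext_bracket x ?d) \<in> egr UNIV {1<..}" by simp
  hence "ext_bracket x (ext_bracket x ?d) \<in> egr UNIV {1<..}"
    using egr_neg by fastforce
  from egr_disjoint[OF xxd this] have "ext_bracket x (ext_bracket x ?d) = 0" by simp
  with d d_nz show ?thesis by blast
qed

text \<open>A polynomial evaluated at the rational curve \<open>L / D\<close> becomes polynomial
  after multiplication by a power of \<open>D\<close>.\<close>

lemma coord_polys_polynomial_family:
  assumes p: "p \<in> coord_polys" and L: "polynomial_family L"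
  shows "\<exists>k q. \<forall>t. poly D t \<noteq> 0 \<longrightarrow> p (fscale (inverse (poly D t)) (L t)) * poly D t ^ k = poly q t"
  using p
proof induction
  case (const c)
  show ?case by (intro exI[of _ 0] exI[of _ "[:c:]"]) simp
next
  case (coord b)
  obtain q where "\<And>t. L t b = poly q t" using L unfolding polynomial_family_def by meson
  thus ?case by (intro exI[of _ 1] exI[of _ q]) (simp add: fscale_apply)
next
  case (add p p')
  then obtain k q k' q' where
    h: "\<And>t. poly D t \<noteq> 0 \<Longrightarrow> p (fscale (inverse (poly D t)) (L t)) * poly D t ^ k = poly q t"
    "\<And>t. poly D t \<noteq> 0 \<Longrightarrow> p' (fscale (inverse (poly D t)) (L t)) * poly D t ^ k' = poly q' t" by blast
  show ?case
    by (intro exI[of _ "k + k'"] exI[of _ "q * D ^ k' + q' * D ^ k"])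
      (simp add: h[symmetric] power_add ring_distribs mult.assoc mult.commute mult.left_commute)
next
  case (mult p p')
  then obtain k q k' q' where
    h: "\<And>t. poly D t \<noteq> 0 \<Longrightarrow> p (fscale (inverse (poly D t)) (L t)) * poly D t ^ k = poly q t"
    "\<And>t. poly D t \<noteq> 0 \<Longrightarrow> p' (fscale (inverse (poly D t)) (L t)) * poly D t ^ k' = poly q' t" by blast
  show ?case
    by (intro exI[of _ "k + k'"] exI[of _ "q * q'"])
      (simp add: h[symmetric] power_add mult.assoc mult.commute mult.left_commute)
qed

lemma G_D:
  assumes "s \<in> G"
  shows "Vector_Spaces.linear smul smul s" "bij s" "v \<in> gr i \<Longrightarrow> s v \<in> gr i"
    "ext_map s \<in> ext_elementary_automorphisms" "w \<in> gr i \<Longrightarrow> \<exists>v\<in>gr i. s v = w"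
proof -
  have s: "Vector_Spaces.linear smul smul s" "bij s" "\<And>x y. s (bracket x y) = bracket (s x) (s y)"
    "ext_map s \<in> ext_elementary_automorphisms" "s H0 = H0"
    using assms by (auto simp: G_def Aut0_def automorphisms_def)
  show "Vector_Spaces.linear smul smul s" "bij s" "ext_map s \<in> ext_elementary_automorphisms" by fact+
  interpret Vector_Spaces.linear smul smul s by (rule s(1))
  show "s v \<in> gr i" if "v \<in> gr i"
    using that s(3)[of H0 v] by (simp add: gr_eigenspace s(5) scale)
  show "\<exists>v\<in>gr i. s v = w" if w: "w \<in> gr i"
  proof -
    obtain v where v: "s v = w" using s(2) by (metis bij_pointE)
    have "s (bracket H0 v) = s (smul (of_int i) v)"
      using w by (simp add: s(3) s(5) v scale gr_eigenspace)
    hence "bracket H0 v = smul (of_int i) v" using s(2) by (simp add: bij_def inj_eq)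
    with v show ?thesis by (auto simp: gr_eigenspace)
  qed
qed

text \<open>The line of the argument joins \<open>x0\<close>, at parameter 0, to \<open>z\<close>,
  at parameter 1; \<open>PK\<close> is not identically zero on it because of \<open>x0\<close>. The
  conclusion is cross-multiplied, so that \<open>p (to_ext (s x0))\<close> need not be known to be
  non-zero.\<close>

lemma divisor_semi_invariant:
  assumes I: "ideal I" and s: "s \<in> G"
    and PK: "\<And>u. u \<in> egr UNIV {1} \<Longrightarrow>
      PK u = 0 \<longleftrightarrow> (\<exists>d\<in>egr I {- 1}. d \<noteq> 0 \<and> ext_bracket u (ext_bracket u d) = 0)"
    and PK_poly: "PK \<in> coord_polys" and p: "p \<in> coord_polys"
    and pq: "\<And>u. u \<in> egr UNIV {1} \<Longrightarrow> p u * q u = PK u"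
    and x0: "x0 \<in> gr 1" "PK (to_ext x0) \<noteq> 0" and z: "z \<in> gr 1"
  shows "p (to_ext (s z)) * p (to_ext x0) = p (to_ext (s x0)) * p (to_ext z)"
proof -
  note s' = G_D[OF s]
  obtain \<gamma> where ap: "automorphism_path I \<gamma>" and \<gamma>1: "\<And>u. u \<in> ext_space \<Longrightarrow> \<gamma> 1 u = ext_map s u"
    and Bij: "ext_map s \<in> Bij ext_space"
    using ext_elementary_path[OF I s'(4)] by blast
  note A = automorphism_pathD[OF ap]
  interpret g: Vector_Spaces.linear fscale fscale "\<gamma> t" for t by (rule polynomial_pathD(1)[OF A(1)])
  have s_egr: "\<gamma> 1 u \<in> egr UNIV S" if "u \<in> egr UNIV S" for u S
  proof -
    interpret m: Vector_Spaces.linear fscale fscale "mext s" by (rule linear_mext)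
    have "mext s u \<in> egr UNIV S"
      using that unfolding egr_def
    proof (induction rule: fs.span_induct_alt)
      case base
      show ?case by (simp add: m.zero fs.span_zero)
    next
      case (step c x y)
      then obtain i v where v: "x = to_ext v" "i \<in> S" "v \<in> gr i" by blast
      have "mext s x = to_ext (s v)" unfolding v(1) by (rule mext_to_ext[OF s'(1)])
      hence "mext s x \<in> fs.span (to_ext ` (\<Union>i\<in>S. UNIV \<inter> gr i))"
        using s'(3)[OF v(3)] v(2) by (auto intro: fs.span_base)
      with step.IH show ?case unfolding m.add m.scale by (intro fs.span_add fs.span_scale)
    qed
    with \<gamma>1 egr_ext_space[OF that] show ?thesis by (simp add: ext_map_eq_mext)
  qed
  have s_inj: "u = 0" if "u \<in> ext_space" "\<gamma> 1 u = 0" for u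
  proof -
    have "ext_map s u = ext_map s 0"
      using that \<gamma>1[OF that(1)] \<gamma>1[OF fs.subspace_0[OF subspace_ext_space]] by (simp add: g.zero)
    moreover have "inj_on (ext_map s) ext_space" using Bij by (simp add: Bij_def bij_betw_def)
    ultimately show ?thesis
      using that(1) fs.subspace_0[OF subspace_ext_space] by (auto dest: inj_onD)
  qed
  \<comment> \<open>Both end points of the path are injective and respect the grading.\<close>
  have tr0: "transversal k (\<gamma> 0)" and tr1: "transversal k (\<gamma> 1)" for k
  proof -
    have disj: "{k<..} \<inter> {..k} = {}" by auto
    show "transversal k (\<gamma> 0)" unfolding transversal_def
      using egr_disjoint[OF _ _ disj] A(4)[OF egr_ext_space] by auto
    show "transversal k (\<gamma> 1)" unfolding transversal_def
      using egr_disjoint[OF s_egr _ disj] s_inj[OF egr_ext_space] by blast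
  qed
  obtain D1 where D1: "\<And>t. poly D1 t \<noteq> 0 \<longleftrightarrow> transversal 1 (\<gamma> t)"
    and lift: "\<And>z. z \<in> egr UNIV {1} \<Longrightarrow> \<exists>L. polynomial_family L \<and> (\<forall>t. poly D1 t \<noteq> 0 \<longrightarrow>
      (\<exists>z'. z' - z \<in> egr UNIV {1<..} \<and> \<gamma> t z' \<in> egr UNIV {..1} \<and>
        L t = fscale (poly D1 t) (eproj {1} (\<gamma> t z'))))"
    using transversal_polynomial[OF A(1), of 1] by blast
  obtain D2 where D2: "\<And>t. poly D2 t \<noteq> 0 \<longleftrightarrow> transversal (- 2) (\<gamma> t)"
    using transversal_polynomial[OF A(1), of "- 2"] by blast
  obtain D3 where D3: "\<And>t. poly D3 t \<noteq> 0 \<longleftrightarrow> transversal (- 1) (\<gamma> t)"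
    using transversal_polynomial[OF A(1), of "- 1"] by blast
  obtain D4 where D4: "\<And>t. poly D4 t \<noteq> 0 \<longleftrightarrow> transversal 0 (\<gamma> t)"
    using transversal_polynomial[OF A(1), of 0] by blast
  let ?D = "D1 * D2 * D3 * D4"
  have good0: "poly ?D 0 \<noteq> 0" and good1: "poly ?D 1 \<noteq> 0"
    using D1 D2 D3 D4 tr0 tr1 by simp_all
  let ?a = "to_ext x0" and ?c = "to_ext z"
  let ?b = "?c - ?a"
  have a: "?a \<in> egr UNIV {1}" and c: "?c \<in> egr UNIV {1}" using x0 z by (auto intro: to_ext_egr)
  hence b: "?b \<in> egr UNIV {1}" by (intro egr_diff)
  obtain La where La: "polynomial_family La" "\<And>t. poly D1 t \<noteq> 0 \<Longrightarrow>
      \<exists>z'. z' - ?a \<in> egr UNIV {1<..} \<and> \<gamma> t z' \<in> egr UNIV {..1} \<and> La t = fscale (poly D1 t) (eproj {1} (\<gamma> t z'))"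
    using lift[OF a] by blast
  obtain Lb where Lb: "polynomial_family Lb" "\<And>t. poly D1 t \<noteq> 0 \<Longrightarrow>
      \<exists>z'. z' - ?b \<in> egr UNIV {1<..} \<and> \<gamma> t z' \<in> egr UNIV {..1} \<and> Lb t = fscale (poly D1 t) (eproj {1} (\<gamma> t z'))"
    using lift[OF b] by blast
  let ?la = "\<lambda>t. fscale (inverse (poly D1 t)) (La t)"
  let ?lc = "\<lambda>t. fscale (inverse (poly D1 t)) (La t + Lb t)"
  obtain R where R: "\<And>r. PK (?a + fscale r ?b) = poly R r" using coord_polys_line[OF PK_poly] by blast
  have "poly R 0 \<noteq> 0" using R[of 0] x0(2) by simp
  hence "finite {r. poly R r = 0}" by (intro poly_roots_finite) auto
  obtain M where M: "\<And>a b. \<exists>q. degree q \<le> M \<and> (\<forall>r. p (a + fscale r b) = poly q r)"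
    using coord_polys_line[OF p] by blast
  obtain V where V: "finite V" "\<And>q :: 'k alg_closure poly. degree q \<le> M \<Longrightarrow> poly q 0 \<noteq> 0 \<Longrightarrow>
      (\<And>r. poly q r = 0 \<Longrightarrow> poly R r = 0) \<Longrightarrow> poly q 1 / poly q 0 \<in> V"
    using finite_root_ratios[OF \<open>finite {r. poly R r = 0}\<close>, of M] by auto
  \<comment> \<open>\<open>?la t\<close> and \<open>?lc t\<close> are the images of
    \<open>x0\<close> and \<open>z\<close> under the Levi factor. The set \<open>V\<close> does not
    depend on \<open>t\<close>, since the degree bound \<open>M\<close> and the roots of
    \<open>R\<close> do not.\<close>
  have ratio: "\<exists>v\<in>V. p (?lc t) = v * p (?la t)" if good: "poly ?D t \<noteq> 0" for t
  proof -
    have g1: "poly D1 t \<noteq> 0" and tr: "transversal (- 2) (\<gamma> t)" "transversal (- 1) (\<gamma> t)" "transversal 0 (\<gamma> t)"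
      using good D2 D3 D4 by auto
    obtain a' where a': "a' - ?a \<in> egr UNIV {1<..}" "\<gamma> t a' \<in> egr UNIV {..1}"
      "La t = fscale (poly D1 t) (eproj {1} (\<gamma> t a'))" using La(2)[OF g1] by blast
    obtain b' where b': "b' - ?b \<in> egr UNIV {1<..}" "\<gamma> t b' \<in> egr UNIV {..1}"
      "Lb t = fscale (poly D1 t) (eproj {1} (\<gamma> t b'))" using Lb(2)[OF g1] by blast
    have la: "?la t = eproj {1} (\<gamma> t a')" using g1 a'(3) by simp
    have lc: "?lc t = eproj {1} (\<gamma> t a') + fscale 1 (eproj {1} (\<gamma> t b'))"
      using g1 a'(3) b'(3) by (simp add: fs.scale_right_distrib)
    obtain \<pi> where \<pi>: "degree \<pi> \<le> M" "\<And>r. p (eproj {1} (\<gamma> t a') + fscale r (eproj {1} (\<gamma> t b'))) = poly \<pi> r"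
      using M by blast
    \<comment> \<open>A zero of \<open>p\<close> at the Levi image of \<open>?x\<close> is a zero of
      \<open>PK\<close> there, so there is a kernel vector in degree -1, and
      \<open>Levi_kernel\<close> transports it back to \<open>?x\<close>.\<close>
    have root: "poly R r = 0" if "poly \<pi> r = 0" for r
    proof -
      let ?x = "?a + fscale r ?b" and ?x' = "a' + fscale r b'"
      have x: "?x \<in> egr UNIV {1}" by (intro egr_add egr_scale a b)
      have "?x' - ?x = (a' - ?a) + fscale r (b' - ?b)"
        by (simp add: fs.scale_right_diff_distrib algebra_simps)
      hence x': "?x' - ?x \<in> egr UNIV {1<..}"
        using a'(1) b'(1) by (simp only: egr_add egr_scale)
      have gx': "\<gamma> t ?x' \<in> egr UNIV {..1}"
        unfolding g.add g.scale using a'(2) b'(2)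
        by (intro egr_add egr_scale)
      have lx: "eproj {1} (\<gamma> t ?x') = eproj {1} (\<gamma> t a') + fscale r (eproj {1} (\<gamma> t b'))"
        by (simp only: g.add g.scale eproj_add eproj_scale)
      have lxE: "eproj {1} (\<gamma> t ?x') \<in> egr UNIV {1}" using eproj_egr[OF gx', of "{1}"] by simp
      have "p (eproj {1} (\<gamma> t ?x')) = 0" unfolding lx using \<pi>(2)[of r] that by simp
      hence "PK (eproj {1} (\<gamma> t ?x')) = 0" using pq[OF lxE] by simp
      then obtain d' where "d' \<in> egr I {- 1}" "d' \<noteq> 0"
        "ext_bracket (eproj {1} (\<gamma> t ?x')) (ext_bracket (eproj {1} (\<gamma> t ?x')) d') = 0"
        using PK[OF lxE] by blast
      from Levi_kernel[OF ap I tr x x' gx' this] PK[OF x] have "PK ?x = 0" by blast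
      with R show ?thesis by simp
    qed
    have \<pi>0: "poly \<pi> 0 \<noteq> 0" using root[of 0] \<open>poly R 0 \<noteq> 0\<close> by blast
    have "poly \<pi> 1 / poly \<pi> 0 \<in> V" by (rule V(2)[OF \<pi>(1) \<pi>0 root])
    moreover have "p (?lc t) = poly \<pi> 1" unfolding lc by (rule \<pi>(2))
    moreover have "p (?la t) = poly \<pi> 0" unfolding la using \<pi>(2)[of 0] by simp
    ultimately show ?thesis using \<pi>0 by (intro bexI[of _ "poly \<pi> 1 / poly \<pi> 0"]) auto
  qed
  obtain ka qa where qa: "\<And>t. poly D1 t \<noteq> 0 \<Longrightarrow> p (?la t) * poly D1 t ^ ka = poly qa t"
    using coord_polys_polynomial_family[OF p La(1), of D1] by blast
  obtain kc qc where qc: "\<And>t. poly D1 t \<noteq> 0 \<Longrightarrow> p (?lc t) * poly D1 t ^ kc = poly qc t"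
    using coord_polys_polynomial_family[OF p polynomial_family_add[OF La(1) Lb(1)], of D1] by blast
  \<comment> \<open>The numerator of \<open>p (?lc t) - v * p (?la t)\<close>. At each good
    \<open>t\<close> one of these finitely many numerators vanishes, so their product is the zero
    polynomial, hence one of them is: its \<open>v\<close> works for all good
    \<open>t\<close>.\<close>
  let ?N = "\<lambda>v. qc * D1 ^ ka - smult v (qa * D1 ^ kc)"
  have N: "poly (?N v) t = (p (?lc t) - v * p (?la t)) * poly D1 t ^ (ka + kc)" if "poly D1 t \<noteq> 0" for v t
    by (simp add: qa[OF that, symmetric] qc[OF that, symmetric] power_add algebra_simps)
  have "poly (?D * (\<Prod>v\<in>V. ?N v)) t = 0" for t
  proof (cases "poly ?D t = 0")
    case False
    from ratio[OF this] obtain v where v: "v \<in> V" "p (?lc t) = v * p (?la t)" by blast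
    have "poly D1 t \<noteq> 0" using False by auto
    from N[OF this, of v] v(2) have "poly (?N v) t = 0" by simp
    hence "poly (\<Prod>v\<in>V. ?N v) t = 0" unfolding poly_prod using v(1) V(1) by (intro prod_zero) auto
    thus ?thesis by (simp only: poly_mult mult_zero_right)
  qed (simp only: poly_mult mult_zero_left)
  hence "?D * (\<Prod>v\<in>V. ?N v) = 0" using poly_all_0_iff_0 by blast
  moreover have "?D \<noteq> 0" using good0 by (metis poly_0)
  ultimately have "(\<Prod>v\<in>V. ?N v) = 0" by (metis mult_eq_0_iff)
  then obtain v where v: "?N v = 0" using V(1) by auto
  have eq: "p (?lc t) = v * p (?la t)" if "poly ?D t \<noteq> 0" for t
  proof -
    have "poly D1 t \<noteq> 0" using that by auto
    with N[OF this, of v] v show ?thesis by simp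
  qed
  \<comment> \<open>The Levi factor is the identity at t = 0; \<open>l1\<close> identifies it with
    \<open>s\<close> at t = 1.\<close>
  have l0: "fscale (inverse (poly D1 0)) (L 0) = y"
    if L: "\<And>t. poly D1 t \<noteq> 0 \<Longrightarrow> \<exists>z'. z' - y \<in> egr UNIV {1<..} \<and> \<gamma> t z' \<in> egr UNIV {..1} \<and>
      L t = fscale (poly D1 t) (eproj {1} (\<gamma> t z'))" and y: "y \<in> egr UNIV {1}" for L y
  proof -
    have g1: "poly D1 0 \<noteq> 0" using good0 by auto
    obtain z' where z': "z' - y \<in> egr UNIV {1<..}" "L 0 = fscale (poly D1 0) (eproj {1} (\<gamma> 0 z'))"
      using L[OF g1] by blast
    have zy: "z' = y + (z' - y)" by simp
    have "z' \<in> ext_space"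
      using fs.subspace_add[OF subspace_ext_space egr_ext_space[OF y] egr_ext_space[OF z'(1)]] by simp
    hence "eproj {1} (\<gamma> 0 z') = eproj {1} (y + (z' - y))" using A(4) by simp
    also have "\<dots> = y"
      unfolding eproj_add using eproj_id[OF y order_refl] eproj_zero[OF z'(1), of "{1}"] by simp
    finally show ?thesis using z'(2) g1 by simp
  qed
  have l1: "fscale (inverse (poly D1 1)) (L 1) = \<gamma> 1 y"
    if L: "\<And>t. poly D1 t \<noteq> 0 \<Longrightarrow> \<exists>z'. z' - y \<in> egr UNIV {1<..} \<and> \<gamma> t z' \<in> egr UNIV {..1} \<and>
      L t = fscale (poly D1 t) (eproj {1} (\<gamma> t z'))" and y: "y \<in> egr UNIV {1}" for L y
  proof -
    have g1: "poly D1 1 \<noteq> 0" using good1 by auto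
    obtain z' where z': "z' - y \<in> egr UNIV {1<..}" "L 1 = fscale (poly D1 1) (eproj {1} (\<gamma> 1 z'))"
      using L[OF g1] by blast
    have "\<gamma> 1 z' = \<gamma> 1 (y + (z' - y))" by simp
    also have "\<dots> = \<gamma> 1 y + \<gamma> 1 (z' - y)" by (rule g.add)
    finally have "eproj {1} (\<gamma> 1 z') = eproj {1} (\<gamma> 1 y) + eproj {1} (\<gamma> 1 (z' - y))"
      by (simp only: eproj_add)
    also have "\<dots> = \<gamma> 1 y"
      using eproj_id[OF s_egr[OF y] order_refl] eproj_zero[OF s_egr[OF z'(1)], of "{1}"] by simp
    finally show ?thesis using z'(2) g1 by simp
  qed
  have "?la 0 = ?a" by (rule l0[OF La(2) a])
  moreover have "?lc 0 = ?c" using l0[OF La(2) a] l0[OF Lb(2) b] by (simp add: fs.scale_right_distrib)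
  ultimately have e0: "p ?c = v * p ?a" using eq[OF good0] by simp
  have g1_ext: "\<gamma> 1 (to_ext y) = to_ext (s y)" for y
    using \<gamma>1[OF to_ext_in_ext_space, of y] mext_to_ext[OF s'(1), of y]
    by (simp add: ext_map_eq_mext[OF to_ext_in_ext_space])
  have "?la 1 = \<gamma> 1 ?a" by (rule l1[OF La(2) a])
  moreover have "?lc 1 = \<gamma> 1 ?a + \<gamma> 1 ?b"
    using l1[OF La(2) a] l1[OF Lb(2) b] by (simp add: fs.scale_right_distrib)
  moreover have "\<gamma> 1 ?a + \<gamma> 1 ?b = \<gamma> 1 ?c" by (simp add: g.add[symmetric])
  ultimately have "p (\<gamma> 1 ?c) = v * p (\<gamma> 1 ?a)" using eq[OF good1] by simp
  hence e1: "p (to_ext (s z)) = v * p (to_ext (s x0))" unfolding g1_ext .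
  show ?thesis unfolding e0 e1 by (simp add: mult.assoc mult.left_commute)
qed

end


section \<open>Relative invariants from graded ideals\<close>

context finite_dimensional_vector_space
begin

text \<open>The dual functionals live on the whole space, as the clause \<open>functional\<close> of
  \<open>polynomial_functions\<close> requires.\<close>

lemma subspace_dual_basis:
  assumes "subspace S"
  obtains c cf where "\<And>i. i < dim S \<Longrightarrow> c i \<in> S" "span (c ` {..<dim S}) = S"
    "\<And>i. Vector_Spaces.linear scale (*) (cf i)"
    "\<And>i j. i < dim S \<Longrightarrow> j < dim S \<Longrightarrow> cf i (c j) = (if i = j then 1 else 0)"
proof -
  interpret pair: vector_space_pair scale "(*) :: 'a \<Rightarrow> 'a \<Rightarrow> 'a"
    by (intro vector_space_pair.intro vector_space_axioms vector_space_over_itself.vector_space_axioms)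
  obtain B where B: "B \<subseteq> S" "independent B" "S \<subseteq> span B" "card B = dim S"
    using basis_exists by blast
  have fin: "finite B" using B(2) by (rule finiteI_independent)
  obtain c where c: "bij_betw c {..<dim S} B"
    using ex_bij_betw_nat_finite[OF fin] B(4) by (auto simp: atLeast0LessThan)
  have img: "c ` {..<dim S} = B" using c by (simp add: bij_betw_def)
  have "\<forall>i. \<exists>g. Vector_Spaces.linear scale (*) g \<and> (\<forall>x\<in>B. g x = (if x = c i then 1 else 0))"
  proof
    fix i
    from pair.linear_independent_extend[OF B(2), of "\<lambda>x. if x = c i then 1 else 0"]
    show "\<exists>g. Vector_Spaces.linear scale (*) g \<and> (\<forall>x\<in>B. g x = (if x = c i then 1 else 0))" .
  qed
  then obtain cf where cf: "\<And>i. Vector_Spaces.linear scale (*) (cf i)"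
    "\<And>i x. x \<in> B \<Longrightarrow> cf i x = (if x = c i then 1 else 0)" by metis
  show thesis
  proof (rule that[of c cf])
    show "c i \<in> S" if "i < dim S" for i using img B(1) that by blast
    show "span (c ` {..<dim S}) = S" unfolding img
      using B assms by (intro antisym span_minimal)
    show "Vector_Spaces.linear scale (*) (cf i)" for i by (rule cf(1))
    show "cf i (c j) = (if i = j then 1 else 0)" if "i < dim S" "j < dim S" for i j
    proof -
      have "c j \<in> B" using img that by blast
      moreover have "c j = c i \<longleftrightarrow> i = j"
        using c that by (auto simp: bij_betw_def inj_on_def)
      ultimately show ?thesis using cf(2) by auto
    qed
  qed
qed

end

context vector_space
begin

lemma dual_family_expansion:
  fixes n :: nat
  assumes cf: "\<And>i. Vector_Spaces.linear scale (*) (cf i)"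
    and dual: "\<And>i j. i < n \<Longrightarrow> j < n \<Longrightarrow> cf i (c j) = (if i = j then 1 else 0)"
    and y: "y \<in> span (c ` {..<n})"
  shows "y = (\<Sum>i<n. scale (cf i y) (c i))"
  using y
proof (induction rule: span_induct_alt)
  case base
  interpret f: Vector_Spaces.linear scale "(*)" "cf i" for i by (rule cf)
  show ?case by (simp add: f.zero)
next
  case (step a x y)
  interpret f: Vector_Spaces.linear scale "(*)" "cf i" for i by (rule cf)
  obtain k where k: "x = c k" "k < n" using step.hyps by blast
  have "(\<Sum>i<n. scale (cf i x) (c i)) = (\<Sum>i<n. if i = k then c k else 0)"
    unfolding k(1) using dual k(2) by (intro sum.cong) auto
  hence x: "(\<Sum>i<n. scale (cf i x) (c i)) = x" using k by simp
  have "(\<Sum>i<n. scale (cf i (scale a x + y)) (c i))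
      = scale a (\<Sum>i<n. scale (cf i x) (c i)) + (\<Sum>i<n. scale (cf i y) (c i))"
    by (simp only: f.add f.scale scale_left_distrib sum.distrib scale_sum_right scale_scale)
  thus ?case unfolding x step.IH[symmetric] by simp
qed

lemma dual_family_independent:
  fixes n :: nat
  assumes cf: "\<And>i. Vector_Spaces.linear scale (*) (cf i)"
    and dual: "\<And>i j. i < n \<Longrightarrow> j < n \<Longrightarrow> cf i (c j) = (if i = j then 1 else 0)"
    and 0: "(\<Sum>i<n. scale (a i) (c i)) = 0"
  shows "\<forall>i<n. a i = 0"
proof (intro allI impI)
  fix k assume k: "k < n"
  interpret f: Vector_Spaces.linear scale "(*)" "cf k" by (rule cf)
  have "0 = cf k (\<Sum>i<n. scale (a i) (c i))" by (simp add: 0 f.zero)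
  also have "\<dots> = (\<Sum>i<n. a i * cf k (c i))" by (simp only: f.sum f.scale)
  also have "\<dots> = (\<Sum>i<n. if k = i then a k else 0)" using dual k by (intro sum.cong) auto
  also have "\<dots> = a k" using k by simp
  finally show "a k = 0" by simp
qed

lemma dual_family_detf_eq_0_iff:
  assumes f: "Vector_Spaces.linear scale scale f"
    and cf: "\<And>i. Vector_Spaces.linear scale (*) (cf i)"
    and cdual: "\<And>i j. i < n \<Longrightarrow> j < n \<Longrightarrow> cf i (c j) = (if i = j then 1 else 0)"
    and df: "\<And>i. Vector_Spaces.linear scale (*) (df i)"
    and ddual: "\<And>i j. i < n \<Longrightarrow> j < n \<Longrightarrow> df i (d j) = (if i = j then 1 else 0)"
    and fd: "\<And>j. j < n \<Longrightarrow> f (d j) \<in> span (c ` {..<n})"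
  shows "detf n (\<lambda>i j. cf i (f (d j))) = 0 \<longleftrightarrow> (\<exists>v\<in>span (d ` {..<n}). v \<noteq> 0 \<and> f v = 0)"
  by (rule detf_eq_0_iff_kernel[OF f dual_family_expansion[OF cf cdual fd]
        dual_family_independent[OF cf cdual] dual_family_independent[OF df ddual]])

end

context graded_semisimple_lie_algebra
begin

lemma linear_ad_square: "Vector_Spaces.linear smul smul (\<lambda>v. bracket x (bracket x v))"
  by unfold_locales (simp_all add: bracket_add_right bracket_scale_right)

lemma linear_ext_ad_square:
  "Vector_Spaces.linear fscale fscale (\<lambda>v. ext_bracket u (ext_bracket u v))"
  by unfold_locales (simp_all add: ext_bracket_add_right ext_bracket_scale_right)

lemma restrict_add: "\<lbrakk>(\<lambda>x\<in>W. p x) \<in> polynomial_functions smul W; (\<lambda>x\<in>W. q x) \<in> polynomial_functions smul W\<rbrakk>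
      \<Longrightarrow> (\<lambda>x\<in>W. p x + q x) \<in> polynomial_functions smul W"
  and restrict_mult: "\<lbrakk>(\<lambda>x\<in>W. p x) \<in> polynomial_functions smul W; (\<lambda>x\<in>W. q x) \<in> polynomial_functions smul W\<rbrakk>
      \<Longrightarrow> (\<lambda>x\<in>W. p x * q x) \<in> polynomial_functions smul W"
  using polynomial_functions.add[of "\<lambda>x\<in>W. p x" smul W "\<lambda>x\<in>W. q x"]
    polynomial_functions.mult[of "\<lambda>x\<in>W. p x" smul W "\<lambda>x\<in>W. q x"]
  by (simp_all cong: restrict_cong)

text \<open>Expanding only the outer \<open>x\<close> in \<open>Basis\<close> writes this quadratic
  function as a sum of products of two functionals.\<close>

lemma functional_ad_square_polynomial:
  assumes f: "Vector_Spaces.linear smul (*) f"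
  shows "(\<lambda>x\<in>W. f (bracket x (bracket x d))) \<in> polynomial_functions smul W"
proof -
  interpret f: Vector_Spaces.linear smul "(*)" f by fact
  have sum: "(\<lambda>x\<in>W. \<Sum>b\<in>B. p b x) \<in> polynomial_functions smul W"
    if "\<And>b. b \<in> B \<Longrightarrow> (\<lambda>x\<in>W. p b x) \<in> polynomial_functions smul W" for B :: "'v set" and p
    using that by (induction B rule: infinite_finite_induct) (auto intro: restrict_add polynomial_functions.const)
  have "f (bracket x (bracket x d)) = (\<Sum>b\<in>Basis. representation Basis x b * f (bracket b (bracket x d)))" for x
  proof -
    have "bracket x w = (\<Sum>b\<in>Basis. smul (representation Basis x b) (bracket b w))" for w
      by (subst (1) basis_expansion[of x, symmetric]) (simp only: bracket_sum_left bracket_scale_left)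
    thus ?thesis by (simp add: f.sum f.scale)
  qed
  moreover have "(\<lambda>x\<in>W. \<Sum>b\<in>Basis. representation Basis x b * f (bracket b (bracket x d)))
      \<in> polynomial_functions smul W"
  proof (intro sum restrict_mult)
    fix b
    show "(\<lambda>x\<in>W. representation Basis x b) \<in> polynomial_functions smul W"
      by (rule polynomial_functions.functional[OF linear_coordinate])
    have "Vector_Spaces.linear smul (*) (\<lambda>x. f (bracket b (bracket x d)))"
      by unfold_locales
        (simp_all add: bracket_add_left bracket_add_right bracket_scale_left bracket_scale_right f.add f.scale)
    thus "(\<lambda>x\<in>W. f (bracket b (bracket x d))) \<in> polynomial_functions smul W"
      by (rule polynomial_functions.functional)
  qed
  ultimately show ?thesis by simp
qed

text \<open>The invariant is an irreducible divisor of P_I that vanishes at a zero \<open>z0\<close>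
  of the caller's choice; \<open>e\<close> certifies that \<open>z0\<close> is one. As a divisor it
  cannot vanish where P_I does not, which is the last conclusion.\<close>

lemma exists_fundamental_relative_invariant:
  assumes I: "ideal I" and dim: "dim (I \<inter> gr 1) = dim (I \<inter> gr (- 1))"
    and x0: "x0 \<in> gr 1" "\<And>d. d \<in> I \<Longrightarrow> d \<in> gr (- 1) \<Longrightarrow> bracket x0 (bracket x0 d) = 0 \<Longrightarrow> d = 0"
    and z0: "z0 \<in> gr 1" "e \<in> I" "e \<in> gr (- 1)" "e \<noteq> 0" "bracket z0 (bracket z0 e) = 0"
  obtains p where "fundamental_relative_invariant p" "p z0 = 0"
    "\<And>x. x \<in> gr 1 \<Longrightarrow> (\<And>d. d \<in> I \<Longrightarrow> d \<in> gr (- 1) \<Longrightarrow> bracket x (bracket x d) = 0 \<Longrightarrow> d = 0) \<Longrightarrow> p x \<noteq> 0"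
proof -
  let ?n = "dim (I \<inter> gr 1)"
  have sub: "subspace (I \<inter> gr i)" for i by (intro subspace_inter ideal_subspace I gr_subspace)
  obtain c cf where c: "\<And>i. i < ?n \<Longrightarrow> c i \<in> I \<inter> gr 1" "span (c ` {..<?n}) = I \<inter> gr 1"
    and cf: "\<And>i. Vector_Spaces.linear smul (*) (cf i)"
    and cdual: "\<And>i j. i < ?n \<Longrightarrow> j < ?n \<Longrightarrow> cf i (c j) = (if i = j then 1 else 0)"
    using subspace_dual_basis[OF sub[of 1]] by blast
  obtain d df where d: "\<And>i. i < ?n \<Longrightarrow> d i \<in> I \<inter> gr (- 1)" "span (d ` {..<?n}) = I \<inter> gr (- 1)"
    and df: "\<And>i. Vector_Spaces.linear smul (*) (df i)"
    and ddual: "\<And>i j. i < ?n \<Longrightarrow> j < ?n \<Longrightarrow> df i (d j) = (if i = j then 1 else 0)"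
    using subspace_dual_basis[OF sub[of "- 1"]] unfolding dim by blast
  define A where "A = (\<lambda>x i j. cf i (bracket x (bracket x (d j))))"
  define P where "P = (\<lambda>x\<in>gr 1. detf ?n (A x))"
  define AK where "AK = (\<lambda>u i j. fext (cf i) (ext_bracket u (ext_bracket u (to_ext (d j)))))"
  define PK where "PK = (\<lambda>u. detf ?n (AK u))"
  interpret ps: polynomial_space smul "gr 1" by unfold_locales (rule gr_subspace)
  have square_I: "bracket x (bracket x v) \<in> I \<inter> gr 1" if "x \<in> gr 1" "v \<in> I \<inter> gr (- 1)" for x v
    using that gr_bracket[of x 1 v "- 1"] gr_bracket[of x 1 "bracket x v" 0]
    by (auto intro: ideal_bracket_right I)
  have P0: "P x = 0 \<longleftrightarrow> (\<exists>v\<in>I \<inter> gr (- 1). v \<noteq> 0 \<and> bracket x (bracket x v) = 0)" if x: "x \<in> gr 1" for x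
  proof -
    have "bracket x (bracket x (d j)) \<in> span (c ` {..<?n})" if "j < ?n" for j
      unfolding c(2) by (rule square_I[OF x d(1)[OF that]])
    from dual_family_detf_eq_0_iff[OF linear_ad_square[of x] cf cdual df ddual this]
    have "detf ?n (A x) = 0 \<longleftrightarrow> (\<exists>v\<in>I \<inter> gr (- 1). v \<noteq> 0 \<and> bracket x (bracket x v) = 0)"
      unfolding d(2) A_def .
    moreover have "P x = detf ?n (A x)" using x by (simp add: P_def)
    ultimately show ?thesis by (simp only:)
  qed
  have P_PF: "P \<in> ps.PF"
    unfolding P_def
  proof (rule detf_closed[where Q = "\<lambda>f. (\<lambda>x\<in>gr 1. f x) \<in> polynomial_functions smul (gr 1)"])
    show "(\<lambda>x\<in>gr 1. A x i j) \<in> polynomial_functions smul (gr 1)" for i j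
      unfolding A_def by (rule functional_ad_square_polynomial[OF cf])
  qed (rule polynomial_functions.const restrict_add restrict_mult; assumption?)+
  have hom: "P (smul s x) = s ^ (2 * ?n) * P x" if x: "x \<in> gr 1" for s x
  proof -
    interpret f: Vector_Spaces.linear smul "(*)" "cf i" for i by (rule cf)
    have "A (smul s x) = (\<lambda>i j. s\<^sup>2 * A x i j)"
      by (simp add: A_def bracket_scale_left bracket_scale_right f.scale power2_eq_square mult.assoc fun_eq_iff)
    hence "detf ?n (A (smul s x)) = (s\<^sup>2) ^ ?n * detf ?n (A x)" by (simp add: detf_scale)
    moreover have "smul s x \<in> gr 1" using x by (simp add: subspace_scale gr_subspace)
    ultimately show ?thesis using x by (simp add: P_def power_mult)
  qed
  have Px0: "P x0 \<noteq> 0" using P0[OF x0(1)] x0(2) by auto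
  have Pz0: "P z0 = 0" using P0[OF z0(1)] z0 by auto
  obtain p q where p: "p \<in> ps.PF" and q: "q \<in> ps.PF"
    and irr: "ring_irreducible\<^bsub>polynomial_ring smul (gr 1)\<^esub> p" and pz0: "p z0 = 0"
    and pq: "\<And>x. x \<in> gr 1 \<Longrightarrow> p x * q x = P x"
    using ps.exists_irreducible_divisor[OF P_PF hom x0(1) Px0 z0(1) Pz0] by blast
  have PK_ext: "PK (to_ext x) = to_ac (P x)" if x: "x \<in> gr 1" for x
  proof -
    interpret h: comm_ring_hom "to_ac :: 'k \<Rightarrow> _" by (rule comm_ring_hom_to_ac)
    have "AK (to_ext x) = (\<lambda>i j. to_ac (A x i j))"
      by (simp add: AK_def A_def ext_bracket_to_ext fext_to_ext[OF cf])
    thus ?thesis using x by (simp add: PK_def P_def h.hom_detf)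
  qed
  have coord: "(\<lambda>u. u b) \<in> coord_polys" for b :: 'v by (rule coord_polys.coord)
  have PK_poly: "PK \<in> coord_polys"
    unfolding PK_def
  proof (rule detf_closed[where Q = "\<lambda>f. f \<in> coord_polys"])
    show "(\<lambda>u. AK u i j) \<in> coord_polys" for i j
      unfolding AK_def
      by (intro fext_comp_coord_polys ext_bracket_coord_polys coord coord_polys.const)
  qed (auto intro: coord_polys.intros)
  have span_ext: "fs.span ((to_ext \<circ> c') ` {..<?n}) = egr I {i}"
    if c': "\<And>j. j < ?n \<Longrightarrow> c' j \<in> I \<inter> gr i" "span (c' ` {..<?n}) = I \<inter> gr i" for c' i
  proof
    show "fs.span ((to_ext \<circ> c') ` {..<?n}) \<subseteq> egr I {i}"
      using c'(1) by (intro fs.span_minimal subspace_egr) (auto intro: to_ext_egr)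
    have "to_ext v \<in> fs.span ((to_ext \<circ> c') ` {..<?n})" if "v \<in> span (c' ` {..<?n})" for v
      using that
    proof (induction rule: span_induct_alt)
      case (step a x y)
      hence "to_ext x \<in> (to_ext \<circ> c') ` {..<?n}" by auto
      with step.IH show ?case unfolding to_ext_add to_ext_scale
        by (intro fs.span_add fs.span_scale) (auto intro: fs.span_base)
    qed (simp add: fs.span_zero)
    thus "egr I {i} \<subseteq> fs.span ((to_ext \<circ> c') ` {..<?n})"
      unfolding egr_def c'(2) by (intro fs.span_minimal) auto
  qed
  have span_c: "fs.span ((to_ext \<circ> c) ` {..<?n}) = egr I {1}"
    and span_d: "fs.span ((to_ext \<circ> d) ` {..<?n}) = egr I {- 1}"
    by (rule span_ext, erule c(1), rule c(2), rule span_ext, erule d(1), rule d(2))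
  have PK0: "PK u = 0 \<longleftrightarrow> (\<exists>v\<in>egr I {- 1}. v \<noteq> 0 \<and> ext_bracket u (ext_bracket u v) = 0)"
    if u: "u \<in> egr UNIV {1}" for u
  proof -
    have mem: "ext_bracket u (ext_bracket u ((to_ext \<circ> d) j)) \<in> fs.span ((to_ext \<circ> c) ` {..<?n})"
      if j: "j < ?n" for j
    proof -
      have "to_ext (d j) \<in> egr I {- 1}" using d(1)[OF j] by (auto intro: to_ext_egr)
      hence "ext_bracket u (to_ext (d j)) \<in> egr I {0}" by (rule egr_bracket[OF I _ u, rotated]) simp
      hence "ext_bracket u (ext_bracket u (to_ext (d j))) \<in> egr I {1}"
        by (rule egr_bracket[OF I _ u, rotated]) simp
      hence "ext_bracket u (ext_bracket u (to_ext (d j))) \<in> fs.span ((to_ext \<circ> c) ` {..<?n})"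
        by (simp only: span_c)
      thus ?thesis by (simp only: o_apply)
    qed
    have cd: "fext (cf i) ((to_ext \<circ> c) j) = (if i = j then 1 else 0)" if "i < ?n" "j < ?n" for i j
      using cdual[OF that] by (simp add: fext_to_ext[OF cf])
    have dd: "fext (df i) ((to_ext \<circ> d) j) = (if i = j then 1 else 0)" if "i < ?n" "j < ?n" for i j
      using ddual[OF that] by (simp add: fext_to_ext[OF df])
    from fs.dual_family_detf_eq_0_iff[OF linear_ext_ad_square[of u] linear_fext cd linear_fext dd mem]
    have "detf ?n (AK u) = 0 \<longleftrightarrow> (\<exists>v\<in>fs.span ((to_ext \<circ> d) ` {..<?n}). v \<noteq> 0 \<and> ext_bracket u (ext_bracket u v) = 0)"
      unfolding AK_def o_def .
    thus ?thesis unfolding PK_def span_d .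
  qed
  obtain p' where p': "p' \<in> coord_polys" "\<And>x. x \<in> gr 1 \<Longrightarrow> p' (to_ext x) = to_ac (p x)"
    using polynomial_functions_extend[OF p] by blast
  obtain q' where q': "q' \<in> coord_polys" "\<And>x. x \<in> gr 1 \<Longrightarrow> q' (to_ext x) = to_ac (q x)"
    using polynomial_functions_extend[OF q] by blast
  \<comment> \<open>The factorization holds at rational points and extends to the closure by
    density.\<close>
  have pq': "p' u * q' u = PK u" if u: "u \<in> egr UNIV {1}" for u
  proof -
    let ?r = "\<lambda>u. p' u * q' u + (- 1) * PK u"
    have "?r \<in> coord_polys" by (intro coord_polys.intros p' q' PK_poly)
    moreover have "?r (to_ext x) = 0" if "x \<in> gr 1" for x
      using p'(2)[OF that] q'(2)[OF that] PK_ext[OF that] pq[OF that] by (simp flip: to_ac_mult)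
    moreover have "u \<in> fs.span (to_ext ` gr 1)" using u by (simp add: egr_def)
    ultimately have "?r u = 0" using coord_polys_density[OF _ gr_subspace] by blast
    thus ?thesis by simp
  qed
  have px0: "p x0 \<noteq> 0" using pq[OF x0(1)] Px0 by auto
  have semi: "p (s z) * p x0 = p (s x0) * p z" if s: "s \<in> G" and z: "z \<in> gr 1" for s z
  proof -
    have "PK (to_ext x0) \<noteq> 0" using PK_ext[OF x0(1)] Px0 by simp
    from divisor_semi_invariant[OF I s PK0 PK_poly p'(1) pq' x0(1) this z]
    have "to_ac (p (s z) * p x0) = to_ac (p (s x0) * p z)"
      using p'(2) x0(1) z G_D(3)[OF s] by simp
    thus ?thesis by (simp only: to_ac_eq_iff)
  qed
  have ratio: "p (s z) = p (s x0) / p x0 * p z" if "s \<in> G" "z \<in> gr 1" for s z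
    using semi[OF that] px0 by (simp add: field_simps)
  \<comment> \<open>The value at \<open>s\<close> is non-zero because \<open>x0 = s v\<close> for
    some \<open>v\<close> in \<open>gr 1\<close> and \<open>p x0 \<noteq> 0\<close>.\<close>
  have "character (\<lambda>s. p (s x0) / p x0)"
    unfolding character_def
  proof (intro conjI ballI)
    fix s assume s: "s \<in> G"
    obtain v where v: "v \<in> gr 1" "s v = x0" using G_D(5)[OF s x0(1)] by blast
    show "p (s x0) / p x0 \<noteq> 0" using ratio[OF s v(1)] v(2) px0 by auto
    fix t assume t: "t \<in> G"
    show "p ((s \<circ> t) x0) / p x0 = p (s x0) / p x0 * (p (t x0) / p x0)"
      using ratio[OF s G_D(3)[OF t x0(1)]] by simp
  qed
  with p ratio have "relative_invariant p" unfolding relative_invariant_def by blast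
  with irr have "fundamental_relative_invariant p" by (simp add: fundamental_relative_invariant_def)
  moreover have "p x \<noteq> 0" if x: "x \<in> gr 1"
    and inj: "\<And>d. d \<in> I \<Longrightarrow> d \<in> gr (- 1) \<Longrightarrow> bracket x (bracket x d) = 0 \<Longrightarrow> d = 0" for x
  proof -
    have "P x \<noteq> 0" using P0[OF x] inj by auto
    with pq[OF x] show ?thesis by auto
  qed
  ultimately show thesis using that pz0 by blast
qed

end

section \<open>Vanishing of the outer graded pieces\<close>

context very_special_decomposition
begin

lemma D_trivial_if_one_irreducible:
  assumes irr: one_irreducible and p: "p \<ge> 3" and v: "v \<in> D (2 * p) 0"
  shows "v = 0"
proof (rule ccontr)
  assume v0: "v \<noteq> 0"
  have vI: "v \<in> trivial_ideal" by (rule D_subset_trivial_ideal[OF p v])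
  have "smul 2 (bracket H0 v) = smul 2 (smul (of_int p) v)"
    using bracket_h1_h2[of v] v by (simp add: D_def eigenspace_def)
  hence "bracket H0 v = smul (of_int p) v" by (simp only: scale_cancel_left) simp
  hence "v \<in> gr p" by (simp add: gr_eigenspace)
  moreover obtain n where "p = int (Suc n)" using p by (metis zero_less_imp_eq_int gr0_conv_Suc less_le_trans zero_less_numeral)
  ultimately obtain w where w: "w \<in> trivial_ideal" "w \<in> gr 1" "w \<noteq> 0"
    using ideal_gr_nontrivial_descend[OF ideal_trivial_ideal vI _ v0] by blast
  obtain e where e: "e \<in> trivial_ideal" "e \<in> gr (- 1)" "e \<noteq> 0"
  proof -
    let ?e = "bracket y0 (bracket y0 w)"
    have "?e \<in> gr (- 1)" using gr_bracket[OF y0 gr_bracket[OF y0 w(2)]] by simp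
    moreover have "?e \<in> trivial_ideal" by (intro ideal_bracket_right ideal_trivial_ideal w)
    moreover have "?e \<noteq> 0" using ad_square_inj_y0[OF w(2)] w(3) by blast
    ultimately show thesis using that by blast
  qed
  \<comment> \<open>For \<open>trivial_ideal\<close> the prescribed zero is the origin, where P_C
    vanishes as soon as its degree -1 part contains some \<open>e \<noteq> 0\<close>. Any
    non-constant divisor would serve.\<close>
  have "bracket 0 (bracket 0 e) = 0" "0 \<in> gr 1" by (simp_all add: subspace_0 gr_subspace)
  then obtain f where f: "fundamental_relative_invariant f"
    "\<And>x. x \<in> gr 1 \<Longrightarrow> (\<And>d. d \<in> trivial_ideal \<Longrightarrow> d \<in> gr (- 1) \<Longrightarrow> bracket x (bracket x d) = 0 \<Longrightarrow> d = 0) \<Longrightarrow> f x \<noteq> 0"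
    using exists_fundamental_relative_invariant[OF ideal_trivial_ideal gr_dim_ideal[OF ideal_trivial_ideal]
        x0 ad_square_inj_x0 _ e] by metis
  have fx1: "f x1 \<noteq> 0" using f(2)[OF x1] ad_square_inj_x1 by blast
  \<comment> \<open>For the whole algebra the prescribed zero is \<open>x1\<close>, with kernel
    vector \<open>y2\<close>. As \<open>f x1 \<noteq> 0 = g x1\<close>, no common \<open>F\<close>
    can be proportional to both.\<close>
  obtain g where g: "fundamental_relative_invariant g" "g x1 = 0"
    using exists_fundamental_relative_invariant[OF ideal_UNIV gr_dim_ideal[OF ideal_UNIV] x0 ad_square_inj_x0
        x1 UNIV_I y2 sl2_triple_nonzero(2)[OF triple2] ad_square_y2] by metis
  obtain F where F: "\<And>F'. fundamental_relative_invariant F' \<Longrightarrow> \<exists>c. c \<noteq> 0 \<and> F' = (\<lambda>x\<in>gr 1. c * F x)"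
    using irr unfolding one_irreducible_def by blast
  obtain c where "c \<noteq> 0" "g = (\<lambda>x\<in>gr 1. c * F x)" using F[OF g(1)] by blast
  hence "F x1 = 0" using g(2) x1 by simp
  moreover obtain c' where "f = (\<lambda>x\<in>gr 1. c' * F x)" using F[OF f(1)] by blast
  ultimately have "f x1 = 0" using x1 by simp
  with fx1 show False ..
qed

lemma gr_trivial_if_one_irreducible:
  assumes irr: one_irreducible and p: "\<bar>p\<bar> \<ge> 3"
  shows "gr p = {0}"
proof -
  have pos: "gr p = {0}" if "p \<ge> 3" for p
  proof (rule ccontr)
    assume "gr p \<noteq> {0}"
    from gr_nontrivial_D[OF this that] show False
      using D_trivial_if_one_irreducible[OF irr that]
        very_special_decomposition.D_trivial_if_one_irreducible[OF swapped irr that]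
      by (auto simp: D_swapped)
  qed
  show ?thesis
  proof (cases "p \<ge> 3")
    case False
    with p have "- p \<ge> 3" "p < 0" by auto
    with pos[of "- p"] gr_negative_nontrivial[of p] show ?thesis by blast
  qed (rule pos)
qed

end

theorem mainTheorem3:
  fixes T :: "'k::field_char_0 topology"
    and smul :: "'k \<Rightarrow> 'v::ab_group_add \<Rightarrow> 'v"
    and Basis :: "'v set"
    and bracket :: "'v \<Rightarrow> 'v \<Rightarrow> 'v"
    and gr :: "int \<Rightarrow> 'v set"
    and H0 :: 'v
  assumes "local_field T"
    and "graded_semisimple_lie_algebra smul Basis bracket gr H0"
    and "graded_semisimple_lie_algebra.one_simple smul bracket gr (smul 2 H0)"
    and "graded_semisimple_lie_algebra.one_irreducible smul Basis bracket gr H0"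
    and "\<exists>h. graded_semisimple_lie_algebra.very_special smul bracket gr H0 h"
  shows "\<forall>p. \<bar>p\<bar> \<ge> 3 \<longrightarrow> gr p = {0}"
proof -
  interpret graded_semisimple_lie_algebra smul Basis bracket gr H0 by fact
  obtain h where h: "special h" "special (smul 2 H0 - h)"
    using assms(5) unfolding very_special_def by blast
  obtain x0 y0 where t0: "x0 \<in> gr 1" "y0 \<in> gr (- 1)" "sl2_triple x0 (smul 2 H0) y0"
    using assms(3) unfolding one_simple_def by blast
  obtain x1 y1 where t1: "x1 \<in> gr 1" "y1 \<in> gr (- 1)" "sl2_triple x1 h y1"
    using h(1) unfolding special_def one_simple_def by blast
  obtain x2 y2 where t2: "x2 \<in> gr 1" "y2 \<in> gr (- 1)" "sl2_triple x2 (smul 2 H0 - h) y2"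
    using h(2) unfolding special_def one_simple_def by blast
  interpret very_special_decomposition smul Basis bracket gr H0 x0 y0 x1 h y1 x2 "smul 2 H0 - h" y2
    by unfold_locales (use t0 t1 t2 h in \<open>auto simp: special_def\<close>)
  show ?thesis using gr_trivial_if_one_irreducible[OF assms(4)] by blast
qed

end
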